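(* The map $(c,q)\mapsto\Psi_{c,q}$ is a homeomorphism from $\mathfrak K$ onto the set of unital basis-positive characters of $\mathcal G$, with pointwise convergence on the tree basis. The parameter $(0,0)$ gives the counit $\varepsilon$; for $c>0$, $$\Psi_{c,q}(F_t)=c^{|t|-1}\psi_p(F_t)\quad(t\in\mathcal T),\qquad p_i=q_i/c .$$ The zero map is the only nonunital basis-positive character. The unital basis-positive characters form a commutative topological monoid under Hopf convolution $\star$. Let $q\sqcup r$ be the decreasing enumeration of the multiset union of the positive entries of $q$ and $r$, with zero padding when this union is finite. Then $$\Psi_{c,q}\star\Psi_{c',r}=\Psi_{c+c',\,q\sqcup r}\qquad\text{for all }(c,q),(c',r)\in\mathfrak K.$$ Equivalently, convolution takes the multiset union of the positive atom masses, while the dust masses add (the dust mass of $(c,q)$ being $c-\sum_iq_i$).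
   Context: Rooted trees are finite, unlabelled and non-plane (considered up to root-preserving isomorphism); $\mathcal T$ is the set of all of them, $|t|$ the number of vertices, $V(t)$ the vertex set of (a representative of) $t$; $\bullet$ is the one-vertex tree and $\tau$ the two-vertex tree. The real Grossman--Larson Hopf algebra $\mathcal G$ has basis $(F_t)_{t\in\mathcal T}$ and product $F_sF_t=\sum_{f:\{1,\dots,k\}\to V(t)}F_{t\circ_f(s_1,\dots,s_k)}$, where $s_1,\dots,s_k$ are the root branches of $s$ (the trees left after deleting the root of $s$, rooted at the children of that root, treated as distinct occurrences) and $t\circ_f(s_1,\dots,s_k)$ is the tree, with the root of $t$ as root, obtained by joining the root of each $s_i$ by an edge to $f(i)$; the unit is $F_\bullet$. If $t$ has root branches $t_1,\dots,t_k$ and, for $I\subseteq\{1,\dots,k\}$, $t_{(I)}$ denotes the tree with root branches $t_i$, $i\in I$, then $\Delta(F_t)=\sum_{I\sqcup J=\{1,\dots,k\}}F_{t_{(I)}}\otimes F_{t_{(J)}}$ (ordered bipartitions) and $\varepsilon(F_t)=\mathbf 1_{\{t=\bullet\}}$. Hopf convolution of linear functionals is $(f\star g)(x)=(f\otimes g)(\Delta x)$, with identity $\varepsilon$. A character is a multiplicative real linear functional on $\mathcal G$ (zero map allowed); it is unital if it sends $F_\bullet$ to $1$, and basis-positive if nonnegative on every $F_t$. A tree is path-forest if every non-root vertex has at most one child; for an integer partition $\lambda$, $P_\lambda$ is the path-forest tree whose root branches are chains with $\lambda_1,\lambda_2,\dots$ vertices. $\Lambda=\mathbb R[\mathsf p_1,\mathsf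 p_2,\dots]$ is the algebra of symmetric functions ($\mathsf p_k$ the power sums), $\widetilde m_\lambda=\big(\prod_{j\ge1}r_j(\lambda)!\big)m_\lambda$ ($m_\lambda$ monomial symmetric function, $r_j(\lambda)$ multiplicity of the part $j$). $\mathsf Q:\mathcal G\to\Lambda$ is the linear map (a Hopf morphism) with $\mathsf Q(F_{P_\lambda})=\widetilde m_\lambda$ and $\mathsf Q(F_t)=0$ for $t$ not path-forest. $\mathfrak K=\{(c,q):c\ge0,\ q_1\ge q_2\ge\cdots\ge0,\ \sum_iq_i\le c\}$ with the product topology. For $(c,q)\in\mathfrak K$, $\operatorname{ev}_{c,q}:\Lambda\to\mathbb R$ is the unital algebra homomorphism with $\operatorname{ev}_{c,q}(\mathsf p_1)=c$, $\operatorname{ev}_{c,q}(\mathsf p_k)=\sum_iq_i^k$ ($k\ge2$), and $\Psi_{c,q}=\operatorname{ev}_{c,q}\circ\mathsf Q$. For $p_1\ge p_2\ge\cdots\ge0$ with $\sum_ip_i\le1$, $\psi_p=\chi_p\circ\mathsf Q$ where $\chi_p$ is the unital algebra homomorphism with $\chi_p(\mathsf p_1)=1$, $\chi_p(\mathsf p_k)=\sum_ip_i^k$ ($k\ge2$). *)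

theory Defs
  imports
    "HOL-Analysis.Analysis"
    "HOL-Analysis.Finite_Function_Topology"
    "HOL-Library.Multiset"
    "HOL-Library.Poly_Mapping"
    "HOL-Algebra.Group"
begin

section \<open>Rooted trees\<close>

text \<open>A non-plane unlabelled rooted tree is determined by the multiset of its root branches.\<close>

datatype rtree = Node (branches: "rtree multiset")

primrec nverts :: "rtree \<Rightarrow> nat" where
  "nverts (Node M) = Suc (\<Sum>\<^sub># (image_mset nverts M))"

definition bullet :: rtree where
  "bullet = Node {#}"

text \<open>A representative of a tree is a rooted tree whose vertices are distinct natural numbers;
  \<open>LNode v M\<close> has the root \<open>v\<close>. The product below needs a vertex set.\<close>

datatype 'a ltree = LNode 'a "'a ltree multiset"

primrec shape :: "'a ltree \<Rightarrow> rtree" where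
  "shape (LNode v M) = Node (image_mset shape M)"

primrec labels :: "'a ltree \<Rightarrow> 'a multiset" where
  "labels (LNode v M) = add_mset v (\<Sum>\<^sub># (image_mset labels M))"

definition represents :: "'a ltree \<Rightarrow> rtree \<Rightarrow> bool" where
  "represents T t \<longleftrightarrow> shape T = t \<and> (\<forall>v. count (labels T) v \<le> 1)"

definition representative :: "rtree \<Rightarrow> nat ltree" where
  "representative t = (SOME T. represents T t)"

lemma ex_represents: "\<exists>T :: nat ltree. represents T t"
proof -
  have "\<forall>n. \<exists>T :: nat ltree. represents T t \<and> (\<forall>v \<in># labels T. n \<le> v)"
  proof (induction t)
    case (Node M)
    have "\<exists>N :: nat ltree multiset. image_mset shape N = M \<and>
        (\<forall>v. count (\<Sum>\<^sub># (image_mset labels N)) v \<le> 1) \<and>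
        (\<forall>v \<in># \<Sum>\<^sub># (image_mset labels N). n \<le> v)" for n
      using Node
    proof (induction M arbitrary: n)
      case empty
      show ?case by (rule exI[of _ "{#}"]) simp
    next
      case (add t M)
      obtain T :: "nat ltree" where T: "represents T t" "\<forall>v \<in># labels T. n \<le> v"
        using add.prems[of t] by auto
      obtain m where m: "\<forall>v \<in># labels T. v < m" "n \<le> m"
      proof
        show "\<forall>v \<in># labels T. v < n + Suc (\<Sum>\<^sub># (labels T))"
          using sum_mset.remove[of _ "labels T"] by fastforce
      qed simp
      obtain N :: "nat ltree multiset" where N: "image_mset shape N = M"
        "\<forall>v. count (\<Sum>\<^sub># (image_mset labels N)) v \<le> 1"
        "\<forall>v \<in># \<Sum>\<^sub># (image_mset labels N). m \<le> v"
        using add.IH[of m] add.prems by auto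
      have "count (labels T + \<Sum>\<^sub># (image_mset labels N)) v \<le> 1" for v
      proof (cases "v < m")
        case True
        then have "v \<notin># \<Sum>\<^sub># (image_mset labels N)" using N(3) by (metis leD)
        then have "count (\<Sum>\<^sub># (image_mset labels N)) v = 0" by (simp only: not_in_iff)
        moreover have "count (labels T) v \<le> 1" using T by (simp add: represents_def)
        ultimately show ?thesis by (simp only: count_union)
      next
        case False
        then have "v \<notin># labels T" using m by auto
        then have "count (labels T) v = 0" by (simp only: not_in_iff)
        then show ?thesis using N(2) by (simp only: count_union add_0)
      qed
      moreover have "\<forall>v \<in># labels T + \<Sum>\<^sub># (image_mset labels N). n \<le> v"
        using T(2) N(3) m(2) by (metis le_trans union_iff)
      ultimately show ?case using T(1) N(1)
        by (intro exI[of _ "add_mset T N"]) (simp add: represents_def)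
    qed
    note ex = this
    show ?case
    proof
      fix n
      obtain N :: "nat ltree multiset" where N: "image_mset shape N = M"
        "\<forall>v. count (\<Sum>\<^sub># (image_mset labels N)) v \<le> 1"
        "\<forall>v \<in># \<Sum>\<^sub># (image_mset labels N). Suc n \<le> v"
        using ex[of "Suc n"] by blast
      have "n \<notin># \<Sum>\<^sub># (image_mset labels N)" using N(3) by (metis not_less_eq_eq order_refl)
      then have "count (\<Sum>\<^sub># (image_mset labels N)) n = 0" by (simp only: not_in_iff)
      then have "represents (LNode n N) (Node M)" using N(1,2)
        by (simp add: represents_def)
      moreover have "\<forall>v \<in># labels (LNode n N). n \<le> v"
        unfolding labels.simps using N(3)
        by (metis Suc_leD insert_iff order_refl set_mset_add_mset_insert)
      ultimately show "\<exists>T :: nat ltree. represents T (Node M) \<and> (\<forall>v \<in># labels T. n \<le> v)"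
        by blast
    qed
  qed
  then show ?thesis by blast
qed

lemma represents_representative: "represents (representative t) t"
  unfolding representative_def by (rule someI_ex) (rule ex_represents)

definition vertices :: "'a ltree \<Rightarrow> 'a set" where
  "vertices T = set_mset (labels T)"

text \<open>\<open>graft g T\<close> joins, for every vertex \<open>v\<close> of \<open>T\<close>, the roots of all trees of the multiset \<open>g v\<close>
  to \<open>v\<close>, and forgets the labels.\<close>

primrec graft :: "('a \<Rightarrow> rtree multiset) \<Rightarrow> 'a ltree \<Rightarrow> rtree" where
  "graft g (LNode v M) = Node (image_mset (graft g) M + g v)"

definition branch_list :: "rtree \<Rightarrow> rtree list" where
  "branch_list t = (SOME ts. mset ts = branches t)"

lemma mset_branch_list: "mset (branch_list t) = branches t"
  unfolding branch_list_def by (rule someI_ex) (rule ex_mset)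


section \<open>The Grossman--Larson Hopf algebra\<close>

type_synonym gl = "rtree \<Rightarrow>\<^sub>0 real"
type_synonym gl2 = "(rtree \<times> rtree) \<Rightarrow>\<^sub>0 real"  \<comment> \<open>tensor square, basis \<open>F\<^sub>s \<otimes> F\<^sub>t\<close>\<close>

definition bF :: "rtree \<Rightarrow> gl" where
  "bF t = Poly_Mapping.single t 1"

definition lin_ext :: "('a \<Rightarrow> 'v::real_vector) \<Rightarrow> ('a \<Rightarrow>\<^sub>0 real) \<Rightarrow> 'v" where
  "lin_ext b x = (\<Sum>t\<in>Poly_Mapping.keys x. Poly_Mapping.lookup x t *\<^sub>R b t)"

text \<open>The branches of \<open>s\<close> are indexed by \<open>{..<k}\<close>, so equal branches stay distinct occurrences.\<close>

definition gl_basis_mult :: "rtree \<Rightarrow> rtree \<Rightarrow> gl" where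
  "gl_basis_mult s t =
     (let ss = branch_list s; k = length ss; T = representative t in
      \<Sum>f \<in> {..<k} \<rightarrow>\<^sub>E vertices T.
        bF (graft (\<lambda>v. image_mset (\<lambda>i. ss ! i) (mset_set {i. i < k \<and> f i = v})) T))"

definition gl_mult :: "gl \<Rightarrow> gl \<Rightarrow> gl" where
  "gl_mult x y = lin_ext (\<lambda>s. lin_ext (\<lambda>t. gl_basis_mult s t) y) x"

definition subtree_on :: "rtree \<Rightarrow> nat set \<Rightarrow> rtree" where
  "subtree_on t I = Node (image_mset (\<lambda>i. branch_list t ! i) (mset_set I))"

definition gl_comult :: "gl \<Rightarrow> gl2" where
  "gl_comult = lin_ext (\<lambda>t. let k = length (branch_list t) in
     \<Sum>I \<in> Pow {..<k}. Poly_Mapping.single (subtree_on t I, subtree_on t ({..<k} - I)) 1)"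

definition gl_counit :: "gl \<Rightarrow> real" where
  "gl_counit = lin_ext (\<lambda>t. if t = bullet then 1 else 0)"

definition tensor_fun :: "(gl \<Rightarrow> real) \<Rightarrow> (gl \<Rightarrow> real) \<Rightarrow> gl2 \<Rightarrow> real" where
  "tensor_fun \<phi> \<psi> = lin_ext (\<lambda>(s, t). \<phi> (bF s) * \<psi> (bF t))"

definition hconv :: "(gl \<Rightarrow> real) \<Rightarrow> (gl \<Rightarrow> real) \<Rightarrow> gl \<Rightarrow> real" (infixl "\<star>" 70) where
  "(\<phi> \<star> \<psi>) x = tensor_fun \<phi> \<psi> (gl_comult x)"


section \<open>Characters\<close>

definition gl_character :: "(gl \<Rightarrow> real) \<Rightarrow> bool" where
  "gl_character \<phi> \<longleftrightarrow> linear \<phi> \<and> (\<forall>x y. \<phi> (gl_mult x y) = \<phi> x * \<phi> y)"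

definition unital :: "(gl \<Rightarrow> real) \<Rightarrow> bool" where
  "unital \<phi> \<longleftrightarrow> \<phi> (bF bullet) = 1"

definition basis_positive :: "(gl \<Rightarrow> real) \<Rightarrow> bool" where
  "basis_positive \<phi> \<longleftrightarrow> (\<forall>t. 0 \<le> \<phi> (bF t))"

definition UPC :: "(gl \<Rightarrow> real) set" where
  "UPC = {\<phi>. gl_character \<phi> \<and> unital \<phi> \<and> basis_positive \<phi>}"

text \<open>Pointwise convergence on the tree basis.\<close>

definition UPC_top :: "(gl \<Rightarrow> real) topology" where
  "UPC_top = pullback_topology UPC (\<lambda>\<phi> t. \<phi> (bF t)) (euclidean :: (rtree \<Rightarrow> real) topology)"


section \<open>Symmetric functions\<close>

text \<open>Formal power series of bounded degree in variables \<open>x\<^sub>0, x\<^sub>1, \<dots>\<close> that are invariant under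
  permutations of the variables. A monomial is encoded as the multiset of its variable indices
  (\<open>x\<^sub>0\<^sup>2 x\<^sub>3\<close> is \<open>{#0, 0, 3#}\<close>), and a series is the function giving its coefficients.\<close>

typedef symfun = "{f :: nat multiset \<Rightarrow> real.
    (\<forall>\<pi> M. bij \<pi> \<longrightarrow> f (image_mset \<pi> M) = f M) \<and> (\<exists>d. \<forall>M. d < size M \<longrightarrow> f M = 0)}"
  morphisms sf_coeff Abs_symfun
  by (rule exI[of _ "\<lambda>_. 0"]) auto

setup_lifting type_definition_symfun

lemma finite_submsets: "finite {A. A \<subseteq># (M :: 'a multiset)}"
proof (induction M)
  case (add x M)
  have "{A. A \<subseteq># add_mset x M} \<subseteq> {A. A \<subseteq># M} \<union> add_mset x ` {A. A \<subseteq># M}"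
  proof
    fix A assume "A \<in> {A. A \<subseteq># add_mset x M}"
    then have A: "A \<subseteq># add_mset x M" by simp
    show "A \<in> {A. A \<subseteq># M} \<union> add_mset x ` {A. A \<subseteq># M}"
    proof (cases "x \<in># A")
      case True
      then obtain B where "A = add_mset x B" by (meson multi_member_split)
      then show ?thesis using A by auto
    next
      case False
      then have "A \<subseteq># M" using A by (metis diff_single_trivial subset_eq_diff_conv add_mset_add_single)
      then show ?thesis by simp
    qed
  qed
  then show ?case using add.IH by (meson finite_Un finite_imageI finite_subset)
qed simp

lemma sf_sum_commute:
  "(\<Sum>A\<in>{A. A \<subseteq># M}. f A * g (M - A)) = (\<Sum>A\<in>{A. A \<subseteq># M}. g A * (f (M - A) :: real))"
  by (rule sum.reindex_bij_witness[of _ "\<lambda>A. M - A" "\<lambda>A. M - A"])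
    (auto simp: subset_mset.diff_diff_right)

lemma sf_sum_assoc:
  "(\<Sum>A\<in>{A. A \<subseteq># M}. (\<Sum>B\<in>{B. B \<subseteq># A}. f B * g (A - B)) * h (M - A)) =
   (\<Sum>B\<in>{B. B \<subseteq># M}. f B * (\<Sum>C\<in>{C. C \<subseteq># M - B}. g C * (h (M - B - C) :: real)))"
proof -
  have "(\<Sum>A\<in>{A. A \<subseteq># M}. (\<Sum>B\<in>{B. B \<subseteq># A}. f B * g (A - B)) * h (M - A)) =
    (\<Sum>(A, B)\<in>(SIGMA A:{A. A \<subseteq># M}. {B. B \<subseteq># A}). f B * g (A - B) * h (M - A))"
    by (simp add: sum_distrib_right sum.Sigma finite_submsets)
  also have "\<dots> = (\<Sum>(B, C)\<in>(SIGMA B:{B. B \<subseteq># M}. {C. C \<subseteq># M - B}). f B * g C * h (M - B - C))"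
  proof (rule sum.reindex_bij_witness[of _ "\<lambda>(B, C). (B + C, B)" "\<lambda>(A, B). (B, A - B)"])
    fix x assume "x \<in> (SIGMA A:{A. A \<subseteq># M}. {B. B \<subseteq># A})"
    then obtain A B where x: "x = (A, B)" and A: "A \<subseteq># M" and B: "B \<subseteq># A" by auto
    obtain C where C: "A = B + C" using B by (auto simp: subset_mset.le_iff_add)
    obtain D where D: "M = B + C + D" using A C by (auto simp: subset_mset.le_iff_add)
    show "(case case x of (A, B) \<Rightarrow> (B, A - B) of (B, C) \<Rightarrow> (B + C, B)) = x"
      by (simp add: x C)
    show "(case x of (A, B) \<Rightarrow> (B, A - B)) \<in> (SIGMA B:{B. B \<subseteq># M}. {C. C \<subseteq># M - B})"
      by (simp add: x C D add.assoc)
    show "(case case x of (A, B) \<Rightarrow> (B, A - B) of (B, C) \<Rightarrow> f B * g C * h (M - B - C)) =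
        (case x of (A, B) \<Rightarrow> f B * g (A - B) * h (M - A))"
      by (simp add: x C D add.assoc)
  next
    fix y assume "y \<in> (SIGMA B:{B. B \<subseteq># M}. {C. C \<subseteq># M - B})"
    then obtain B C where y: "y = (B, C)" and B: "B \<subseteq># M" and C: "C \<subseteq># M - B" by auto
    obtain N where N: "M = B + N" using B by (auto simp: subset_mset.le_iff_add)
    have "C \<subseteq># N" using C by (simp add: N)
    then obtain D where D: "N = C + D" by (auto simp: subset_mset.le_iff_add)
    show "(case case y of (B, C) \<Rightarrow> (B + C, B) of (A, B) \<Rightarrow> (B, A - B)) = y"
      by (simp add: y)
    show "(case y of (B, C) \<Rightarrow> (B + C, B)) \<in> (SIGMA A:{A. A \<subseteq># M}. {B. B \<subseteq># A})"
      by (simp add: y N D flip: add.assoc)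
  qed
  also have "\<dots> = (\<Sum>B\<in>{B. B \<subseteq># M}. f B * (\<Sum>C\<in>{C. C \<subseteq># M - B}. g C * h (M - B - C)))"
    by (simp add: sum_distrib_left sum.Sigma finite_submsets mult.assoc)
  finally show ?thesis .
qed

lemma submsets_image_inj:
  assumes "inj \<pi>"
  shows "{A. A \<subseteq># image_mset \<pi> M} = image_mset \<pi> ` {B. B \<subseteq># M}"
proof
  show "{A. A \<subseteq># image_mset \<pi> M} \<subseteq> image_mset \<pi> ` {B. B \<subseteq># M}"
  proof
    fix A assume "A \<in> {A. A \<subseteq># image_mset \<pi> M}"
    then obtain C where "image_mset \<pi> M = A + C" by (auto simp: subset_mset.le_iff_add)
    then obtain B D where "M = B + D" "A = image_mset \<pi> B" by (auto simp: image_mset_eq_plusD dest!: image_mset_eq_plusD)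
    then show "A \<in> image_mset \<pi> ` {B. B \<subseteq># M}" by auto
  qed
qed (auto intro: image_mset_subseteq_mono)

instantiation symfun :: "{comm_ring_1, real_algebra_1}"
begin

lift_definition zero_symfun :: symfun is "\<lambda>_. 0" by auto

lift_definition one_symfun :: symfun is "\<lambda>M. if M = {#} then 1 else 0" by auto

lift_definition plus_symfun :: "symfun \<Rightarrow> symfun \<Rightarrow> symfun" is "\<lambda>f g M. f M + g M"
proof -
  fix f g :: "nat multiset \<Rightarrow> real"
  assume f: "(\<forall>\<pi> M. bij \<pi> \<longrightarrow> f (image_mset \<pi> M) = f M) \<and> (\<exists>d. \<forall>M. d < size M \<longrightarrow> f M = 0)"
    and g: "(\<forall>\<pi> M. bij \<pi> \<longrightarrow> g (image_mset \<pi> M) = g M) \<and> (\<exists>d. \<forall>M. d < size M \<longrightarrow> g M = 0)"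
  then obtain d e where "\<forall>M. d < size M \<longrightarrow> f M = 0" "\<forall>M. e < size M \<longrightarrow> g M = 0" by auto
  then have "\<forall>M. max d e < size M \<longrightarrow> f M + g M = 0" by auto
  then have "\<exists>d. \<forall>M. d < size M \<longrightarrow> f M + g M = 0" by blast
  moreover have "\<forall>\<pi> M. bij \<pi> \<longrightarrow> f (image_mset \<pi> M) + g (image_mset \<pi> M) = f M + g M"
    using f g by simp
  ultimately show "(\<forall>\<pi> M. bij \<pi> \<longrightarrow> f (image_mset \<pi> M) + g (image_mset \<pi> M) = f M + g M) \<and>
      (\<exists>d. \<forall>M. d < size M \<longrightarrow> f M + g M = 0)" by blast
qed

lift_definition uminus_symfun :: "symfun \<Rightarrow> symfun" is "\<lambda>f M. - f M" by auto

definition minus_symfun :: "symfun \<Rightarrow> symfun \<Rightarrow> symfun" where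
  "minus_symfun f g = f + (- g)"

lift_definition scaleR_symfun :: "real \<Rightarrow> symfun \<Rightarrow> symfun" is "\<lambda>r f M. r * f M" by fastforce

lift_definition times_symfun :: "symfun \<Rightarrow> symfun \<Rightarrow> symfun" is
  "\<lambda>f g M. \<Sum>A\<in>{A. A \<subseteq># M}. f A * g (M - A)"
proof -
  fix f g :: "nat multiset \<Rightarrow> real"
  assume f: "(\<forall>\<pi> M. bij \<pi> \<longrightarrow> f (image_mset \<pi> M) = f M) \<and> (\<exists>d. \<forall>M. d < size M \<longrightarrow> f M = 0)"
    and g: "(\<forall>\<pi> M. bij \<pi> \<longrightarrow> g (image_mset \<pi> M) = g M) \<and> (\<exists>d. \<forall>M. d < size M \<longrightarrow> g M = 0)"
  have "(\<Sum>A\<in>{A. A \<subseteq># image_mset \<pi> M}. f A * g (image_mset \<pi> M - A)) =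
      (\<Sum>A\<in>{A. A \<subseteq># M}. f A * g (M - A))" if "bij \<pi>" for \<pi> :: "nat \<Rightarrow> nat" and M
  proof -
    have inj: "inj \<pi>" using that by (rule bij_is_inj)
    have "inj (image_mset \<pi>)" using inj by (rule multiset.inj_map)
    then have "(\<Sum>A\<in>{A. A \<subseteq># image_mset \<pi> M}. f A * g (image_mset \<pi> M - A)) =
      (\<Sum>A\<in>{A. A \<subseteq># M}. f (image_mset \<pi> A) * g (image_mset \<pi> M - image_mset \<pi> A))"
      unfolding submsets_image_inj[OF inj] by (subst sum.reindex) (auto intro: inj_on_subset)
    also have "\<dots> = (\<Sum>A\<in>{A. A \<subseteq># M}. f A * g (M - A))"
      using f g that by (intro sum.cong) (auto simp flip: image_mset_Diff)
    finally show ?thesis .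
  qed
  moreover obtain d e where de: "\<forall>M. d < size M \<longrightarrow> f M = 0" "\<forall>M. e < size M \<longrightarrow> g M = 0"
    using f g by auto
  have "(\<Sum>A\<in>{A. A \<subseteq># M}. f A * g (M - A)) = 0" if "d + e < size M" for M
  proof (rule sum.neutral, safe)
    fix A assume "A \<subseteq># M"
    then have "size M = size A + size (M - A)"
      by (metis size_union subset_mset.add_diff_inverse)
    then have "d < size A \<or> e < size (M - A)" using that by linarith
    then show "f A * g (M - A) = 0" using de by auto
  qed
  ultimately show "(\<forall>\<pi> M. bij \<pi> \<longrightarrow>
      (\<Sum>A\<in>{A. A \<subseteq># image_mset \<pi> M}. f A * g (image_mset \<pi> M - A)) =
      (\<Sum>A\<in>{A. A \<subseteq># M}. f A * g (M - A))) \<and>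
      (\<exists>d. \<forall>M. d < size M \<longrightarrow> (\<Sum>A\<in>{A. A \<subseteq># M}. f A * g (M - A)) = 0)"
    by blast
qed

instance
proof
  fix a b c :: symfun and r s :: real
  show "a + b + c = a + (b + c)" by transfer (simp add: add.assoc)
  show "a + b = b + a" by transfer (simp add: add.commute)
  show "0 + a = a" by transfer simp
  show "- a + a = 0" by transfer simp
  show "a - b = a + - b" by (rule minus_symfun_def)
  show "r *\<^sub>R (a + b) = r *\<^sub>R a + r *\<^sub>R b" by transfer (simp add: distrib_left)
  show "(r + s) *\<^sub>R a = r *\<^sub>R a + s *\<^sub>R a" by transfer (simp add: distrib_right)
  show "r *\<^sub>R s *\<^sub>R a = (r * s) *\<^sub>R a" by transfer (simp add: mult.assoc)
  show "1 *\<^sub>R a = a" by transfer simp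
  show "a * b * c = a * (b * c)" by transfer (simp only: sf_sum_assoc)
  show comm: "a * b = b * a" for a b :: symfun
    by transfer (rule ext, rule sf_sum_commute)
  show distr: "(a + b) * c = a * c + b * c" for a b c :: symfun
    by transfer (simp add: distrib_right sum.distrib)
  show "a * (b + c) = a * b + a * c" using distr[of b c a] by (simp only: comm)
  show "r *\<^sub>R a * b = r *\<^sub>R (a * b)" by transfer (simp add: sum_distrib_left mult.assoc)
  show "a * r *\<^sub>R b = r *\<^sub>R (a * b)" by transfer (simp add: sum_distrib_left mult.left_commute)
  show one: "1 * a = a" for a :: symfun
  proof transfer
    fix a :: "nat multiset \<Rightarrow> real"
    have "(\<Sum>A\<in>{A. A \<subseteq># M}. (if A = {#} then 1 else 0) * a (M - A)) = a M" for M
    proof -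
      have "(\<Sum>A\<in>{A. A \<subseteq># M}. (if A = {#} then 1 else 0) * a (M - A)) =
          (\<Sum>A\<in>{A. A \<subseteq># M}. if A = {#} then a (M - A) else 0)"
        by (intro sum.cong) auto
      then show ?thesis by (simp add: finite_submsets)
    qed
    then show "(\<lambda>M. \<Sum>A\<in>{A. A \<subseteq># M}. (if A = {#} then 1 else 0) * a (M - A)) = a" by auto
  qed
  show "a * 1 = a" using one[of a] by (simp only: comm)
  show "(0::symfun) \<noteq> 1" by transfer (auto dest: fun_cong[of _ _ "{#}"])
qed

end

text \<open>Partitions are multisets of positive naturals. The exponents of the monomial \<open>M\<close> form the
  partition \<open>exponents M\<close>, and \<open>monomial_sf l\<close> is the sum of all monomials with exponents \<open>l\<close>.\<close>

definition exponents :: "nat multiset \<Rightarrow> nat multiset" where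
  "exponents M = image_mset (count M) (mset_set (set_mset M))"

lemma exponents_image_inj:
  assumes "inj \<pi>"
  shows "exponents (image_mset \<pi> M) = exponents M"
proof -
  have "count (image_mset \<pi> M) (\<pi> x) = count M x" for x
  proof -
    have "\<pi> -` {\<pi> x} = {x}" using assms by (auto dest: injD)
    then show ?thesis by (cases "x \<in># M") (auto simp: count_image_mset not_in_iff)
  qed
  moreover have "mset_set (\<pi> ` set_mset M) = image_mset \<pi> (mset_set (set_mset M))"
    using assms by (simp add: image_mset_mset_set inj_on_subset)
  ultimately show ?thesis by (simp add: exponents_def multiset.map_comp o_def)
qed

lemma sum_exponents: "\<Sum>\<^sub># (exponents M) = size M"
  by (simp add: exponents_def size_multiset_overloaded_eq sum_unfold_sum_mset)

lift_definition monomial_sf :: "nat multiset \<Rightarrow> symfun" is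
  "\<lambda>l M. if exponents M = l then 1 else 0"
proof -
  fix l :: "nat multiset"
  have "\<forall>M. \<Sum>\<^sub># l < size M \<longrightarrow> (if exponents M = l then 1 else 0) = (0::real)"
    by (auto simp flip: sum_exponents)
  then have "\<exists>d. \<forall>M. d < size M \<longrightarrow> (if exponents M = l then 1 else 0) = (0::real)"
    by (rule exI)
  moreover have "\<forall>\<pi> M. bij \<pi> \<longrightarrow> (if exponents (image_mset \<pi> M) = l then 1 else 0) =
        (if exponents M = l then 1 else (0::real))"
    by (simp add: exponents_image_inj bij_is_inj)
  ultimately show "(\<forall>\<pi> M. bij \<pi> \<longrightarrow> (if exponents (image_mset \<pi> M) = l then 1 else 0) =
        (if exponents M = l then 1 else (0::real))) \<and>
      (\<exists>d. \<forall>M. d < size M \<longrightarrow> (if exponents M = l then 1 else 0) = (0::real))"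
    by blast
qed

text \<open>Parts \<open>j\<close> of multiplicity 0 contribute a factor \<open>0! = 1\<close>.\<close>

definition aug_monomial_sf :: "nat multiset \<Rightarrow> symfun" where
  "aug_monomial_sf l = (\<Prod>j\<in>set_mset l. fact (count l j)) *\<^sub>R monomial_sf l"

text \<open>Meaningful for \<open>k \<ge> 1\<close>: the coefficient at \<open>M\<close> is 1 iff \<open>M\<close> is the monomial \<open>x\<^sub>i\<^sup>k\<close> for
  some \<open>i\<close>.\<close>

lift_definition power_sum :: "nat \<Rightarrow> symfun" is
  "\<lambda>k M. if \<exists>i. M = replicate_mset k i then 1 else 0"
proof -
  fix k :: nat
  have eq: "(\<exists>i. image_mset \<pi> M = replicate_mset k i) = (\<exists>i. M = replicate_mset k i)"
    if "bij \<pi>" for \<pi> :: "nat \<Rightarrow> nat" and M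
  proof
    assume "\<exists>i. image_mset \<pi> M = replicate_mset k i"
    then obtain i where "image_mset \<pi> M = replicate_mset k i" by blast
    then have "image_mset (inv_into UNIV \<pi>) (image_mset \<pi> M) =
        replicate_mset k (inv_into UNIV \<pi> i)" by simp
    moreover have "inv_into UNIV \<pi> \<circ> \<pi> = id" using that bij_is_inj inv_o_cancel by blast
    ultimately show "\<exists>i. M = replicate_mset k i" by (auto simp: multiset.map_comp)
  qed auto
  have "\<forall>(\<pi> :: nat \<Rightarrow> nat) M. bij \<pi> \<longrightarrow> (if \<exists>i. image_mset \<pi> M = replicate_mset k i then 1 else 0) =
        (if \<exists>i. M = replicate_mset k i then 1 else (0::real))"
    by (intro allI impI) (simp only: eq)
  moreover have "\<forall>M :: nat multiset. k < size M \<longrightarrow> (if \<exists>i. M = replicate_mset k i then 1 else 0) = (0::real)"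
    by auto
  ultimately show "(\<forall>(\<pi> :: nat \<Rightarrow> nat) M. bij \<pi> \<longrightarrow>
        (if \<exists>i. image_mset \<pi> M = replicate_mset k i then 1 else 0) =
        (if \<exists>i. M = replicate_mset k i then 1 else (0::real))) \<and>
      (\<exists>d. \<forall>M :: nat multiset. d < size M \<longrightarrow> (if \<exists>i. M = replicate_mset k i then 1 else 0) = (0::real))"
    by blast
qed


section \<open>Path-forest trees and the map \<open>Q\<close>\<close>

primrec is_path :: "rtree \<Rightarrow> bool" where
  "is_path (Node M) \<longleftrightarrow> size M \<le> 1 \<and> (\<forall>b \<in># image_mset is_path M. b)"

text \<open>Every non-root vertex has at most one child.\<close>

definition path_forest :: "rtree \<Rightarrow> bool" where
  "path_forest t \<longleftrightarrow> (\<forall>b \<in># branches t. is_path b)"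

text \<open>\<open>chain n\<close> is the chain with \<open>n \<ge> 1\<close> vertices.\<close>

definition chain :: "nat \<Rightarrow> rtree" where
  "chain n = ((\<lambda>t. Node {#t#}) ^^ (n - 1)) bullet"

definition path_tree :: "nat multiset \<Rightarrow> rtree" where
  "path_tree l = Node (image_mset chain l)"

text \<open>The partition \<open>\<lambda>\<close> with \<open>t = P\<^sub>\<lambda>\<close> is read off as the multiset of the sizes of the root branches
  of \<open>t\<close>; \<open>Q\<close> is characterised by \<open>Q_path_tree\<close>, \<open>Q_not_path_forest\<close> and linearity.\<close>

definition Q :: "gl \<Rightarrow> symfun" where
  "Q = lin_ext (\<lambda>t. if path_forest t
     then aug_monomial_sf (image_mset nverts (branches t)) else 0)"

lemma lin_ext_bF: "lin_ext b (bF t) = b t"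
  by (simp add: lin_ext_def bF_def)

lemma lookup_scaleR:
  fixes x :: "'a \<Rightarrow>\<^sub>0 real"
  shows "Poly_Mapping.lookup (r *\<^sub>R x) t = r * Poly_Mapping.lookup x t"
proof -
  have "finite {i. r * Poly_Mapping.lookup x i \<noteq> 0}"
    by (rule finite_subset[OF _ finite_keys[of x]]) (auto simp: in_keys_iff)
  then show ?thesis by (simp add: scaleR_poly_mapping_def lookup_Abs_poly_mapping)
qed

lemma linear_lin_ext: "linear (lin_ext (b :: 'a \<Rightarrow> 'v::real_vector))"
proof -
  have eq: "lin_ext b x = (\<Sum>t\<in>K. Poly_Mapping.lookup x t *\<^sub>R b t)"
    if "finite K" "Poly_Mapping.keys x \<subseteq> K" for x :: "'a \<Rightarrow>\<^sub>0 real" and K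
    unfolding lin_ext_def using that by (intro sum.mono_neutral_left) (auto simp: in_keys_iff)
  show ?thesis
  proof (rule linearI)
    fix x y :: "'a \<Rightarrow>\<^sub>0 real"
    let ?K = "Poly_Mapping.keys x \<union> Poly_Mapping.keys y"
    have "Poly_Mapping.keys (x + y) \<subseteq> ?K" by (rule Poly_Mapping.keys_add)
    then show "lin_ext b (x + y) = lin_ext b x + lin_ext b y"
      by (simp add: eq[of ?K] lookup_add scaleR_left_distrib sum.distrib)
  next
    fix r and x :: "'a \<Rightarrow>\<^sub>0 real"
    have "Poly_Mapping.keys (r *\<^sub>R x) \<subseteq> Poly_Mapping.keys x"
      by (auto simp: in_keys_iff lookup_scaleR)
    then show "lin_ext b (r *\<^sub>R x) = r *\<^sub>R lin_ext b x"
      by (simp add: eq[of "Poly_Mapping.keys x"] lookup_scaleR scaleR_sum_right)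
  qed
qed

lemma chain_Suc: "chain (Suc (Suc n)) = Node {#chain (Suc n)#}"
  by (simp add: chain_def)

lemma nverts_chain: "1 \<le> n \<Longrightarrow> nverts (chain n) = n"
proof (induction n rule: dec_induct)
  case base
  show ?case by (simp add: chain_def bullet_def)
next
  case (step n)
  then show ?case using chain_Suc[of "n - 1"] by simp
qed

lemma is_path_chain: "is_path (chain n)"
proof -
  have "is_path (((\<lambda>t. Node {#t#}) ^^ m) bullet)" for m
    by (induction m) (auto simp: bullet_def)
  then show ?thesis by (simp add: chain_def)
qed

lemma is_path_eq_chain: "is_path t \<Longrightarrow> t = chain (nverts t)"
proof (induction t)
  case (Node M)
  show ?case
  proof (cases "M = {#}")
    case True
    then show ?thesis by (simp add: chain_def bullet_def)
  next
    case False
    then have "size M = 1" using Node.prems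
      by (metis One_nat_def Suc_leI is_path.simps le_antisym nonempty_has_size)
    then obtain b where b: "M = {#b#}" using size_1_singleton_mset by blast
    obtain n where n: "nverts b = Suc n" by (cases b) auto
    have "b = chain (nverts b)" using Node b by auto
    then show ?thesis using b n chain_Suc[of n] by simp
  qed
qed

lemma path_forest_iff: "path_forest t \<longleftrightarrow> (\<exists>l. 0 \<notin># l \<and> t = path_tree l)"
proof
  assume t: "path_forest t"
  let ?l = "image_mset nverts (branches t)"
  have "0 \<notin># ?l"
  proof
    assume "0 \<in># ?l"
    then obtain b where "nverts b = 0" by auto
    then show False by (cases b) auto
  qed
  moreover have "image_mset chain ?l = branches t"
    using t is_path_eq_chain
    by (simp add: path_forest_def multiset.map_comp o_def cong: image_mset_cong)
  then have "t = path_tree ?l" by (simp add: path_tree_def)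
  ultimately show "\<exists>l. 0 \<notin># l \<and> t = path_tree l" by blast
qed (auto simp: path_forest_def path_tree_def is_path_chain)

lemma Q_path_tree:
  assumes "0 \<notin># l"
  shows "Q (bF (path_tree l)) = aug_monomial_sf l"
proof -
  have "image_mset nverts (image_mset chain l) = image_mset id l"
    unfolding multiset.map_comp using assms
    by (intro image_mset_cong) (auto intro!: nverts_chain simp: Suc_le_eq intro: gr0I)
  moreover have "path_forest (path_tree l)" using assms path_forest_iff by blast
  ultimately show ?thesis by (simp add: Q_def lin_ext_bF path_tree_def)
qed

lemma Q_not_path_forest: "\<not> path_forest t \<Longrightarrow> Q (bF t) = 0"
  by (simp add: Q_def lin_ext_bF)

lemma linear_Q: "linear Q"
  unfolding Q_def by (rule linear_lin_ext)


section \<open>The parametrised characters\<close>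

text \<open>Sequences \<open>q\<^sub>1, q\<^sub>2, \<dots>\<close> are indexed from 0. The type \<open>real \<times> (nat \<Rightarrow> real)\<close> carries the product
  topology.\<close>

definition KK :: "(real \<times> (nat \<Rightarrow> real)) set" where
  "KK = {(c, q). 0 \<le> c \<and> decseq q \<and> (\<forall>i. 0 \<le> q i) \<and> summable q \<and> suminf q \<le> c}"

text \<open>The symmetric functions are the polynomial algebra in the power sums, so the homomorphisms
  below exist and are unique.\<close>

definition sf_hom :: "(symfun \<Rightarrow> real) \<Rightarrow> bool" where
  "sf_hom \<phi> \<longleftrightarrow> linear \<phi> \<and> \<phi> 1 = 1 \<and> (\<forall>f g. \<phi> (f * g) = \<phi> f * \<phi> g)"

definition ev :: "real \<Rightarrow> (nat \<Rightarrow> real) \<Rightarrow> symfun \<Rightarrow> real" where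
  "ev c q = (THE \<phi>. sf_hom \<phi> \<and> \<phi> (power_sum 1) = c \<and>
     (\<forall>k\<ge>2. \<phi> (power_sum k) = suminf (\<lambda>i. q i ^ k)))"

definition \<Psi> :: "real \<Rightarrow> (nat \<Rightarrow> real) \<Rightarrow> gl \<Rightarrow> real" where
  "\<Psi> c q = ev c q \<circ> Q"

definition chi_hom :: "(nat \<Rightarrow> real) \<Rightarrow> symfun \<Rightarrow> real" where
  "chi_hom p = (THE \<phi>. sf_hom \<phi> \<and> \<phi> (power_sum 1) = 1 \<and>
     (\<forall>k\<ge>2. \<phi> (power_sum k) = suminf (\<lambda>i. p i ^ k)))"

definition psi_char :: "(nat \<Rightarrow> real) \<Rightarrow> gl \<Rightarrow> real" where
  "psi_char p = chi_hom p \<circ> Q"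

text \<open>The positive entries of \<open>s\<close> are, with multiplicity, those of \<open>q\<close> together with those of \<open>r\<close>.\<close>

definition is_atom_union :: "(nat \<Rightarrow> real) \<Rightarrow> (nat \<Rightarrow> real) \<Rightarrow> (nat \<Rightarrow> real) \<Rightarrow> bool" where
  "is_atom_union s q r \<longleftrightarrow>
     (\<exists>\<beta>. bij_betw \<beta> {i. 0 < s i} ({i. 0 < q i} <+> {i. 0 < r i}) \<and>
       (\<forall>i. 0 < s i \<longrightarrow> s i = case_sum q r (\<beta> i)))"

text \<open>A nonnegative decreasing sequence whose positive entries are finite in number is eventually
  zero, so zero padding is automatic.\<close>

definition atom_union :: "(nat \<Rightarrow> real) \<Rightarrow> (nat \<Rightarrow> real) \<Rightarrow> nat \<Rightarrow> real" (infixl "\<squnion>\<^sub>a" 65) where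
  "q \<squnion>\<^sub>a r = (THE s. decseq s \<and> (\<forall>i. 0 \<le> s i) \<and> is_atom_union s q r)"

definition dust :: "real \<Rightarrow> (nat \<Rightarrow> real) \<Rightarrow> real" where
  "dust c q = c - suminf q"

end

theory Submission
  imports Defs "HOL-Combinatorics.Permutations"
begin

text \<open>A basis-positive character vanishes on every tree that contains, with the same root, a tree on which
  it vanishes, because of \<open>F\<^sub>\<tau> F\<^sub>t = \<Sum>\<^sub>v F\<^bsub>t + leaf at v\<^esub>\<close>. Commuting \<open>F\<^sub>\<tau>\<close> with a chain shows that it vanishes
  on chains with a forked end, hence off the path-forest trees. Its values on the path-forest trees obey
  the multiplication rule of augmented monomial functions, so it comes from an algebra homomorphism of
  \<open>\<Lambda>\<close> that is nonnegative on these functions.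

  After normalising \<open>p\<^sub>1 = 1\<close> such a homomorphism is a law of exchangeable partitions. Multiplicativity makes
  the second moments of the power sums of the block frequencies factorise in the limit, so by Chebyshev's
  argument there are partitions whose frequencies have power sums converging to the given values, and
  compactness of the parameter space yields \<open>(c, q)\<close>. Conversely, the homomorphism of \<open>(c, q)\<close> is a limit of
  evaluations at finitely many nonnegative variables. The power sums determine \<open>(c, q)\<close> and are primitive,
  so that convolution adds them; adding power sums unites the atoms.\<close>

section \<open>Values on augmented monomial functions\<close>

text \<open>One recursion carries the argument because its solution is a polynomial in the numbers
  \<open>p k\<close>: uniqueness, limits and multiplicativity become inductions on the number of
  parts, and merging two parts is one operation that occurs alike in products of symmetric
  functions, in graftings and in samples. The vanishing has its source in noncommutativity: a real
  character cannot distinguish the two orders of a product although their expansions differ, and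
  positivity turns the difference into zeros. The probabilistic part is finite at each stage:
  \<open>n\<close> points are coloured with \<open>n\<close> colours, exchangeability is built into
  the weights, and only events about \<open>k + l\<close> sampled points are needed. The limit is
  taken on the parameters, not on random objects. The obstacle in the topology is dust: mass can
  leave all entries of \<open>q\<close> in a limit, so the first power sum must be the separate
  coordinate \<open>c\<close>, and the parameter space is not compact. Bounding \<open>c\<close>
  restores compactness, and \<open>c\<close> is itself a continuous function of the
  character.\<close>

text \<open>The recursion \<open>p\<^sub>k m\<^sub>l = m\<^bsub>l + (k)\<^esub> + \<Sum>\<^sub>i m\<^bsub>(\<dots>, l\<^sub>i + k, \<dots>)\<^esub>\<close> for augmented monomial functions
  determines the values \<open>M l\<close> of an algebra homomorphism on them from its values \<open>p k\<close> on power sums.\<close>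

definition monomial_values :: "(nat \<Rightarrow> real) \<Rightarrow> (nat multiset \<Rightarrow> real) \<Rightarrow> bool" where
  "monomial_values p M \<longleftrightarrow> M {#} = 1 \<and>
     (\<forall>k l. 0 < k \<longrightarrow> 0 \<notin># l \<longrightarrow>
        p k * M l = M (add_mset k l) + (\<Sum>a\<in>#l. M (add_mset (k + a) (l - {#a#}))))"

lemma monomial_values_empty: "monomial_values p M \<Longrightarrow> M {#} = 1"
  by (simp add: monomial_values_def)

lemma monomial_values_rec:
  assumes "monomial_values p M" "0 < k" "0 \<notin># l"
  shows "M (add_mset k l) = p k * M l - (\<Sum>a\<in>#l. M (add_mset (k + a) (l - {#a#})))"
  using assms by (simp add: monomial_values_def)

lemma monomial_values_single:
  assumes "monomial_values p M" "0 < k"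
  shows "M {#k#} = p k"
  using monomial_values_rec[OF assms, of "{#}"] monomial_values_empty[OF assms(1)] by simp

lemma sum_mset_cong: "(\<And>a. a \<in># A \<Longrightarrow> f a = g a) \<Longrightarrow> (\<Sum>a\<in>#A. f a) = (\<Sum>a\<in>#A. g a)"
  by (metis image_mset_cong)

lemma image_mset_fun_upd:
  assumes "finite X" "x \<in> X"
  shows "image_mset (\<tau>(x := b)) (mset_set X) = add_mset b (image_mset \<tau> (mset_set X) - {#\<tau> x#})"
proof -
  have "mset_set X = add_mset x (mset_set (X - {x}))"
    using assms by (simp add: mset_set.remove)
  moreover have "image_mset (\<tau>(x := b)) (mset_set (X - {x})) = image_mset \<tau> (mset_set (X - {x}))"
    using assms by (intro image_mset_cong) auto
  ultimately show ?thesis by simp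
qed

text \<open>Parts carried by an index set turn a merger into a function update and keep equal parts
  apart; the inductions over attached chains, splittings and samples use the recursion in this
  form.\<close>

lemma monomial_values_index:
  assumes "monomial_values p M" "finite X" "0 < k" "\<And>x. x \<in> X \<Longrightarrow> 0 < \<tau> x"
  shows "p k * M (image_mset \<tau> (mset_set X)) = M (add_mset k (image_mset \<tau> (mset_set X))) +
    (\<Sum>x\<in>X. M (image_mset (\<tau>(x := k + \<tau> x)) (mset_set X)))"
proof -
  let ?l = "image_mset \<tau> (mset_set X)"
  have "0 \<notin># ?l" using assms(2) by (auto dest!: assms(4))
  then have "p k * M ?l = M (add_mset k ?l) + (\<Sum>a\<in>#?l. M (add_mset (k + a) (?l - {#a#})))"
    using assms(1,3) by (simp add: monomial_values_def)
  also have "(\<Sum>a\<in>#?l. M (add_mset (k + a) (?l - {#a#}))) =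
      (\<Sum>x\<in>X. M (add_mset (k + \<tau> x) (?l - {#\<tau> x#})))"
    by (simp add: sum_unfold_sum_mset multiset.map_comp o_def)
  also have "\<dots> = (\<Sum>x\<in>X. M (image_mset (\<tau>(x := k + \<tau> x)) (mset_set X)))"
    using assms(2) by (intro sum.cong refl) (simp only: image_mset_fun_upd)
  finally show ?thesis .
qed

lemma tendsto_sum_mset:
  fixes f :: "'a \<Rightarrow> 'b \<Rightarrow> real"
  assumes "\<And>a. a \<in># A \<Longrightarrow> (f a \<longlongrightarrow> g a) F"
  shows "((\<lambda>n. \<Sum>a\<in>#A. f a n) \<longlongrightarrow> (\<Sum>a\<in>#A. g a)) F"
  using assms by (induction A) (auto intro!: tendsto_add)

lemma size_parts_step: "a \<in># l \<Longrightarrow> size (add_mset b (l - {#a#})) = size l"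
  by (metis insert_DiffM size_add_mset)

lemma pos_parts_step: "\<lbrakk>0 \<notin># l; 0 < (b::nat)\<rbrakk> \<Longrightarrow> 0 \<notin># add_mset b (l - {#a#})"
  by (auto dest: in_diffD)

text \<open>Solved for \<open>M (add_mset k l)\<close>, the recursion involves only multisets with
  as many parts as \<open>l\<close>, so each value is a fixed polynomial in the numbers
  \<open>p k\<close>. The induction is on the number of parts, since a merger does not lower their
  sum.\<close>

lemma monomial_values_tendsto:
  assumes "\<And>n. monomial_values (p n) (M n)" "monomial_values p' M'"
    and "\<And>k. 0 < k \<Longrightarrow> ((\<lambda>n. p n k) \<longlongrightarrow> p' k) F" and "0 \<notin># l"
  shows "((\<lambda>n. M n l) \<longlongrightarrow> M' l) F"
  using assms(4)
proof (induction "size l" arbitrary: l rule: less_induct)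
  case less
  show ?case
  proof (cases l)
    case empty
    then show ?thesis using assms(1,2)[THEN monomial_values_empty] by simp
  next
    case (add k l')
    then have k: "0 < k" "0 \<notin># l'" using less.prems by auto
    have "((\<lambda>n. \<Sum>a\<in>#l'. M n (add_mset (k + a) (l' - {#a#}))) \<longlongrightarrow>
        (\<Sum>a\<in>#l'. M' (add_mset (k + a) (l' - {#a#})))) F"
      using k by (intro tendsto_sum_mset less.hyps pos_parts_step) (simp_all only: size_parts_step add, auto)
    moreover have "((\<lambda>n. M n l') \<longlongrightarrow> M' l') F"
      using k add by (intro less.hyps) auto
    ultimately show ?thesis
      unfolding add assms(1,2)[THEN monomial_values_rec, OF k]
      using assms(3)[OF k(1)] by (intro tendsto_intros)
  qed
qed

lemma monomial_values_unique:
  assumes "monomial_values p M" "monomial_values p' M'" "\<And>k. 0 < k \<Longrightarrow> p k = p' k" "0 \<notin># l"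
  shows "M l = M' l"
proof -
  \<comment> \<open>Uniqueness is the limit statement for constant sequences.\<close>
  have "((\<lambda>n::nat. M l) \<longlongrightarrow> M' l) sequentially"
    by (rule monomial_values_tendsto[OF assms(1,2) _ assms(4)]) (simp add: assms(3))
  then show ?thesis by (simp add: LIMSEQ_const_iff)
qed

text \<open>Convergence of the power sums alone forces all values to converge, and the recursion,
  being a polynomial identity, survives. This provides the values at a general point of
  \<open>KK\<close> from finitely many variables.\<close>

lemma monomial_values_limit:
  assumes "\<And>n. monomial_values (p n) (M n)" "\<And>k. 0 < k \<Longrightarrow> (\<lambda>n. p n k) \<longlonglongrightarrow> p' k"
  shows "\<exists>M'. monomial_values p' M' \<and> (\<forall>l. 0 \<notin># l \<longrightarrow> (\<lambda>n. M n l) \<longlonglongrightarrow> M' l)"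
proof -
  have conv: "convergent (\<lambda>n. M n l)" if "0 \<notin># l" for l
    using that
  proof (induction "size l" arbitrary: l rule: less_induct)
    case less
    show ?case
    proof (cases l)
      case empty
      then show ?thesis using assms(1)[THEN monomial_values_empty] by (simp add: convergent_const)
    next
      case (add k l')
      then have k: "0 < k" "0 \<notin># l'" using less.prems by auto
      have "(\<lambda>n. M n (add_mset (k + a) (l' - {#a#}))) \<longlonglongrightarrow> lim (\<lambda>n. M n (add_mset (k + a) (l' - {#a#})))"
        if "a \<in># l'" for a
        unfolding convergent_LIMSEQ_iff[symmetric]
        using k that by (intro less.hyps pos_parts_step) (simp_all only: size_parts_step add, auto)
      then have 1: "(\<lambda>n. \<Sum>a\<in>#l'. M n (add_mset (k + a) (l' - {#a#}))) \<longlonglongrightarrow>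
          (\<Sum>a\<in>#l'. lim (\<lambda>n. M n (add_mset (k + a) (l' - {#a#}))))"
        by (rule tendsto_sum_mset)
      have 2: "(\<lambda>n. M n l') \<longlonglongrightarrow> lim (\<lambda>n. M n l')"
        unfolding convergent_LIMSEQ_iff[symmetric] using k add by (intro less.hyps) auto
      show ?thesis
        unfolding add assms(1)[THEN monomial_values_rec, OF k]
        by (rule convergentI[OF tendsto_diff[OF tendsto_mult[OF assms(2)[OF k(1)] 2] 1]])
    qed
  qed
  define M' where "M' l = lim (\<lambda>n. M n l)" for l
  have lim: "(\<lambda>n. M n l) \<longlonglongrightarrow> M' l" if "0 \<notin># l" for l
    using conv[OF that] by (simp add: M'_def convergent_LIMSEQ_iff)
  have "monomial_values p' M'"
    unfolding monomial_values_def
  proof (intro conjI allI impI)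
    show "M' {#} = 1"
      using assms(1)[THEN monomial_values_empty] by (simp add: M'_def)
  next
    fix k :: nat and l :: "nat multiset" assume k: "0 < k" "0 \<notin># l"
    have "(\<lambda>n. M n (add_mset k l) + (\<Sum>a\<in>#l. M n (add_mset (k + a) (l - {#a#})))) \<longlonglongrightarrow>
        M' (add_mset k l) + (\<Sum>a\<in>#l. M' (add_mset (k + a) (l - {#a#})))"
      using k by (intro tendsto_add tendsto_sum_mset lim pos_parts_step) auto
    moreover have "(\<lambda>n. p n k * M n l) \<longlonglongrightarrow> p' k * M' l"
      using k by (intro tendsto_mult lim assms)
    moreover have "p n k * M n l = M n (add_mset k l) + (\<Sum>a\<in>#l. M n (add_mset (k + a) (l - {#a#})))" for n
      using assms(1)[of n] k by (simp add: monomial_values_def)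
    ultimately show "p' k * M' l = M' (add_mset k l) + (\<Sum>a\<in>#l. M' (add_mset (k + a) (l - {#a#})))"
      by (simp add: LIMSEQ_unique)
  qed
  then show ?thesis using lim by blast
qed

text \<open>Every term of the recursion has the same weight \<open>k + \<Sum>\<^sub># l\<close>,
  since merging parts preserves their sum.\<close>

lemma monomial_values_scale:
  fixes c :: real
  assumes "monomial_values p M"
  shows "monomial_values (\<lambda>k. c ^ k * p k) (\<lambda>l. c ^ \<Sum>\<^sub># l * M l)"
  unfolding monomial_values_def
proof (intro conjI allI impI)
  fix k :: nat and l :: "nat multiset" assume k: "0 < k" "0 \<notin># l"
  have "c ^ (k + \<Sum>\<^sub># l) * M (add_mset (k + a) (l - {#a#})) =
      c ^ \<Sum>\<^sub># (add_mset (k + a) (l - {#a#})) * M (add_mset (k + a) (l - {#a#}))" if "a \<in># l" for a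
    using that by (auto dest!: multi_member_split simp: add.assoc)
  then have "c ^ (k + \<Sum>\<^sub># l) * (\<Sum>a\<in>#l. M (add_mset (k + a) (l - {#a#}))) =
      (\<Sum>a\<in>#l. c ^ \<Sum>\<^sub># (add_mset (k + a) (l - {#a#})) * M (add_mset (k + a) (l - {#a#})))"
    unfolding sum_mset_distrib_left by (intro sum_mset_cong)
  moreover have "c ^ (k + \<Sum>\<^sub># l) * (p k * M l) =
      c ^ (k + \<Sum>\<^sub># l) * (M (add_mset k l) + (\<Sum>a\<in>#l. M (add_mset (k + a) (l - {#a#}))))"
    using assms k by (simp add: monomial_values_def)
  ultimately show "c ^ k * p k * (c ^ \<Sum>\<^sub># l * M l) = c ^ \<Sum>\<^sub># (add_mset k l) * M (add_mset k l) +
      (\<Sum>a\<in>#l. c ^ \<Sum>\<^sub># (add_mset (k + a) (l - {#a#})) * M (add_mset (k + a) (l - {#a#})))"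
    by (simp add: distrib_left power_add mult_ac)
qed (simp add: monomial_values_empty[OF assms])

lemma monomial_values_counit: "monomial_values (\<lambda>_. 0) (\<lambda>l. if l = {#} then 1 else 0)"
  by (simp add: monomial_values_def)

subsection \<open>Finitely many variables\<close>

text \<open>The augmented monomial function of \<open>l\<close> sums over the assignments of its
  parts to distinct variables; the first variable receives no part or exactly one part
  \<open>a\<close>.\<close>

primrec eval_vars :: "real list \<Rightarrow> nat multiset \<Rightarrow> real" where
  "eval_vars [] l = (if l = {#} then 1 else 0)"
| "eval_vars (y # ys) l = eval_vars ys l + (\<Sum>a\<in>#l. y ^ a * eval_vars ys (l - {#a#}))"

text \<open>Both sides run over the ordered pairs of different occurrences in
  \<open>l\<close>.\<close>

lemma sum_mset_remove_commute:
  fixes F :: "'a \<Rightarrow> 'a \<Rightarrow> real"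
  shows "(\<Sum>a\<in>#l. \<Sum>b\<in>#l - {#a#}. F a b) = (\<Sum>a\<in>#l. \<Sum>b\<in>#l - {#a#}. F b a)"
proof (induction l)
  case (add x l)
  have "(\<Sum>b\<in>#add_mset x l - {#a#}. F a b) = F a x + (\<Sum>b\<in>#l - {#a#}. F a b)" if "a \<in># l" for F :: "'a \<Rightarrow> 'a \<Rightarrow> real" and a
    using that by (auto dest!: multi_member_split)
  then have "(\<Sum>a\<in>#l. \<Sum>b\<in>#add_mset x l - {#a#}. F a b) = (\<Sum>a\<in>#l. F a x + (\<Sum>b\<in>#l - {#a#}. F a b))"
    for F :: "'a \<Rightarrow> 'a \<Rightarrow> real"
    by (rule sum_mset_cong)
  then have "(\<Sum>a\<in>#add_mset x l. \<Sum>b\<in>#add_mset x l - {#a#}. F a b) =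
      (\<Sum>b\<in>#l. F x b) + (\<Sum>a\<in>#l. F a x) + (\<Sum>a\<in>#l. \<Sum>b\<in>#l - {#a#}. F a b)"
    for F :: "'a \<Rightarrow> 'a \<Rightarrow> real"
    by (simp add: sum_mset.distrib)
  then show ?case using add.IH by simp
qed simp

lemma sum_mset_nonneg: "(\<And>a. a \<in># A \<Longrightarrow> 0 \<le> f a) \<Longrightarrow> 0 \<le> (\<Sum>a\<in>#A. f a :: real)"
  by (induction A) auto

lemma monomial_values_eval_vars:
  "monomial_values (\<lambda>k. \<Sum>y\<leftarrow>ys. y ^ k) (eval_vars ys)"
proof (induction ys)
  case Nil
  show ?case using monomial_values_counit by (simp add: fun_eq_iff monomial_values_def)
next
  case (Cons y ys)
  let ?p = "\<lambda>k. \<Sum>y\<leftarrow>ys. y ^ k" and ?E = "eval_vars ys"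
  note rec = Cons[unfolded monomial_values_def, THEN conjunct2, rule_format]
  show ?case
    unfolding monomial_values_def
  proof (intro conjI allI impI)
    show "eval_vars (y # ys) {#} = 1" using monomial_values_empty[OF Cons] by simp
  next
    fix k :: nat and l :: "nat multiset" assume k: "0 < k" "0 \<notin># l"
    \<comment> \<open>Here \<open>y\<close> carries the part \<open>a\<close>, while the power
      \<open>k\<close> sits on another variable together with the part \<open>b\<close>. The product
      yields these terms through the induction hypothesis, the merged values yield them with the
      roles of \<open>a\<close> and \<open>b\<close> exchanged.\<close>
    let ?D = "\<Sum>a\<in>#l. \<Sum>b\<in>#l - {#a#}. y ^ a * ?E (add_mset (k + b) (l - {#a#} - {#b#}))"
    have "eval_vars (y # ys) (add_mset k l) = ?E (add_mset k l) + y ^ k * ?E l +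
        (\<Sum>a\<in>#l. y ^ a * ?E (add_mset k (l - {#a#})))"
      by (simp add: diff_add_mset_swap)
        (auto intro!: sum_mset_cong dest!: multi_member_split)
    moreover have "?p k * (\<Sum>a\<in>#l. y ^ a * ?E (l - {#a#})) =
        (\<Sum>a\<in>#l. y ^ a * ?E (add_mset k (l - {#a#}))) + ?D"
    proof -
      have "?p k * (y ^ a * ?E (l - {#a#})) = y ^ a * ?E (add_mset k (l - {#a#})) +
          (\<Sum>b\<in>#l - {#a#}. y ^ a * ?E (add_mset (k + b) (l - {#a#} - {#b#})))" if "a \<in># l" for a
      proof -
        have "0 \<notin># l - {#a#}" using k by (meson in_diffD)
        then show ?thesis using rec[OF k(1), of "l - {#a#}"]
          by (simp add: mult.left_commute distrib_left sum_mset_distrib_left)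
      qed
      then show ?thesis
        unfolding sum_mset_distrib_left sum_mset.distrib[symmetric] by (rule sum_mset_cong)
    qed
    moreover have "(\<Sum>a\<in>#l. eval_vars (y # ys) (add_mset (k + a) (l - {#a#}))) =
        (\<Sum>a\<in>#l. ?E (add_mset (k + a) (l - {#a#}))) + y ^ k * (\<Sum>a\<in>#l. y ^ a * ?E (l - {#a#})) + ?D"
    proof -
      have "(\<Sum>b\<in>#l - {#a#}. y ^ b * ?E (add_mset (k + a) (l - {#a#}) - {#b#})) =
         (\<Sum>b\<in>#l - {#a#}. y ^ b * ?E (add_mset (k + a) (l - {#b#} - {#a#})))" for a
        by (intro sum_mset_cong)
          (auto dest!: multi_member_split simp: add_mset_commute)
      then have "eval_vars (y # ys) (add_mset (k + a) (l - {#a#})) =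
         ?E (add_mset (k + a) (l - {#a#})) + y ^ k * (y ^ a * ?E (l - {#a#})) +
         (\<Sum>b\<in>#l - {#a#}. y ^ b * ?E (add_mset (k + a) (l - {#b#} - {#a#})))" for a
        by (simp add: power_add)
      moreover have "?D = (\<Sum>a\<in>#l. \<Sum>b\<in>#l - {#a#}. y ^ b * ?E (add_mset (k + a) (l - {#b#} - {#a#})))"
        by (rule sum_mset_remove_commute)
      ultimately show ?thesis
        by (simp add: sum_mset.distrib sum_mset_distrib_left)
    qed
    moreover have "?p k * ?E l = ?E (add_mset k l) + (\<Sum>a\<in>#l. ?E (add_mset (k + a) (l - {#a#})))"
      by (rule rec[OF k])
    moreover have "(\<Sum>z\<leftarrow>y # ys. z ^ k) * eval_vars (y # ys) l = ?p k * ?E l +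
       ?p k * (\<Sum>a\<in>#l. y ^ a * ?E (l - {#a#})) + y ^ k * ?E l + y ^ k * (\<Sum>a\<in>#l. y ^ a * ?E (l - {#a#}))"
      by (simp add: algebra_simps)
    ultimately show "(\<Sum>z\<leftarrow>y # ys. z ^ k) * eval_vars (y # ys) l = eval_vars (y # ys) (add_mset k l) +
        (\<Sum>a\<in>#l. eval_vars (y # ys) (add_mset (k + a) (l - {#a#})))"
      by linarith
  qed
qed

lemma eval_vars_nonneg: "(\<And>y. y \<in> set ys \<Longrightarrow> 0 \<le> y) \<Longrightarrow> 0 \<le> eval_vars ys l"
  by (induction ys arbitrary: l) (auto intro!: add_nonneg_nonneg sum_mset_nonneg mult_nonneg_nonneg)

subsection \<open>The parameter space\<close>

text \<open>The values of the power sums at the parameter: dust contributes to the first one only.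
  The entry at \<open>k = 0\<close> has no meaning, hence the guards \<open>0 < k\<close>.\<close>

definition psum :: "real \<Rightarrow> (nat \<Rightarrow> real) \<Rightarrow> nat \<Rightarrow> real" where
  "psum c q k = (if k = 1 then c else suminf (\<lambda>i. q i ^ k))"

lemma KK_D:
  assumes "(c, q) \<in> KK"
  shows "0 \<le> c" "decseq q" "0 \<le> q i" "summable q" "suminf q \<le> c"
  using assms by (auto simp: KK_def)

lemma KK_sum_le: "(c, q) \<in> KK \<Longrightarrow> finite I \<Longrightarrow> sum q I \<le> c"
  using sum_le_suminf[of q I] by (auto simp: KK_def)

lemma KK_le: "(c, q) \<in> KK \<Longrightarrow> q i \<le> c"
  using KK_sum_le[of c q "{i}"] by simp

text \<open>Partial sums replace summability by conditions on finitely many coordinates at a time,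
  which are closed in the product topology.\<close>

lemma KK_iff_partial_sums:
  "(c, q) \<in> KK \<longleftrightarrow> 0 \<le> c \<and> decseq q \<and> (\<forall>i. 0 \<le> q i) \<and> (\<forall>n. sum q {..<n} \<le> c)"
  (is "_ \<longleftrightarrow> ?R")
proof
  assume R: ?R
  then have "summable q" by (intro summableI_nonneg_bounded[of q c]) auto
  then show "(c, q) \<in> KK" using R by (auto simp: KK_def intro: suminf_le_const)
qed (auto simp: KK_def intro: order_trans[OF sum_le_suminf])

text \<open>The first \<open>i + 1\<close> entries are all at least \<open>q i\<close>. The bound
  depends on \<open>q\<close> only through \<open>c\<close>, so it can dominate a whole sequence of
  parameters.\<close>

lemma KK_decay:
  assumes "(c, q) \<in> KK"
  shows "q i \<le> c / real (Suc i)"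
proof -
  have "(\<Sum>j\<le>i. q i) \<le> (\<Sum>j\<le>i. q j)"
    using KK_D(2)[OF assms] by (intro sum_mono) (auto simp: decseq_def)
  also have "\<dots> \<le> c" by (rule KK_sum_le[OF assms]) simp
  finally show ?thesis by (simp add: field_simps)
qed

lemma KK_summable_power:
  assumes "(c, q) \<in> KK" "0 < k"
  shows "summable (\<lambda>i. q i ^ k)"
proof (rule summable_comparison_test'[of "\<lambda>i. c ^ (k - 1) * q i" 0])
  show "summable (\<lambda>i. c ^ (k - 1) * q i)" using KK_D(4)[OF assms(1)] by (rule summable_mult)
  fix i
  have "q i ^ k = q i ^ (k - 1) * q i" using assms(2) by (metis power_minus_mult)
  also have "\<dots> \<le> c ^ (k - 1) * q i"
    using KK_D(3)[OF assms(1)] KK_le[OF assms(1)] by (intro mult_right_mono power_mono) auto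
  finally show "norm (q i ^ k) \<le> c ^ (k - 1) * q i" using KK_D(3)[OF assms(1)] by simp
qed

text \<open>The mass outside the first \<open>n\<close> atoms is spread evenly over \<open>n\<close> further variables, whose higher
  power sums vanish in the limit.\<close>

lemma KK_monomial_values:
  assumes "(c, q) \<in> KK"
  shows "\<exists>M. monomial_values (psum c q) M \<and> (\<forall>l. 0 \<notin># l \<longrightarrow> 0 \<le> M l)"
proof -
  define d where "d n = c - sum q {..<n}" for n
  \<comment> \<open>\<open>Suc n\<close> avoids a division by zero, so that the first power sum
    equals \<open>c\<close> for every \<open>n\<close>, including \<open>n = 0\<close>.\<close>
  define xs where "xs n = map q [0..<Suc n] @ replicate (Suc n) (d (Suc n) / real (Suc n))" for n
  have d: "0 \<le> d n" "d n \<le> c" for n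
    using KK_sum_le[OF assms, of "{..<n}"] KK_D(3)[OF assms] by (auto simp: d_def sum_nonneg)
  have sum_xs: "(\<Sum>y\<leftarrow>xs n. y ^ k) = (\<Sum>i<Suc n. q i ^ k) + real (Suc n) * (d (Suc n) / real (Suc n)) ^ k" for n k
    unfolding xs_def
    by (simp add: o_def sum_list_replicate interv_sum_list_conv_sum_set_nat atLeast0LessThan del: upt_Suc replicate_Suc sum.lessThan_Suc)
  have "(\<lambda>n. \<Sum>y\<leftarrow>xs n. y ^ k) \<longlonglongrightarrow> psum c q k" if "0 < k" for k
  proof (cases "k = 1")
    case True
    then have "(\<Sum>y\<leftarrow>xs n. y ^ k) = c" for n using sum_xs[of 1 n] by (simp add: d_def del: sum.lessThan_Suc of_nat_Suc)
    then show ?thesis using True by (simp add: psum_def)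
  next
    case False
    then have k: "2 \<le> k" using that by simp
    have "(\<lambda>n. \<Sum>i<n. q i ^ k) \<longlonglongrightarrow> psum c q k"
      using summable_LIMSEQ[OF KK_summable_power[OF assms that]] False by (simp add: psum_def)
    then have "(\<lambda>n. \<Sum>i<Suc n. q i ^ k) \<longlonglongrightarrow> psum c q k" by (rule LIMSEQ_Suc)
    moreover have "(\<lambda>n. real (Suc n) * (d (Suc n) / real (Suc n)) ^ k) \<longlonglongrightarrow> 0"
    proof (rule tendsto_sandwich[OF _ _ tendsto_const])
      show "(\<lambda>n. c ^ k * inverse (real (Suc n))) \<longlonglongrightarrow> 0"
        using tendsto_mult_right_zero[OF LIMSEQ_inverse_real_of_nat] by blast
      show "\<forall>\<^sub>F n in sequentially. 0 \<le> real (Suc n) * (d (Suc n) / real (Suc n)) ^ k"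
        using d by (intro always_eventually allI mult_nonneg_nonneg zero_le_power divide_nonneg_nonneg) auto
      \<comment> \<open>A mass of at most \<open>c\<close> spread evenly over \<open>m\<close>
        variables has \<open>k\<close>-th power sum at most \<open>c^k m^(1-k)\<close>, hence at
        most \<open>c^k / m\<close> because \<open>k \<ge> 2\<close>.\<close>
      have "real (Suc n) * (d (Suc n) / real (Suc n)) ^ k \<le> c ^ k * inverse (real (Suc n))" for n
      proof -
        have "real (Suc n) ^ 2 \<le> real (Suc n) ^ k" using k by (intro power_increasing) auto
        then have "real (Suc n) / real (Suc n) ^ k \<le> real (Suc n) / real (Suc n) ^ 2"
          by (intro divide_left_mono) auto
        also have "\<dots> = inverse (real (Suc n))" by (simp add: power2_eq_square inverse_eq_divide del: of_nat_Suc)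
        finally have "real (Suc n) / real (Suc n) ^ k \<le> inverse (real (Suc n))" .
        moreover have "d (Suc n) ^ k \<le> c ^ k" using d by (intro power_mono)
        ultimately have "d (Suc n) ^ k * (real (Suc n) / real (Suc n) ^ k) \<le> c ^ k * inverse (real (Suc n))"
          using d KK_D(1)[OF assms] by (intro mult_mono) auto
        then show ?thesis by (simp add: power_divide mult.commute del: of_nat_Suc)
      qed
      then show "\<forall>\<^sub>F n in sequentially. real (Suc n) * (d (Suc n) / real (Suc n)) ^ k \<le> c ^ k * inverse (real (Suc n))"
        by (intro always_eventually allI)
    qed
    ultimately show ?thesis unfolding sum_xs using tendsto_add[of _ "psum c q k" sequentially _ 0] by simp
  qed
  then obtain M where M: "monomial_values (psum c q) M"
    and lim: "\<And>l. 0 \<notin># l \<Longrightarrow> (\<lambda>n. eval_vars (xs n) l) \<longlonglongrightarrow> M l"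
    using monomial_values_limit[OF monomial_values_eval_vars] by blast
  have "0 \<le> y" if "y \<in> set (xs n)" for y n
    using that d[of "Suc n"] KK_D(3)[OF assms] unfolding xs_def by (auto simp del: upt_Suc replicate_Suc)
  then have "0 \<le> eval_vars (xs n) l" for n l by (rule eval_vars_nonneg)
  then have "0 \<le> M l" if "0 \<notin># l" for l
    using lim[OF that] by (intro LIMSEQ_le_const) auto
  then show ?thesis using M by blast
qed

text \<open>The choice is immaterial: the recursion determines the values on multisets of positive
  parts, and only these are evaluated.\<close>

definition KK_values :: "real \<Rightarrow> (nat \<Rightarrow> real) \<Rightarrow> nat multiset \<Rightarrow> real" where
  "KK_values c q = (SOME M. monomial_values (psum c q) M \<and> (\<forall>l. 0 \<notin># l \<longrightarrow> 0 \<le> M l))"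

lemma KK_values:
  assumes "(c, q) \<in> KK"
  shows "monomial_values (psum c q) (KK_values c q)" "0 \<notin># l \<Longrightarrow> 0 \<le> KK_values c q l"
  using someI_ex[OF KK_monomial_values[OF assms]] by (simp_all add: KK_values_def)

section \<open>Symmetric functions\<close>

lemma sum_mset_sum_swap:
  fixes F :: "'a \<Rightarrow> 'b \<Rightarrow> real"
  shows "(\<Sum>a\<in>#A. \<Sum>i\<in>S. F a i) = (\<Sum>i\<in>S. \<Sum>a\<in>#A. F a i)"
  by (induction A) (simp_all add: sum.distrib)

definition parts_fact :: "nat multiset \<Rightarrow> real" where
  "parts_fact l = (\<Prod>j\<in>set_mset l. fact (count l j))"

lemma parts_fact_pos: "0 < parts_fact l"
  by (simp add: parts_fact_def prod_pos)

lemma parts_fact_add: "parts_fact (add_mset a l) = (real (count l a) + 1) * parts_fact l"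
proof -
  have superset: "parts_fact m = (\<Prod>j\<in>insert a (set_mset l). fact (count m j))" if "set_mset m \<subseteq> insert a (set_mset l)" for m
    unfolding parts_fact_def using that by (intro prod.mono_neutral_left) (auto simp: not_in_iff)
  have "(\<Prod>j\<in>insert a (set_mset l) - {a}. fact (count (add_mset a l) j)) = (\<Prod>j\<in>insert a (set_mset l) - {a}. fact (count l j) :: real)"
    by (intro prod.cong) auto
  moreover have "parts_fact (add_mset a l) = (\<Prod>j\<in>insert a (set_mset l). fact (count (add_mset a l) j))"
    and "parts_fact l = (\<Prod>j\<in>insert a (set_mset l). fact (count l j))"
    by (rule superset, auto)+
  ultimately show ?thesis
    by (simp add: prod.insert_remove algebra_simps)
qed

lemma sf_coeff_aug: "sf_coeff (aug_monomial_sf l) M = (if exponents M = l then parts_fact l else 0)"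
  by (simp add: aug_monomial_sf_def scaleR_symfun.rep_eq monomial_sf.rep_eq parts_fact_def)

lemma exponents_pos: "0 \<notin># exponents M"
  by (auto simp: exponents_def count_eq_zero_iff)

lemma exponents_add_replicate:
  assumes "i \<notin># M" "0 < k"
  shows "exponents (replicate_mset k i + M) = add_mset k (exponents M)"
proof -
  have "set_mset (replicate_mset k i + M) = insert i (set_mset M)" using assms by auto
  moreover have "image_mset (count (replicate_mset k i + M)) (mset_set (set_mset M)) = image_mset (count M) (mset_set (set_mset M))"
    using assms by (intro image_mset_cong) auto
  ultimately show ?thesis using assms by (simp add: exponents_def not_in_iff)
qed

lemma exponents_remove:
  assumes "i \<in># M"
  shows "exponents M = add_mset (count M i) (exponents (M - replicate_mset (count M i) i))"
proof -
  have "M = replicate_mset (count M i) i + (M - replicate_mset (count M i) i)"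
    by (simp add: multiset_eq_iff)
  moreover have "i \<notin># M - replicate_mset (count M i) i" by (simp add: not_in_iff)
  ultimately show ?thesis using exponents_add_replicate assms by (metis count_greater_zero_iff)
qed

lemma count_exponents: "count (exponents M) k = card {i \<in> set_mset M. count M i = k}"
proof -
  have "count (exponents M) k = (\<Sum>i\<in>count M -` {k} \<inter> set_mset M. 1)"
    by (simp add: exponents_def count_image_mset)
  also have "count M -` {k} \<inter> set_mset M = {i \<in> set_mset M. count M i = k}" by auto
  finally show ?thesis by simp
qed

text \<open>An augmented function counts the ways to hand its parts to distinct variables. Here the
  ways are sorted by the variable that receives the part \<open>k\<close>.\<close>

lemma aug_expand_part:
  assumes "0 < k"
  shows "sf_coeff (aug_monomial_sf (add_mset k l)) M =
    (\<Sum>i | i \<in># M \<and> count M i = k. sf_coeff (aug_monomial_sf l) (M - replicate_mset k i))"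
proof -
  have "(exponents (M - replicate_mset k i) = l) = (exponents M = add_mset k l)" if "i \<in># M" "count M i = k" for i
    using exponents_remove[of i M] that by auto
  then have "(\<Sum>i | i \<in># M \<and> count M i = k. sf_coeff (aug_monomial_sf l) (M - replicate_mset k i)) =
      (\<Sum>i | i \<in># M \<and> count M i = k. if exponents M = add_mset k l then parts_fact l else 0)"
    by (intro sum.cong) (auto simp: sf_coeff_aug)
  also have "\<dots> = (if exponents M = add_mset k l then real (count (add_mset k l) k) * parts_fact l else 0)"
    by (auto simp del: count_add_mset simp flip: count_exponents)
  finally show ?thesis by (simp add: sf_coeff_aug parts_fact_add add.commute)
qed

text \<open>The same count, sorted by the part that a fixed variable \<open>i\<close> of
  \<open>M\<close> receives.\<close>

lemma aug_expand_variable: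
  assumes "i \<in># M"
  shows "sf_coeff (aug_monomial_sf l) M =
    (\<Sum>a\<in>#l. if count M i = a then sf_coeff (aug_monomial_sf (l - {#a#})) (M - replicate_mset a i) else 0)"
proof -
  define a where "a = count M i"
  have e: "exponents M = add_mset a (exponents (M - replicate_mset a i))"
    using exponents_remove[OF assms] by (simp add: a_def)
  have "(\<Sum>b\<in>#l. if a = b then sf_coeff (aug_monomial_sf (l - {#b#})) (M - replicate_mset b i) else 0) =
      (\<Sum>b\<in>#l. if b = a then sf_coeff (aug_monomial_sf (l - {#a#})) (M - replicate_mset a i) else 0)"
    by (rule sum_mset_cong) auto
  also have "\<dots> = sf_coeff (aug_monomial_sf (l - {#a#})) (M - replicate_mset a i) * real (count l a)"
    by (simp add: sum_mset_delta)
  also have "\<dots> = sf_coeff (aug_monomial_sf l) M"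
  proof (cases "a \<in># l")
    case True
    then obtain l' where l: "l = add_mset a l'" by (meson multi_member_split)
    show ?thesis unfolding l by (simp add: sf_coeff_aug e parts_fact_add)
  next
    case False
    then have "exponents M \<noteq> l" using e by auto
    then show ?thesis using False by (simp add: sf_coeff_aug not_in_iff)
  qed
  finally show ?thesis by (simp add: a_def)
qed

lemma sf_coeff_power_sum_mult:
  assumes "0 < k"
  shows "sf_coeff (power_sum k * f) M = (\<Sum>i | i \<in># M \<and> k \<le> count M i. sf_coeff f (M - replicate_mset k i))"
proof -
  have "sf_coeff (power_sum k * f) M =
      (\<Sum>A | A \<subseteq># M. (if \<exists>i. A = replicate_mset k i then 1 else 0) * sf_coeff f (M - A))"
    by (simp add: times_symfun.rep_eq power_sum.rep_eq)
  also have "\<dots> = (\<Sum>A\<in>replicate_mset k ` {i. i \<in># M \<and> k \<le> count M i}. sf_coeff f (M - A))"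
  proof (rule sum.mono_neutral_cong_right[OF finite_submsets])
    show "replicate_mset k ` {i. i \<in># M \<and> k \<le> count M i} \<subseteq> {A. A \<subseteq># M}"
      by (auto simp flip: count_le_replicate_mset_subset_eq)
    have "i \<in># M \<and> k \<le> count M i" if "replicate_mset k i \<subseteq># M" for i
      using that assms by (auto simp flip: count_le_replicate_mset_subset_eq intro: count_inI)
    then show "\<forall>A\<in>{A. A \<subseteq># M} - replicate_mset k ` {i. i \<in># M \<and> k \<le> count M i}.
        (if \<exists>i. A = replicate_mset k i then 1 else 0) * sf_coeff f (M - A) = 0"
      by auto
  qed auto
  also have "\<dots> = (\<Sum>i | i \<in># M \<and> k \<le> count M i. sf_coeff f (M - replicate_mset k i))"
    using assms by (subst sum.reindex) (auto intro!: inj_onI dest: arg_cong[where f = set_mset] split: if_splits)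
  finally show ?thesis .
qed

lemma sf_eqI: "(\<And>M. sf_coeff f M = sf_coeff g M) \<Longrightarrow> f = g"
  by (simp add: sf_coeff_inject[symmetric] fun_eq_iff)

lemma sf_coeff_sum_mset: "sf_coeff (\<Sum>a\<in>#A. f a) M = (\<Sum>a\<in>#A. sf_coeff (f a) M)"
  by (induction A) (simp_all add: zero_symfun.rep_eq plus_symfun.rep_eq)

lemma diff_replicate_mset_add:
  "M - replicate_mset (m + n) x = M - replicate_mset m x - replicate_mset n x"
  by (simp add: multiset_eq_iff)

text \<open>The power sum multiplies by the \<open>k\<close>-th power of some variable. If this
  variable is new, its exponent in \<open>M\<close> is \<open>k\<close> and \<open>k\<close> is a
  part of its own; if it already carries a part \<open>a\<close>, the exponent exceeds
  \<open>k\<close> and the two parts merge.\<close>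

lemma power_sum_mult_aug:
  assumes "0 < k" "0 \<notin># l"
  shows "power_sum k * aug_monomial_sf l =
    aug_monomial_sf (add_mset k l) + (\<Sum>a\<in>#l. aug_monomial_sf (add_mset (k + a) (l - {#a#})))"
proof (rule sf_eqI)
  fix M :: "nat multiset"
  let ?c = "\<lambda>l. sf_coeff (aug_monomial_sf l)"
  have "(\<Sum>a\<in>#l. ?c (add_mset (k + a) (l - {#a#})) M) =
      (\<Sum>a\<in>#l. \<Sum>i | i \<in># M \<and> count M i = k + a. ?c (l - {#a#}) (M - replicate_mset (k + a) i))"
    using assms by (intro sum_mset_cong aug_expand_part) simp
  also have "\<dots> = (\<Sum>a\<in>#l. \<Sum>i | i \<in># M \<and> k < count M i. if count M i = k + a
      then ?c (l - {#a#}) (M - replicate_mset (k + a) i) else 0)"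
  proof (rule sum_mset_cong)
    fix a assume "a \<in># l"
    then have a: "0 < a" using assms by (auto intro: gr0I)
    show "(\<Sum>i | i \<in># M \<and> count M i = k + a. ?c (l - {#a#}) (M - replicate_mset (k + a) i)) =
      (\<Sum>i | i \<in># M \<and> k < count M i. if count M i = k + a
      then ?c (l - {#a#}) (M - replicate_mset (k + a) i) else 0)"
      using a by (intro sum.mono_neutral_cong_left) auto
  qed
  also have "\<dots> = (\<Sum>i | i \<in># M \<and> k < count M i. \<Sum>a\<in>#l. if count M i = k + a
      then ?c (l - {#a#}) (M - replicate_mset (k + a) i) else 0)"
    by (rule sum_mset_sum_swap)
  also have "\<dots> = (\<Sum>i | i \<in># M \<and> k < count M i. ?c l (M - replicate_mset k i))"
  proof (rule sum.cong[OF refl])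
    fix i assume "i \<in> {i. i \<in># M \<and> k < count M i}"
    then have i: "i \<in># M - replicate_mset k i" "k < count M i" by (auto simp: in_diff_count)
    show "(\<Sum>a\<in>#l. if count M i = k + a then ?c (l - {#a#}) (M - replicate_mset (k + a) i) else 0) =
        ?c l (M - replicate_mset k i)"
      unfolding aug_expand_variable[OF i(1)] using i(2)
      by (intro sum_mset_cong) (auto simp: diff_replicate_mset_add)
  qed
  finally have 1: "(\<Sum>a\<in>#l. ?c (add_mset (k + a) (l - {#a#})) M) =
    (\<Sum>i | i \<in># M \<and> k < count M i. ?c l (M - replicate_mset k i))" .
  have "{i. i \<in># M \<and> k \<le> count M i} = {i. i \<in># M \<and> count M i = k} \<union> {i. i \<in># M \<and> k < count M i}"
    by auto
  then have "(\<Sum>i | i \<in># M \<and> k \<le> count M i. ?c l (M - replicate_mset k i)) =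
      (\<Sum>i | i \<in># M \<and> count M i = k. ?c l (M - replicate_mset k i)) +
      (\<Sum>i | i \<in># M \<and> k < count M i. ?c l (M - replicate_mset k i))"
    by (simp only:) (rule sum.union_disjoint, auto)
  then show "sf_coeff (power_sum k * aug_monomial_sf l) M = sf_coeff (aug_monomial_sf (add_mset k l) +
      (\<Sum>a\<in>#l. aug_monomial_sf (add_mset (k + a) (l - {#a#})))) M"
    using 1 by (simp add: sf_coeff_power_sum_mult[OF assms(1)] aug_expand_part[OF assms(1)]
      plus_symfun.rep_eq sf_coeff_sum_mset)
qed

lemma aug_monomial_empty: "aug_monomial_sf {#} = 1"
proof (rule sf_eqI)
  fix M
  have "exponents M = {#} \<longleftrightarrow> M = {#}" by (simp add: exponents_def mset_set_empty_iff)
  then show "sf_coeff (aug_monomial_sf {#}) M = sf_coeff 1 M"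
    by (simp add: sf_coeff_aug one_symfun.rep_eq parts_fact_def)
qed

lemma power_sum_eq_aug: "0 < k \<Longrightarrow> power_sum k = aug_monomial_sf {#k#}"
  using power_sum_mult_aug[of k "{#}"] by (simp add: aug_monomial_empty)

section \<open>Expansion in augmented monomial functions\<close>

text \<open>On a finite set containing all variables of both monomials, the exponents padded by
  zeros form the same multiset, so a permutation of that set carries one monomial to the other.
  Extended by the identity it is a bijection of all variables, under which the series is
  invariant.\<close>

lemma sf_coeff_exponents:
  assumes "exponents M = exponents N"
  shows "sf_coeff f M = sf_coeff f N"
proof -
  define A where "A = {..<Suc (\<Sum>\<^sub># M + \<Sum>\<^sub># N)}"
  have fin: "finite A" by (simp add: A_def)
  have sub: "set_mset M \<subseteq> A" "set_mset N \<subseteq> A"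
    by (auto simp: A_def less_Suc_eq_le dest!: multi_member_split)
  have ext: "image_mset (count L) (mset_set A) = exponents L + replicate_mset (card A - size (exponents L)) 0"
    if "set_mset L \<subseteq> A" for L
  proof -
    have "A = set_mset L \<union> (A - set_mset L)" using that by auto
    then have "mset_set A = mset_set (set_mset L) + mset_set (A - set_mset L)"
      by (metis mset_set_Union fin finite_Diff finite_set_mset Diff_disjoint)
    moreover have "image_mset (count L) (mset_set (A - set_mset L)) = image_mset (\<lambda>_. 0) (mset_set (A - set_mset L))"
      using fin by (intro image_mset_cong) (auto simp: not_in_iff)
    ultimately show ?thesis using that fin
      by (simp add: exponents_def image_mset_const_eq card_Diff_subset)
  qed
  have "image_mset (count M) (mset_set A) = image_mset (count N) (mset_set A)"
    using ext[OF sub(1)] ext[OF sub(2)] assms by simp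
  then obtain p where p: "p permutes A" "\<forall>x\<in>A. count M x = count N (p x)"
    using image_mset_eq_implies_permutes[OF fin] by blast
  have eq: "count M x = count N (p x)" for x
  proof (cases "x \<in> A")
    case False
    then have "p x = x" "x \<notin># M" "x \<notin># N" using p(1) sub by (auto simp: permutes_def)
    then show ?thesis by (simp add: not_in_iff)
  qed (use p in simp)
  have "bij p" using p(1) by (rule permutes_bij)
  have "image_mset p M = N"
  proof (rule multiset_eqI)
    fix y
    obtain x where y: "y = p x" using \<open>bij p\<close> by (metis bij_pointE)
    have "p -` {p x} = {x}" using \<open>bij p\<close> by (auto dest: bij_is_inj injD)
    then show "count (image_mset p M) y = count N y"
      using eq[of x] by (cases "x \<in># M") (auto simp: count_image_mset y not_in_iff)
  qed
  then show ?thesis using sf_coeff[of f] \<open>bij p\<close> by auto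
qed

lemma ex_exponents:
  assumes "0 \<notin># l"
  shows "\<exists>M. exponents M = l"
proof -
  have "\<exists>M. exponents M = l \<and> (\<forall>i\<in>#M. i < size l)"
    using assms
  proof (induction l)
    case empty
    then show ?case by (intro exI[of _ "{#}"]) (simp add: exponents_def)
  next
    case (add k l)
    then obtain M where M: "exponents M = l" "\<forall>i\<in>#M. i < size l" by auto
    then have "size l \<notin># M" by auto
    then have "exponents (replicate_mset k (size l) + M) = add_mset k l"
      using add.prems M(1) by (subst exponents_add_replicate) auto
    then show ?case using M(2) by (intro exI[of _ "replicate_mset k (size l) + M"]) auto
  qed
  then show ?thesis by blast
qed

text \<open>The coefficient in the basis of augmented monomial functions; dividing by
  \<open>parts_fact l\<close> undoes their normalisation. A multiset with a part 0 is never an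
  exponent multiset, so the choice of \<open>M\<close> would be arbitrary there and the coefficient
  is set to 0.\<close>

definition partition_coeff :: "symfun \<Rightarrow> nat multiset \<Rightarrow> real" where
  "partition_coeff f l = (if 0 \<in># l then 0 else sf_coeff f (SOME M. exponents M = l) / parts_fact l)"

lemma sf_coeff_partition: "sf_coeff f M = partition_coeff f (exponents M) * parts_fact (exponents M)"
proof -
  have "exponents (SOME N. exponents N = exponents M) = exponents M" by (rule someI) simp
  from sf_coeff_exponents[OF this] show ?thesis
    using parts_fact_pos[of "exponents M"] by (simp add: partition_coeff_def exponents_pos)
qed

text \<open>Degree at most \<open>d\<close> bounds the sum of the parts and, the parts being
  positive, also their number and size.\<close>

lemma finite_partition_coeff: "finite {l. partition_coeff f l \<noteq> 0}"
proof -
  obtain d where d: "\<forall>M. d < size M \<longrightarrow> sf_coeff f M = 0" using sf_coeff[of f] by blast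
  have "{l. partition_coeff f l \<noteq> 0} \<subseteq> mset ` {xs. set xs \<subseteq> {..d} \<and> length xs \<le> d}"
  proof
    fix l assume l: "l \<in> {l. partition_coeff f l \<noteq> 0}"
    then have pos: "0 \<notin># l" by (auto simp: partition_coeff_def)
    then obtain M where M: "exponents M = l" using ex_exponents by blast
    have "\<Sum>\<^sub># l \<le> d" using l d sf_coeff_partition[of f M] parts_fact_pos[of l] M
      by (metis (mono_tags) sum_exponents mem_Collect_eq mult_eq_0_iff less_irrefl not_le)
    moreover have "size l \<le> \<Sum>\<^sub># l" using pos by (induction l) (auto simp: Suc_le_eq add.commute intro!: add_le_mono)
    moreover have "a \<le> \<Sum>\<^sub># l" if "a \<in># l" for a using that by (auto dest!: multi_member_split)
    moreover obtain xs where "l = mset xs" by (metis ex_mset)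
    ultimately show "l \<in> mset ` {xs. set xs \<subseteq> {..d} \<and> length xs \<le> d}" by fastforce
  qed
  then show ?thesis by (rule finite_subset) (intro finite_imageI finite_lists_length_le, simp)
qed

lemma partition_coeff_add: "partition_coeff (f + g) l = partition_coeff f l + partition_coeff g l"
  by (simp add: partition_coeff_def plus_symfun.rep_eq add_divide_distrib)

lemma partition_coeff_scaleR: "partition_coeff (r *\<^sub>R f) l = r * partition_coeff f l"
  by (simp add: partition_coeff_def scaleR_symfun.rep_eq)

lemma partition_coeff_aug:
  assumes "0 \<notin># l"
  shows "partition_coeff (aug_monomial_sf l) l' = (if l' = l then 1 else 0)"
proof (cases "0 \<in># l'")
  case False
  then have "exponents (SOME M. exponents M = l') = l'" using ex_exponents by (metis (mono_tags) someI_ex)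
  then show ?thesis using False parts_fact_pos[of l] by (auto simp: partition_coeff_def sf_coeff_aug)
qed (use assms in \<open>auto simp: partition_coeff_def\<close>)

lemma sf_coeff_sum: "sf_coeff (\<Sum>a\<in>A. f a) M = (\<Sum>a\<in>A. sf_coeff (f a) M)"
  by (induction A rule: infinite_finite_induct) (simp_all add: zero_symfun.rep_eq plus_symfun.rep_eq)

lemma symfun_expansion:
  "f = (\<Sum>l | partition_coeff f l \<noteq> 0. partition_coeff f l *\<^sub>R aug_monomial_sf l)"
proof (rule sf_eqI)
  fix M
  have "sf_coeff (\<Sum>l | partition_coeff f l \<noteq> 0. partition_coeff f l *\<^sub>R aug_monomial_sf l) M =
      (\<Sum>l | partition_coeff f l \<noteq> 0. if exponents M = l then partition_coeff f l * parts_fact l else 0)"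
    unfolding sf_coeff_sum by (intro sum.cong) (auto simp: scaleR_symfun.rep_eq sf_coeff_aug)
  also have "\<dots> = sf_coeff f M"
    using finite_partition_coeff[of f] by (simp add: sf_coeff_partition)
  finally show "sf_coeff f M = sf_coeff (\<Sum>l | partition_coeff f l \<noteq> 0. partition_coeff f l *\<^sub>R aug_monomial_sf l) M" ..
qed

lemma linear_symfun_expansion:
  fixes \<phi> :: "symfun \<Rightarrow> 'a::real_vector"
  assumes "linear \<phi>"
  shows "\<phi> f = (\<Sum>l | partition_coeff f l \<noteq> 0. partition_coeff f l *\<^sub>R \<phi> (aug_monomial_sf l))"
  by (subst symfun_expansion) (simp add: linear_sum[OF assms] linear_scale[OF assms])

lemma linear_symfun_eqI:
  fixes \<phi> \<psi> :: "symfun \<Rightarrow> 'a::real_vector"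
  assumes "linear \<phi>" "linear \<psi>" "\<And>l. 0 \<notin># l \<Longrightarrow> \<phi> (aug_monomial_sf l) = \<psi> (aug_monomial_sf l)"
  shows "\<phi> f = \<psi> f"
proof -
  have "\<phi> f = (\<Sum>l | partition_coeff f l \<noteq> 0. partition_coeff f l *\<^sub>R \<phi> (aug_monomial_sf l))"
    by (rule linear_symfun_expansion[OF assms(1)])
  also have "\<dots> = (\<Sum>l | partition_coeff f l \<noteq> 0. partition_coeff f l *\<^sub>R \<psi> (aug_monomial_sf l))"
    using assms(3) by (intro sum.cong) (auto simp: partition_coeff_def split: if_splits)
  also have "\<dots> = \<psi> f" by (rule linear_symfun_expansion[OF assms(2), symmetric])
  finally show ?thesis .
qed

section \<open>Algebra homomorphisms obtained from the recursion\<close>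

lemma linear_sum_mset:
  assumes "linear \<phi>"
  shows "\<phi> (\<Sum>a\<in>#A. f a) = (\<Sum>a\<in>#A. \<phi> (f a))"
  by (induction A) (simp_all add: linear_0[OF assms] linear_add[OF assms])

lemma sf_hom_monomial_values:
  assumes "sf_hom \<phi>"
  shows "monomial_values (\<lambda>k. \<phi> (power_sum k)) (\<lambda>l. \<phi> (aug_monomial_sf l))"
  unfolding monomial_values_def
proof (intro conjI allI impI)
  have lin: "linear \<phi>" and mult: "\<phi> (f * g) = \<phi> f * \<phi> g" for f g
    using assms by (auto simp: sf_hom_def)
  show "\<phi> (aug_monomial_sf {#}) = 1" using assms by (simp add: aug_monomial_empty sf_hom_def)
  fix k :: nat and l :: "nat multiset" assume "0 < k" "0 \<notin># l"
  then show "\<phi> (power_sum k) * \<phi> (aug_monomial_sf l) = \<phi> (aug_monomial_sf (add_mset k l)) +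
      (\<Sum>a\<in>#l. \<phi> (aug_monomial_sf (add_mset (k + a) (l - {#a#}))))"
    unfolding mult[symmetric] by (subst power_sum_mult_aug) (auto simp: linear_add[OF lin] linear_sum_mset[OF lin])
qed

text \<open>Extend \<open>M\<close> linearly. The recursion says that this map is multiplicative
  against power sums; writing an augmented function through a power sum and augmented functions with
  fewer parts carries this over to the whole basis.\<close>

lemma ex_sf_hom:
  assumes "monomial_values p M"
  shows "\<exists>\<phi>. sf_hom \<phi> \<and> (\<forall>l. 0 \<notin># l \<longrightarrow> \<phi> (aug_monomial_sf l) = M l)"
proof -
  define \<phi> where "\<phi> f = Sum_any (\<lambda>l. partition_coeff f l * M l)" for f
  have fin: "finite {l. partition_coeff f l * M l \<noteq> 0}" for f
    by (rule finite_subset[OF _ finite_partition_coeff[of f]]) auto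
  have lin: "linear \<phi>"
  proof (rule linearI)
    show "\<phi> (f + g) = \<phi> f + \<phi> g" for f g
      unfolding \<phi>_def partition_coeff_add distrib_right by (rule Sum_any.distrib[OF fin fin])
    show "\<phi> (r *\<^sub>R f) = r *\<^sub>R \<phi> f" for r f
      unfolding \<phi>_def partition_coeff_scaleR by (simp only: mult.assoc real_scaleR_def Sum_any_right_distrib[OF fin])
  qed
  have aug: "\<phi> (aug_monomial_sf l) = M l" if "0 \<notin># l" for l
  proof -
    have "partition_coeff (aug_monomial_sf l) l' * M l' = (M l' when l' = l)" for l'
      using that by (simp add: partition_coeff_aug when_def)
    then show ?thesis unfolding \<phi>_def by simp
  qed
  have pow: "\<phi> (power_sum k * f) = p k * \<phi> f" if "0 < k" for k f
  proof (rule linear_symfun_eqI)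
    show "linear (\<lambda>f. \<phi> (power_sum k * f))"
      by (intro linearI) (simp_all add: distrib_left linear_add[OF lin] linear_scale[OF lin])
    show "linear (\<lambda>f. p k * \<phi> f)"
      by (intro linearI) (simp_all add: distrib_left linear_add[OF lin] linear_scale[OF lin])
    fix l :: "nat multiset" assume l: "0 \<notin># l"
    have "\<phi> (\<Sum>a\<in>#l. aug_monomial_sf (add_mset (k + a) (l - {#a#}))) = (\<Sum>a\<in>#l. M (add_mset (k + a) (l - {#a#})))"
      unfolding linear_sum_mset[OF lin] using l that by (intro sum_mset_cong aug pos_parts_step) auto
    then show "\<phi> (power_sum k * aug_monomial_sf l) = p k * \<phi> (aug_monomial_sf l)"
      using assms that l by (simp add: power_sum_mult_aug linear_add[OF lin] aug monomial_values_def)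
  qed
  have one: "\<phi> 1 = 1" using aug[of "{#}"] monomial_values_empty[OF assms] by (simp add: aug_monomial_empty)
  have aug_mult: "\<phi> (aug_monomial_sf l * g) = M l * \<phi> g" if "0 \<notin># l" for l g
    using that
  proof (induction "size l" arbitrary: l g rule: less_induct)
    case less
    show ?case
    proof (cases l)
      case empty
      then show ?thesis using monomial_values_empty[OF assms] by (simp add: aug_monomial_empty)
    next
      case (add k l')
      then have k: "0 < k" "0 \<notin># l'" using less.prems by auto
      have "\<phi> ((\<Sum>a\<in>#l'. aug_monomial_sf (add_mset (k + a) (l' - {#a#}))) * g) =
          (\<Sum>a\<in>#l'. \<phi> (aug_monomial_sf (add_mset (k + a) (l' - {#a#})) * g))"
        by (simp add: sum_mset_distrib_right linear_sum_mset[OF lin])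
      also have "\<dots> = (\<Sum>a\<in>#l'. M (add_mset (k + a) (l' - {#a#})) * \<phi> g)"
        using k by (intro sum_mset_cong less.hyps pos_parts_step) (simp_all only: size_parts_step add, auto)
      finally have *: "\<phi> ((\<Sum>a\<in>#l'. aug_monomial_sf (add_mset (k + a) (l' - {#a#}))) * g) =
          (\<Sum>a\<in>#l'. M (add_mset (k + a) (l' - {#a#}))) * \<phi> g"
        by (simp add: sum_mset_distrib_right)
      have "aug_monomial_sf l * g = power_sum k * (aug_monomial_sf l' * g) -
          (\<Sum>a\<in>#l'. aug_monomial_sf (add_mset (k + a) (l' - {#a#}))) * g"
        using power_sum_mult_aug[OF k] by (simp add: add mult.assoc[symmetric] left_diff_distrib[symmetric])
      moreover have "\<phi> (aug_monomial_sf l' * g) = M l' * \<phi> g"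
        using k add by (intro less.hyps) auto
      ultimately have "\<phi> (aug_monomial_sf l * g) = p k * (M l' * \<phi> g) -
          (\<Sum>a\<in>#l'. M (add_mset (k + a) (l' - {#a#}))) * \<phi> g"
        by (simp add: linear_diff[OF lin] pow[OF k(1)] *)
      then show ?thesis unfolding add monomial_values_rec[OF assms k] by (simp add: algebra_simps)
    qed
  qed
  have "\<phi> (f * g) = \<phi> f * \<phi> g" for f g
  proof (rule linear_symfun_eqI[of "\<lambda>f. \<phi> (f * g)" "\<lambda>f. \<phi> f * \<phi> g"])
    show "linear (\<lambda>f. \<phi> (f * g))"
      by (intro linearI) (simp_all add: distrib_right linear_add[OF lin] linear_scale[OF lin])
    show "linear (\<lambda>f. \<phi> f * \<phi> g)"
      by (intro linearI) (simp_all add: distrib_right linear_add[OF lin] linear_scale[OF lin])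
  qed (simp add: aug aug_mult)
  then show ?thesis using lin one aug by (auto simp: sf_hom_def)
qed

text \<open>\<open>ev\<close> is a definite description, so it is usable only once existence and
  uniqueness are known. Uniqueness holds because the values on power sums fix those on the augmented
  functions.\<close>

lemma
  assumes "(c, q) \<in> KK"
  shows sf_hom_ev: "sf_hom (ev c q)"
    and ev_aug: "0 \<notin># l \<Longrightarrow> ev c q (aug_monomial_sf l) = KK_values c q l"
proof -
  let ?P = "\<lambda>\<phi>. sf_hom \<phi> \<and> \<phi> (power_sum 1) = c \<and> (\<forall>k\<ge>2. \<phi> (power_sum k) = suminf (\<lambda>i. q i ^ k))"
  note M = KK_values(1)[OF assms]
  obtain \<phi> where \<phi>: "sf_hom \<phi>" "\<And>l. 0 \<notin># l \<Longrightarrow> \<phi> (aug_monomial_sf l) = KK_values c q l"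
    using ex_sf_hom[OF M] by blast
  have "\<phi> (power_sum k) = psum c q k" if "0 < k" for k
    using that \<phi>(2)[of "{#k#}"] monomial_values_single[OF M that] by (simp add: power_sum_eq_aug)
  then have "?P \<phi>" using \<phi>(1) by (simp add: psum_def)
  moreover have "\<psi> = \<phi>" if P: "?P \<psi>" for \<psi>
  proof
    fix f
    have hom: "sf_hom \<psi>" using P by (rule conjunct1)
    have eq: "\<psi> (power_sum k) = \<phi> (power_sum k)" if "0 < k" for k
    proof (cases "k = 1")
      case False
      then have "2 \<le> k" using that by simp
      then show ?thesis using P \<open>?P \<phi>\<close> by metis
    qed (use P \<open>?P \<phi>\<close> in simp)
    have "linear \<psi>" "linear \<phi>" using hom \<phi>(1) by (simp_all only: sf_hom_def)
    then show "\<psi> f = \<phi> f"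
      by (rule linear_symfun_eqI)
        (rule monomial_values_unique[OF sf_hom_monomial_values[OF hom] sf_hom_monomial_values[OF \<phi>(1)] eq])
  qed
  ultimately have "ev c q = \<phi>" unfolding ev_def by (rule the_equality)
  then show "sf_hom (ev c q)" "0 \<notin># l \<Longrightarrow> ev c q (aug_monomial_sf l) = KK_values c q l"
    using \<phi> by auto
qed

section \<open>Linear functionals on the Grossman--Larson algebra\<close>

lemma linear_eq_lin_ext:
  assumes "linear \<phi>"
  shows "\<phi> x = lin_ext (\<lambda>t. \<phi> (Poly_Mapping.single t 1)) x"
proof -
  have "x = (\<Sum>t\<in>Poly_Mapping.keys x. Poly_Mapping.single t (Poly_Mapping.lookup x t))"
    by (rule poly_mapping_eqI) (simp add: lookup_sum lookup_single when_def in_keys_iff)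
  also have "\<dots> = (\<Sum>t\<in>Poly_Mapping.keys x. Poly_Mapping.lookup x t *\<^sub>R Poly_Mapping.single t 1)"
    by (intro sum.cong refl poly_mapping_eqI) (simp add: lookup_scaleR lookup_single when_def)
  finally have "\<phi> x = \<phi> (\<Sum>t\<in>Poly_Mapping.keys x. Poly_Mapping.lookup x t *\<^sub>R Poly_Mapping.single t 1)"
    by (rule arg_cong)
  then show ?thesis
    by (simp only: lin_ext_def linear_sum[OF assms] linear_scale[OF assms])
qed

lemma linear_gl_eqI:
  assumes "linear f" "linear g" "\<And>t. f (bF t) = g (bF t)"
  shows "f x = g x"
  using linear_eq_lin_ext[OF assms(1), of x] linear_eq_lin_ext[OF assms(2), of x] assms(3)
  by (simp add: bF_def)

lemma gl_mult_bF: "gl_mult (bF s) (bF t) = gl_basis_mult s t"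
  by (simp add: gl_mult_def lin_ext_bF)

lemma linear_gl_mult_left: "linear (\<lambda>x. gl_mult x y)"
  unfolding gl_mult_def by (rule linear_lin_ext)

lemma linear_gl_mult_right: "linear (\<lambda>y. gl_mult x y)"
  unfolding gl_mult_def lin_ext_def[of _ x]
  by (intro linear_compose_sum ballI linear_compose_scale_right linear_lin_ext)

lemma gl_characterI:
  assumes "linear \<phi>" "\<And>s t. \<phi> (gl_basis_mult s t) = \<phi> (bF s) * \<phi> (bF t)"
  shows "gl_character \<phi>"
  unfolding gl_character_def
proof (intro conjI allI assms(1))
  have lin_left: "linear (\<lambda>x. c * \<phi> x)" for c
    by (intro linearI) (simp_all add: linear_add[OF assms(1)] linear_scale[OF assms(1)] distrib_left)
  have lin_right: "linear (\<lambda>x. \<phi> x * c)" for c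
    by (intro linearI) (simp_all add: linear_add[OF assms(1)] linear_scale[OF assms(1)] distrib_right)
  fix x y
  have basis: "\<phi> (gl_mult (bF s) y) = \<phi> (bF s) * \<phi> y" for s
  proof (rule linear_gl_eqI[where f = "\<lambda>y. \<phi> (gl_mult (bF s) y)" and g = "\<lambda>y. \<phi> (bF s) * \<phi> y"])
    show "linear (\<lambda>y. \<phi> (gl_mult (bF s) y))"
      using linear_compose[OF linear_gl_mult_right assms(1)] by (simp add: o_def)
  qed (simp_all add: lin_left gl_mult_bF assms(2))
  show "\<phi> (gl_mult x y) = \<phi> x * \<phi> y"
  proof (rule linear_gl_eqI[where f = "\<lambda>x. \<phi> (gl_mult x y)" and g = "\<lambda>x. \<phi> x * \<phi> y"])
    show "linear (\<lambda>x. \<phi> (gl_mult x y))"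
      using linear_compose[OF linear_gl_mult_left assms(1)] by (simp add: o_def)
  qed (simp_all add: lin_right basis)
qed

lemma gl_character_basis:
  "gl_character \<phi> \<Longrightarrow> \<phi> (gl_basis_mult s t) = \<phi> (bF s) * \<phi> (bF t)"
  by (simp add: gl_character_def flip: gl_mult_bF)

lemma gl_basis_mult_functional:
  assumes "linear \<phi>"
  shows "\<phi> (gl_basis_mult s t) = (\<Sum>f\<in>{..<length (branch_list s)} \<rightarrow>\<^sub>E vertices (representative t).
    \<phi> (bF (graft (\<lambda>v. image_mset (\<lambda>i. branch_list s ! i)
      (mset_set {i. i < length (branch_list s) \<and> f i = v})) (representative t))))"
  by (simp add: gl_basis_mult_def Let_def linear_sum[OF assms])

lemma finite_vertices: "finite (vertices T)"
  by (simp add: vertices_def)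

lemma branch_list_single: "branch_list (Node {#b#}) = [b]"
  using mset_branch_list[of "Node {#b#}"] by simp

lemma gl_basis_mult_single:
  assumes "linear \<phi>"
  shows "\<phi> (gl_basis_mult (Node {#b#}) t) = (\<Sum>v\<in>vertices (representative t).
    \<phi> (bF (graft (\<lambda>u. if u = v then {#b#} else {#}) (representative t))))"
proof -
  let ?T = "representative t"
  let ?G = "\<lambda>f v. image_mset (\<lambda>i. [b] ! i) (mset_set {i. i < 1 \<and> f i = v})"
  have "\<phi> (gl_basis_mult (Node {#b#}) t) = (\<Sum>f\<in>{..<1} \<rightarrow>\<^sub>E vertices ?T. \<phi> (bF (graft (?G f) ?T)))"
    by (simp add: gl_basis_mult_functional[OF assms] branch_list_single)
  also have "\<dots> = (\<Sum>v\<in>vertices ?T. \<phi> (bF (graft (\<lambda>u. if u = v then {#b#} else {#}) ?T)))"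
  proof (rule sum.reindex_bij_witness[of _ "\<lambda>v. \<lambda>i\<in>{..<1}. v" "\<lambda>f. f 0"])
    fix f :: "nat \<Rightarrow> nat"
    have "{i. i < 1 \<and> f i = v} = (if v = f 0 then {0} else {})" for v by auto
    then have "?G f = (\<lambda>u. if u = f 0 then {#b#} else {#})" by (intro ext) simp
    then show "\<phi> (bF (graft (\<lambda>u. if u = f 0 then {#b#} else {#}) ?T)) = \<phi> (bF (graft (?G f) ?T))"
      by simp
  qed (auto simp: PiE_def extensional_def fun_eq_iff)
  finally show ?thesis .
qed

section \<open>Grafting\<close>

definition distinct_labels :: "'a ltree \<Rightarrow> bool" where
  "distinct_labels T \<longleftrightarrow> (\<forall>v. count (labels T) v \<le> 1)"

lemma distinct_labels_representative: "distinct_labels (representative t)"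
  and shape_representative: "shape (representative t) = t"
  using represents_representative[of t] by (simp_all add: represents_def distinct_labels_def)

lemma distinct_labels_branch:
  assumes "distinct_labels (LNode r (add_mset B N))"
  shows "distinct_labels B" "r \<notin># labels B" "v \<in># labels B \<Longrightarrow> C \<in># N \<Longrightarrow> v \<notin># labels C"
    "distinct_labels (LNode r N)"
proof -
  let ?S = "\<Sum>\<^sub># (image_mset labels N)"
  have c: "(if r = v then 1 else 0) + count (labels B) v + count ?S v \<le> 1" for v
  proof -
    have "count (labels (LNode r (add_mset B N))) v = (if r = v then 1 else 0) + count (labels B) v + count ?S v"
      by simp
    then show ?thesis using assms[unfolded distinct_labels_def, rule_format, of v] by linarith
  qed
  show "distinct_labels B" unfolding distinct_labels_def
  proof
    show "count (labels B) v \<le> 1" for v using c[of v] by linarith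
  qed
  show "r \<notin># labels B" using c[of r] by (simp add: not_in_iff)
  show "distinct_labels (LNode r N)" unfolding distinct_labels_def
  proof
    fix v
    have "count (labels (LNode r N)) v = (if r = v then 1 else 0) + count ?S v" by simp
    then show "count (labels (LNode r N)) v \<le> 1" using c[of v] by linarith
  qed
  show "v \<notin># labels C" if "v \<in># labels B" "C \<in># N"
  proof
    assume "v \<in># labels C"
    then have "v \<in># \<Sum>\<^sub># (image_mset labels N)" using that(2) by auto
    then have "0 < count (\<Sum>\<^sub># (image_mset labels N)) v" "0 < count (labels B) v"
      using that(1) by (simp_all only: count_greater_zero_iff)
    then show False using c[of v] by linarith
  qed
qed

lemma graft_cong: "(\<And>v. v \<in># labels T \<Longrightarrow> g v = h v) \<Longrightarrow> graft g T = graft h T"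
proof (induction T)
  case (LNode r N)
  have "graft g B = graft h B" if "B \<in># N" for B
    using that by (intro LNode.IH LNode.prems) auto
  then have "image_mset (graft g) N = image_mset (graft h) N" by (rule image_mset_cong)
  then show ?case using LNode.prems[of r] by simp
qed

lemma graft_empty: "graft (\<lambda>_. {#}) T = shape T"
proof (induction T)
  case (LNode r N)
  then have "image_mset (graft (\<lambda>_. {#})) N = image_mset shape N" by (intro image_mset_cong)
  then show ?case by simp
qed

lemma graft_outside: "v \<notin># labels T \<Longrightarrow> graft (\<lambda>u. if u = v then X else {#}) T = shape T"
  by (subst graft_empty[symmetric]) (auto intro: graft_cong)

text \<open>A relation on unlabelled trees keeps representatives out of the combinatorics. Its
  reflexive transitive closure relates a tree to the trees that contain it with the same
  root.\<close>

inductive leaf_ext :: "rtree \<Rightarrow> rtree \<Rightarrow> bool" where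
  root: "leaf_ext (Node M) (Node (add_mset bullet M))"
| branch: "leaf_ext b b' \<Longrightarrow> leaf_ext (Node (add_mset b M)) (Node (add_mset b' M))"

text \<open>Each enlargement by a leaf is thereby a term of \<open>F_\<tau> F_t\<close>. Distinct
  labels ensure that a graft at a vertex of one branch leaves the other branches unchanged.\<close>

lemma leaf_ext_graft:
  assumes "leaf_ext t t'" "shape T = t" "distinct_labels T"
  shows "\<exists>v\<in>#labels T. t' = graft (\<lambda>u. if u = v then {#bullet#} else {#}) T"
  using assms
proof (induction arbitrary: T rule: leaf_ext.induct)
  case (root M)
  obtain r N where T: "T = LNode r N" by (cases T)
  let ?g = "\<lambda>u. if u = r then {#bullet#} else {#}"
  have "graft ?g B = shape B" if B: "B \<in># N" for B
  proof -
    obtain N' where "N = add_mset B N'" using B by (meson multi_member_split)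
    then have "r \<notin># labels B" using root(2) by (auto simp: T dest: distinct_labels_branch(2))
    then show ?thesis by (rule graft_outside)
  qed
  then have "image_mset (graft ?g) N = image_mset shape N" by (rule image_mset_cong)
  then show ?case using root(1) by (intro bexI[of _ r]) (auto simp: T)
next
  case (branch b b' M)
  obtain r N where T: "T = LNode r N" by (cases T)
  have "image_mset shape N = add_mset b M" using branch.prems(1) by (simp add: T)
  then obtain B N' where N: "N = add_mset B N'" "b = shape B" "M = image_mset shape N'"
    by (metis msed_map_invR)
  note d = distinct_labels_branch[OF branch.prems(2)[unfolded T N(1)]]
  obtain v where v: "v \<in># labels B" "b' = graft (\<lambda>u. if u = v then {#bullet#} else {#}) B"
    using branch.IH[OF N(2)[symmetric] d(1)] by blast
  have "image_mset (graft (\<lambda>u. if u = v then {#bullet#} else {#})) N' = image_mset shape N'"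
    using d(3)[OF v(1)] by (intro image_mset_cong graft_outside)
  moreover have "r \<noteq> v" using v(1) d(2) by auto
  ultimately show ?case using v by (intro bexI[of _ v]) (auto simp: T N)
qed

lemma leaf_ext_context:
  "leaf_ext\<^sup>*\<^sup>* b b' \<Longrightarrow> leaf_ext\<^sup>*\<^sup>* (Node (add_mset b M)) (Node (add_mset b' M))"
  by (induction rule: rtranclp_induct) (auto intro: leaf_ext.branch rtranclp.rtrancl_into_rtrancl)

text \<open>Each new branch is grown from a leaf attached at the root.\<close>

lemma leaf_ext_add_branches:
  assumes "\<And>b. b \<in># N \<Longrightarrow> leaf_ext\<^sup>*\<^sup>* bullet b"
  shows "leaf_ext\<^sup>*\<^sup>* (Node M) (Node (M + N))"
  using assms
proof (induction N)
  case (add b N)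
  have "leaf_ext\<^sup>*\<^sup>* (Node M) (Node (M + N))" using add by simp
  also have "leaf_ext\<^sup>*\<^sup>* (Node (M + N)) (Node (add_mset bullet (M + N)))"
    by (blast intro: leaf_ext.root)
  also have "leaf_ext\<^sup>*\<^sup>* (Node (add_mset bullet (M + N))) (Node (add_mset b (M + N)))"
    by (rule leaf_ext_context) (simp add: add.prems)
  finally show ?case by simp
qed simp

lemma leaf_ext_from_bullet: "leaf_ext\<^sup>*\<^sup>* bullet t"
proof (induction t)
  case (Node M)
  then show ?case using leaf_ext_add_branches[of M "{#}"] by (simp add: bullet_def)
qed

lemma leaf_ext_subset: "leaf_ext\<^sup>*\<^sup>* (Node M) (Node (M + N))"
  by (rule leaf_ext_add_branches) (rule leaf_ext_from_bullet)

text \<open>A row of \<open>d + 1\<close> vertices, the last of which has two leaves: the minimal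
  obstructions to being a path.\<close>

definition fork :: "nat \<Rightarrow> rtree" where
  "fork d = ((\<lambda>t. Node {#t#}) ^^ d) (Node {#bullet, bullet#})"

lemma fork_Suc: "fork (Suc d) = Node {#fork d#}"
  by (simp add: fork_def)

text \<open>Follow single children down to the first vertex with at least two children;
  \<open>d\<close> is its depth.\<close>

lemma not_path_contains_fork: "\<not> is_path t \<Longrightarrow> \<exists>d. leaf_ext\<^sup>*\<^sup>* (fork d) t"
proof (induction t)
  case (Node M)
  show ?case
  proof (cases "size M \<le> 1")
    case True
    then obtain b where b: "b \<in># M" "\<not> is_path b" using Node.prems by auto
    then have M: "M = {#b#}" using True
      by (metis One_nat_def Suc_leI le_antisym nonempty_has_size size_1_singleton_mset empty_iff set_mset_empty
          set_mset_single singletonD)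
    obtain d where "leaf_ext\<^sup>*\<^sup>* (fork d) b" using Node.IH[OF b] by blast
    then have "leaf_ext\<^sup>*\<^sup>* (fork (Suc d)) (Node M)" unfolding fork_Suc M by (rule leaf_ext_context)
    then show ?thesis by blast
  next
    case False
    then obtain b M' where "M = add_mset b M'" "M' \<noteq> {#}"
      by (cases M) (auto simp: le_Suc_eq)
    then obtain c M'' where M: "M = add_mset b (add_mset c M'')" by (cases M') auto
    have "leaf_ext\<^sup>*\<^sup>* (Node {#bullet, bullet#}) (Node {#b, bullet#})"
      by (rule leaf_ext_context[OF leaf_ext_from_bullet])
    also have "leaf_ext\<^sup>*\<^sup>* (Node {#b, bullet#}) (Node {#b, c#})"
      using leaf_ext_context[OF leaf_ext_from_bullet, of "{#b#}" c] by (simp add: add_mset_commute)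
    also have "leaf_ext\<^sup>*\<^sup>* (Node {#b, c#}) (Node M)"
      using leaf_ext_subset[of "{#b, c#}" M''] by (simp add: M)
    finally have "leaf_ext\<^sup>*\<^sup>* (fork 0) (Node M)" by (simp add: fork_def)
    then show ?thesis by blast
  qed
qed

section \<open>Positive characters vanish off path forests\<close>

lemma chain_eq_funpow: "chain (Suc n) = ((\<lambda>t. Node {#t#}) ^^ n) bullet"
  by (simp add: chain_def)

lemma leaf_ext_funpow: "leaf_ext b b' \<Longrightarrow> leaf_ext (((\<lambda>t. Node {#t#}) ^^ d) b) (((\<lambda>t. Node {#t#}) ^^ d) b')"
  by (induction d) (auto intro: leaf_ext.branch)

lemma leaf_ext_chain:
  "leaf_ext (chain (Suc (Suc d))) (chain (Suc (Suc (Suc d))))"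
  "leaf_ext (chain (Suc (Suc d))) (fork d)"
proof -
  have 1: "leaf_ext bullet (Node {#bullet#})" using leaf_ext.root[of "{#}"] by (simp add: bullet_def)
  have 2: "leaf_ext (Node {#bullet#}) (Node {#bullet, bullet#})" by (rule leaf_ext.root)
  show "leaf_ext (chain (Suc (Suc d))) (chain (Suc (Suc (Suc d))))"
    using leaf_ext_funpow[OF 1, of "Suc d"] by (simp only: chain_eq_funpow funpow_Suc_right o_def)
  show "leaf_ext (chain (Suc (Suc d))) (fork d)"
    using leaf_ext_funpow[OF 2, of d] by (simp only: chain_eq_funpow fork_def funpow_Suc_right o_def)
qed

lemma not_path_fork: "\<not> is_path (fork d)"
  by (induction d) (auto simp: fork_def)

lemma character_times_tau:
  assumes "gl_character \<phi>"
  shows "\<phi> (bF (Node {#b#})) * \<phi> (bF (Node {#bullet#})) =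
    \<phi> (bF (Node {#bullet, b#})) + \<phi> (bF (Node {#Node {#b#}#}))"
proof -
  have lin: "linear \<phi>" using assms by (simp add: gl_character_def)
  let ?T = "representative (Node {#bullet#})"
  obtain x N where T: "?T = LNode x N" by (cases ?T)
  have "image_mset shape N = add_mset bullet {#}"
    using shape_representative[of "Node {#bullet#}"] by (simp add: T)
  from msed_map_invR[OF this] obtain B N' where "N = add_mset B N'" "image_mset shape N' = {#}" and B': "shape B = bullet"
    by blast
  then have N: "N = {#B#}" by simp
  obtain y K where "B = LNode y K" by (cases B)
  with B' have B: "B = LNode y {#}" by (simp add: bullet_def)
  have "distinct_labels (LNode x {#B#})"
    using distinct_labels_representative[of "Node {#bullet#}"] unfolding T N .
  then have "x \<notin># labels B" by (rule distinct_labels_branch(2))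
  then have xy: "x \<noteq> y" by (simp add: B)
  \<comment> \<open>The edge has two distinct vertices, so the product has exactly two
    terms.\<close>
  have T': "?T = LNode x {#LNode y {#}#}" by (simp only: T N B)
  have vert: "vertices (LNode x {#LNode y {#}#}) = {x, y}" by (auto simp: vertices_def)
  have "\<phi> (bF (Node {#b#})) * \<phi> (bF (Node {#bullet#})) =
      (\<Sum>v\<in>{x, y}. \<phi> (bF (graft (\<lambda>u. if u = v then {#b#} else {#}) (LNode x {#LNode y {#}#}))))"
    unfolding gl_character_basis[OF assms, symmetric] gl_basis_mult_single[OF lin] T' vert ..
  also have "\<dots> = \<phi> (bF (Node {#bullet, b#})) + \<phi> (bF (Node {#Node {#b#}#}))"
    using xy by (simp add: bullet_def add_mset_commute)
  finally show ?thesis .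
qed

text \<open>Different trees come from different vertices, so the sum is part of the expansion of
  \<open>F_\<tau> F_t\<close>, whose remaining terms are nonnegative. An inequality suffices and
  spares the computation of multiplicities.\<close>

lemma character_tau_times_le:
  assumes "gl_character \<phi>" "basis_positive \<phi>" "finite S" "\<And>t'. t' \<in> S \<Longrightarrow> leaf_ext t t'"
  shows "(\<Sum>t'\<in>S. \<phi> (bF t')) \<le> \<phi> (bF (Node {#bullet#})) * \<phi> (bF t)"
proof -
  have lin: "linear \<phi>" using assms(1) by (simp add: gl_character_def)
  let ?T = "representative t"
  let ?g = "\<lambda>v. graft (\<lambda>u. if u = v then {#bullet#} else {#}) ?T"
  have "S \<subseteq> ?g ` vertices ?T"
    using leaf_ext_graft[OF assms(4) shape_representative distinct_labels_representative]
    by (fastforce simp: vertices_def)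
  then obtain W where W: "W \<subseteq> vertices ?T" "inj_on ?g W" "S = ?g ` W"
    by (meson subset_image_inj)
  have "(\<Sum>t'\<in>S. \<phi> (bF t')) = (\<Sum>v\<in>W. \<phi> (bF (?g v)))"
    unfolding W(3) using W(2) by (simp add: sum.reindex)
  also have "\<dots> \<le> (\<Sum>v\<in>vertices ?T. \<phi> (bF (?g v)))"
    using W(1) assms(2) by (intro sum_mono2 finite_vertices) (auto simp: basis_positive_def)
  also have "\<dots> = \<phi> (bF (Node {#bullet#})) * \<phi> (bF t)"
    unfolding gl_character_basis[OF assms(1), symmetric] gl_basis_mult_single[OF lin] ..
  finally show ?thesis .
qed

lemma character_zero_leaf_ext:
  assumes "gl_character \<phi>" "basis_positive \<phi>" "leaf_ext\<^sup>*\<^sup>* t t'" "\<phi> (bF t) = 0"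
  shows "\<phi> (bF t') = 0"
  using assms(3,4)
proof (induction rule: rtranclp_induct)
  case (step t' t'')
  have "0 \<le> \<phi> (bF t'')" using assms(2) by (simp add: basis_positive_def)
  then show ?case
    using character_tau_times_le[OF assms(1,2), of "{t''}" t'] step by simp
qed simp

text \<open>Comparing \<open>F\<^sub>\<tau> F\<^sub>s\<close> with \<open>F\<^sub>s F\<^sub>\<tau>\<close> for a chain \<open>s\<close> leaves, on the left, exactly the trees in which an
  inner vertex of the chain has received a second child.\<close>

lemma character_fork:
  assumes "gl_character \<phi>" "basis_positive \<phi>"
  shows "\<phi> (bF (Node {#fork d#})) = 0"
proof -
  let ?c = "chain (Suc (Suc d))"
  \<comment> \<open>For \<open>s = Node {#?c#}\<close> the trees \<open>?t1\<close> and
    \<open>?t2\<close> make up all of \<open>F_s F_\<tau>\<close>; in \<open>F_\<tau> F_s\<close>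
    they arise from a leaf at the root and at the far end. The tree \<open>?t3\<close>, from a leaf
    at the last vertex but one, occurs in \<open>F_\<tau> F_s\<close> only, so its value is at most
    0.\<close>
  let ?t1 = "Node {#bullet, ?c#}" and ?t2 = "Node {#Node {#?c#}#}" and ?t3 = "Node {#fork d#}"
  have le: "(\<Sum>t'\<in>{?t1, ?t2, ?t3}. \<phi> (bF t')) \<le> \<phi> (bF (Node {#bullet#})) * \<phi> (bF (Node {#?c#}))"
  proof (rule character_tau_times_le[OF assms])
    fix t' assume "t' \<in> {?t1, ?t2, ?t3}"
    then show "leaf_ext (Node {#?c#}) t'"
      using leaf_ext.root[of "{#?c#}"] leaf_ext.branch[OF leaf_ext_chain(1)[of d], of "{#}"]
        leaf_ext.branch[OF leaf_ext_chain(2)[of d], of "{#}"] chain_Suc[of "Suc d"] by auto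
  qed simp
  have "Node {#?c#} \<noteq> fork d"
    using not_path_fork[of d] is_path_chain[of "Suc (Suc (Suc d))"] chain_Suc[of "Suc d"] by metis
  then have "?t1 \<noteq> ?t2" "?t1 \<noteq> ?t3" "?t2 \<noteq> ?t3" by auto
  then have "(\<Sum>t'\<in>{?t1, ?t2, ?t3}. \<phi> (bF t')) = \<phi> (bF ?t1) + \<phi> (bF ?t2) + \<phi> (bF ?t3)"
    by simp
  then have "\<phi> (bF ?t3) \<le> 0"
    using le character_times_tau[OF assms(1), of ?c] by (simp add: mult.commute)
  then show ?thesis using assms(2) by (simp add: basis_positive_def antisym)
qed

text \<open>The root is exempt from the path condition, which is why the fork is needed one level
  below the root.\<close>

lemma character_not_path_forest:
  assumes "gl_character \<phi>" "basis_positive \<phi>" "\<not> path_forest t"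
  shows "\<phi> (bF t) = 0"
proof -
  obtain b M where t: "t = Node (add_mset b M)" and b: "\<not> is_path b"
    using assms(3) by (cases t) (auto simp: path_forest_def dest!: multi_member_split)
  obtain d where "leaf_ext\<^sup>*\<^sup>* (fork d) b" using not_path_contains_fork[OF b] by blast
  then have "leaf_ext\<^sup>*\<^sup>* (Node {#fork d#}) (Node {#b#})" by (rule leaf_ext_context)
  also have "leaf_ext\<^sup>*\<^sup>* (Node {#b#}) t" using leaf_ext_subset[of "{#b#}" M] by (simp add: t)
  finally show ?thesis by (rule character_zero_leaf_ext[OF assms(1,2) _ character_fork[OF assms(1,2)]])
qed

section \<open>Products of path forests\<close>

lemma sum_PiE_insert:
  assumes "n \<notin> A"
  shows "(\<Sum>f\<in>insert n A \<rightarrow>\<^sub>E V. h f) = (\<Sum>f\<in>A \<rightarrow>\<^sub>E V. \<Sum>v\<in>V. h (f(n := v)) :: real)"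
proof -
  have "(\<Sum>f\<in>insert n A \<rightarrow>\<^sub>E V. h f) = (\<Sum>(v, f)\<in>V \<times> (A \<rightarrow>\<^sub>E V). h (f(n := v)))"
    unfolding PiE_insert_eq using assms
    by (subst sum.reindex[OF inj_combinator]) (auto simp: case_prod_beta)
  also have "\<dots> = (\<Sum>v\<in>V. \<Sum>f\<in>A \<rightarrow>\<^sub>E V. h (f(n := v)))"
    by (simp only: sum.cartesian_product)
  also have "\<dots> = (\<Sum>f\<in>A \<rightarrow>\<^sub>E V. \<Sum>v\<in>V. h (f(n := v)))"
    by (rule sum.swap)
  finally show ?thesis .
qed

text \<open>\<open>placement \<mu> \<kappa> D r A f\<close> lists the branch sizes after chains of sizes \<open>\<mu> i\<close> have been attached
  at \<open>f i\<close>, where \<open>r\<close> is the root and \<open>d \<in> D\<close> is the end of a chain with \<open>\<kappa> d\<close> vertices.\<close>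

definition placement :: "('i \<Rightarrow> nat) \<Rightarrow> ('d \<Rightarrow> nat) \<Rightarrow> 'd set \<Rightarrow> 'd \<Rightarrow> 'i set \<Rightarrow> ('i \<Rightarrow> 'd) \<Rightarrow> nat multiset" where
  "placement \<mu> \<kappa> D r A f = image_mset \<mu> (mset_set {i \<in> A. f i = r}) +
     image_mset (\<lambda>d. \<kappa> d + (\<Sum>i | i \<in> A \<and> f i = d. \<mu> i)) (mset_set D)"

text \<open>Two chains at the same end create a vertex with two children, hence the value 0; the
  root accepts any number of chains.\<close>

definition placement_value where
  "placement_value M \<mu> \<kappa> D r A f =
     (if \<forall>d\<in>D. card {i \<in> A. f i = d} \<le> 1 then M (placement \<mu> \<kappa> D r A f) else 0 :: real)"

lemma image_mset_mset_set_Plus: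
  assumes "finite A" "finite B"
  shows "image_mset \<tau> (mset_set (A <+> B)) =
    image_mset (\<lambda>a. \<tau> (Inl a)) (mset_set A) + image_mset (\<lambda>b. \<tau> (Inr b)) (mset_set B)"
proof -
  have "mset_set (A <+> B) = mset_set (Inl ` A) + mset_set (Inr ` B)"
    unfolding Plus_def using assms by (intro mset_set_Union) auto
  then show ?thesis
    by (simp add: image_mset_mset_set[symmetric] multiset.map_comp o_def inj_on_def)
qed

text \<open>The new chain of size \<open>k = \<mu> n\<close> goes to the root as a part of its own,
  or to a free end and lengthens that part, or to an occupied end with value 0. Compared with the
  recursion for \<open>k\<close>, the mergers with parts that contain an attached chain
  \<open>i\<close> are missing; these are the values after \<open>\<mu> i\<close> has grown by
  \<open>k\<close>.\<close>

lemma placement_value_insert: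
  assumes M: "monomial_values p M" and fin: "finite A" "finite D" and n: "n \<notin> A" and r: "r \<notin> D"
    and pos: "\<And>d. d \<in> D \<Longrightarrow> 0 < \<kappa> d" "\<And>i. i \<in> A \<Longrightarrow> 0 < \<mu> i" "0 < \<mu> n"
    and f: "f \<in> A \<rightarrow>\<^sub>E insert r D"
  shows "(\<Sum>v\<in>insert r D. placement_value M \<mu> \<kappa> D r (insert n A) (f(n := v))) =
    p (\<mu> n) * placement_value M \<mu> \<kappa> D r A f -
    (\<Sum>i\<in>A. placement_value M (\<mu>(i := \<mu> n + \<mu> i)) \<kappa> D r A f)"
proof (cases "\<forall>d\<in>D. card {i \<in> A. f i = d} \<le> 1")
  case False
  then obtain d where d: "d \<in> D" "\<not> card {i \<in> A. f i = d} \<le> 1" by blast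
  have "\<not> card {i \<in> insert n A. (f(n := v)) i = d} \<le> 1" for v
  proof -
    have "card {i \<in> A. f i = d} \<le> card {i \<in> insert n A. (f(n := v)) i = d}"
      using n fin by (intro card_mono) auto
    then show ?thesis using d by linarith
  qed
  then have "placement_value M \<mu> \<kappa> D r (insert n A) (f(n := v)) = 0" for v
    using d(1) unfolding placement_value_def by (meson)
  moreover have "placement_value M \<nu> \<kappa> D r A f = 0" for \<nu>
    using False unfolding placement_value_def by (rule if_not_P)
  ultimately show ?thesis by simp
next
  case inj: True
  define k where "k = \<mu> n"
  define R where "R = {i \<in> A. f i = r}"
  define \<sigma> where "\<sigma> \<nu> d = \<kappa> d + (\<Sum>i | i \<in> A \<and> f i = d. \<nu> i)" for \<nu> and d
  \<comment> \<open>The parts of the placement are indexed by the chains at the root and by the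
    ends, so merging into the part at an end \<open>d\<close> is an update at
    \<open>Inr d\<close>.\<close>
  define \<tau> where "\<tau> \<nu> = case_sum \<nu> (\<sigma> \<nu>)" for \<nu>
  define hit where "hit = f ` (A - R)"
  let ?V = "\<lambda>\<nu>. placement_value M \<nu> \<kappa> D r A f"
  let ?W = "\<lambda>v. placement_value M \<mu> \<kappa> D r (insert n A) (f(n := v))"
  have finR: "finite R" using fin by (simp add: R_def)
  have hit: "hit \<subseteq> D" using f by (auto simp: hit_def R_def)
  have val: "?V \<nu> = M (image_mset (\<tau> \<nu>) (mset_set (R <+> D)))" for \<nu>
    unfolding image_mset_mset_set_Plus[OF finR fin(2)]
    using inj by (simp add: placement_value_def placement_def \<tau>_def R_def \<sigma>_def)
  have fiber: "{j \<in> A. f j = f i} = {i}" if i: "i \<in> A - R" for i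
  proof -
    have "f i \<in> D" using i f by (auto simp: R_def)
    then have "card {j \<in> A. f j = f i} \<le> Suc 0" using inj by auto
    then have "\<forall>a\<in>{j \<in> A. f j = f i}. \<forall>b\<in>{j \<in> A. f j = f i}. a = b"
      using fin(1) by (subst (asm) card_le_Suc0_iff_eq) auto
    then show ?thesis using i by blast
  qed
  have fiber_insert: "{i \<in> insert n A. (f(n := v)) i = d} = (if v = d then insert n {i \<in> A. f i = d} else {i \<in> A. f i = d})" for v d
    using n by auto
  have hit_iff: "v \<in> hit \<longleftrightarrow> v \<in> D \<and> {i \<in> A. f i = v} \<noteq> {}" for v
    using r hit f by (auto simp: hit_def R_def)
  have W_val: "?W v = M (placement \<mu> \<kappa> D r (insert n A) (f(n := v)))" if v: "v \<notin> hit" for v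
  proof -
    have "card {i \<in> insert n A. (f(n := v)) i = d} \<le> 1" if d: "d \<in> D" for d
    proof (cases "v = d")
      case True
      then have E: "{i \<in> A. f i = d} = {}" using v d hit_iff by blast
      show ?thesis unfolding fiber_insert E using True by simp
    next
      case False
      then show ?thesis unfolding fiber_insert using inj d by simp
    qed
    then show ?thesis unfolding placement_value_def by (intro if_P ballI)
  qed
  have root: "?W r = M (add_mset k (image_mset (\<tau> \<mu>) (mset_set (R <+> D))))"
  proof -
    have "r \<notin> hit" using r hit by auto
    have "image_mset \<mu> (mset_set {i \<in> insert n A. (f(n := r)) i = r}) = add_mset k (image_mset \<mu> (mset_set R))"
      unfolding fiber_insert using n fin by (simp add: R_def k_def)
    moreover have "image_mset (\<lambda>d. \<kappa> d + (\<Sum>i | i \<in> insert n A \<and> (f(n := r)) i = d. \<mu> i)) (mset_set D) = image_mset (\<sigma> \<mu>) (mset_set D)"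
    proof (rule image_mset_cong)
      fix d assume "d \<in># mset_set D"
      then have "r \<noteq> d" using fin r by auto
      then show "\<kappa> d + (\<Sum>i | i \<in> insert n A \<and> (f(n := r)) i = d. \<mu> i) = \<sigma> \<mu> d"
        unfolding fiber_insert \<sigma>_def by simp
    qed
    ultimately show ?thesis
      unfolding W_val[OF \<open>r \<notin> hit\<close>] placement_def image_mset_mset_set_Plus[OF finR fin(2)] by (simp add: \<tau>_def)
  qed
  have hit_zero: "?W d = 0" if "d \<in> hit" for d
  proof -
    have d: "d \<in> D" "{i \<in> A. f i = d} \<noteq> {}" using that hit_iff by auto
    have "card {i \<in> insert n A. (f(n := d)) i = d} = Suc (card {i \<in> A. f i = d})"
      unfolding fiber_insert using n fin by simp
    moreover have "0 < card {i \<in> A. f i = d}" using d(2) fin by (simp add: card_gt_0_iff)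
    ultimately have "\<not> card {i \<in> insert n A. (f(n := d)) i = d} \<le> 1" by linarith
    then show ?thesis unfolding placement_value_def using d(1) by (intro if_not_P) blast
  qed
  have unhit: "?W d = M (image_mset ((\<tau> \<mu>)(Inr d := k + \<tau> \<mu> (Inr d))) (mset_set (R <+> D)))" if d: "d \<in> D - hit" for d
  proof -
    have "d \<noteq> r" "d \<notin> hit" using d r by auto
    have empty: "{i \<in> A. f i = d} = {}" using d hit_iff by blast
    have "image_mset \<mu> (mset_set {i \<in> insert n A. (f(n := d)) i = r}) = image_mset \<mu> (mset_set R)"
      unfolding fiber_insert using \<open>d \<noteq> r\<close> by (simp add: R_def)
    moreover have "\<kappa> e + (\<Sum>i | i \<in> insert n A \<and> (f(n := d)) i = e. \<mu> i) = ((\<tau> \<mu>)(Inr d := k + \<tau> \<mu> (Inr d))) (Inr e)" for e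
      unfolding fiber_insert using n fin by (simp add: \<tau>_def \<sigma>_def k_def)
    ultimately show ?thesis
      unfolding W_val[OF \<open>d \<notin> hit\<close>] placement_def image_mset_mset_set_Plus[OF finR fin(2)] by (simp add: \<tau>_def)
  qed
  have at_root: "M (image_mset ((\<tau> \<mu>)(Inl i := k + \<tau> \<mu> (Inl i))) (mset_set (R <+> D))) = ?V (\<mu>(i := k + \<mu> i))" if "i \<in> R" for i
  proof -
    have "\<tau> (\<mu>(i := k + \<mu> i)) (Inr d) = \<tau> \<mu> (Inr d)" if "d \<in> D" for d
      using \<open>i \<in> R\<close> that r by (auto simp: \<tau>_def \<sigma>_def R_def intro!: sum.cong)
    then show ?thesis unfolding val using finR fin
      by (intro arg_cong[where f = M] image_mset_cong) (auto simp: \<tau>_def split: if_splits)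
  qed
  \<comment> \<open>An occupied end carries exactly one attached chain, so lengthening the part at
    this end by \<open>k\<close> is the same as lengthening that chain.\<close>
  have at_hit: "M (image_mset ((\<tau> \<mu>)(Inr (f i) := k + \<tau> \<mu> (Inr (f i)))) (mset_set (R <+> D))) = ?V (\<mu>(i := k + \<mu> i))"
    if i: "i \<in> A - R" for i
  proof -
    have "\<sigma> (\<mu>(i := k + \<mu> i)) d = (if d = f i then k + \<sigma> \<mu> d else \<sigma> \<mu> d)" for d
    proof (cases "d = f i")
      case True
      then show ?thesis using fiber[OF i] by (simp add: \<sigma>_def)
    next
      case False
      then show ?thesis by (auto simp: \<sigma>_def intro!: sum.cong)
    qed
    then show ?thesis unfolding val using finR fin i
      by (intro arg_cong[where f = M] image_mset_cong) (auto simp: \<tau>_def split: if_splits)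
  qed
  have "p k * ?V \<mu> = M (add_mset k (image_mset (\<tau> \<mu>) (mset_set (R <+> D)))) +
      (\<Sum>x\<in>R <+> D. M (image_mset ((\<tau> \<mu>)(x := k + \<tau> \<mu> x)) (mset_set (R <+> D))))"
    unfolding val
  proof (rule monomial_values_index[OF M])
    show "0 < k" using pos by (simp add: k_def)
    show "0 < \<tau> \<mu> x" if "x \<in> R <+> D" for x using that pos by (auto simp: \<tau>_def \<sigma>_def R_def)
  qed (use finR fin in auto)
  also have "(\<Sum>x\<in>R <+> D. M (image_mset ((\<tau> \<mu>)(x := k + \<tau> \<mu> x)) (mset_set (R <+> D)))) =
      (\<Sum>i\<in>R. ?V (\<mu>(i := k + \<mu> i))) +
      (\<Sum>d\<in>D. M (image_mset ((\<tau> \<mu>)(Inr d := k + \<tau> \<mu> (Inr d))) (mset_set (R <+> D))))"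
    using finR fin at_root by (simp add: sum.Plus)
  also have "(\<Sum>d\<in>D. M (image_mset ((\<tau> \<mu>)(Inr d := k + \<tau> \<mu> (Inr d))) (mset_set (R <+> D)))) =
      (\<Sum>d\<in>D - hit. ?W d) + (\<Sum>d\<in>hit. M (image_mset ((\<tau> \<mu>)(Inr d := k + \<tau> \<mu> (Inr d))) (mset_set (R <+> D))))"
    using sum.subset_diff[OF hit fin(2)] unhit by simp
  also have "(\<Sum>d\<in>D - hit. ?W d) = (\<Sum>d\<in>D. ?W d)"
    using fin hit_zero by (intro sum.mono_neutral_left) auto
  also have "(\<Sum>d\<in>hit. M (image_mset ((\<tau> \<mu>)(Inr d := k + \<tau> \<mu> (Inr d))) (mset_set (R <+> D)))) =
      (\<Sum>i\<in>A - R. ?V (\<mu>(i := k + \<mu> i)))"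
  proof -
    have "inj_on f (A - R)"
    proof (rule inj_onI)
      fix i j assume "i \<in> A - R" "j \<in> A - R" "f i = f j"
      then have "j \<in> {j \<in> A. f j = f i}" by simp
      then have "j \<in> {i}" unfolding fiber[OF \<open>i \<in> A - R\<close>] .
      then show "i = j" by simp
    qed
    then show ?thesis unfolding hit_def using at_hit by (simp add: sum.reindex)
  qed
  finally have "p k * ?V \<mu> = ?W r + (\<Sum>d\<in>D. ?W d) + ((\<Sum>i\<in>R. ?V (\<mu>(i := k + \<mu> i))) + (\<Sum>i\<in>A - R. ?V (\<mu>(i := k + \<mu> i))))"
    unfolding root[symmetric] by linarith
  moreover have "(\<Sum>i\<in>R. ?V (\<mu>(i := k + \<mu> i))) + (\<Sum>i\<in>A - R. ?V (\<mu>(i := k + \<mu> i))) = (\<Sum>i\<in>A. ?V (\<mu>(i := k + \<mu> i)))"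
  proof -
    have "R \<subseteq> A" by (auto simp: R_def)
    from sum.subset_diff[OF this fin(1), of "\<lambda>i. ?V (\<mu>(i := k + \<mu> i))"] show ?thesis by linarith
  qed
  ultimately show ?thesis using r fin by (simp add: k_def)
qed

text \<open>As a function of the attached chains the sum obeys the recursion of \<open>M\<close>,
  with the value at the ends as a constant factor. The sizes \<open>\<mu>\<close> are generalised
  because the recursion changes them.\<close>

lemma sum_placement_value:
  assumes M: "monomial_values p M" and fin: "finite A" "finite D" and r: "r \<notin> D"
    and pos: "\<And>d. d \<in> D \<Longrightarrow> 0 < \<kappa> d" "\<And>i. i \<in> A \<Longrightarrow> 0 < \<mu> i"
  shows "(\<Sum>f\<in>A \<rightarrow>\<^sub>E insert r D. placement_value M \<mu> \<kappa> D r A f) =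
    M (image_mset \<mu> (mset_set A)) * M (image_mset \<kappa> (mset_set D))"
  using fin(1) pos(2)
proof (induction A arbitrary: \<mu> rule: finite_induct)
  case empty
  show ?case using monomial_values_empty[OF M] by (simp add: placement_value_def placement_def)
next
  case (insert n A)
  let ?L = "M (image_mset \<kappa> (mset_set D))" and ?\<mu> = "\<lambda>i. \<mu>(i := \<mu> n + \<mu> i)"
  have "(\<Sum>f\<in>insert n A \<rightarrow>\<^sub>E insert r D. placement_value M \<mu> \<kappa> D r (insert n A) f) =
      (\<Sum>f\<in>A \<rightarrow>\<^sub>E insert r D. \<Sum>v\<in>insert r D. placement_value M \<mu> \<kappa> D r (insert n A) (f(n := v)))"
    by (rule sum_PiE_insert[OF insert.hyps(2)])
  also have "\<dots> = (\<Sum>f\<in>A \<rightarrow>\<^sub>E insert r D. p (\<mu> n) * placement_value M \<mu> \<kappa> D r A f -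
      (\<Sum>i\<in>A. placement_value M (?\<mu> i) \<kappa> D r A f))"
    using insert.prems insert.hyps pos(1) fin(2) r
    by (intro sum.cong[OF refl] placement_value_insert[OF M]) auto
  also have "\<dots> = p (\<mu> n) * (\<Sum>f\<in>A \<rightarrow>\<^sub>E insert r D. placement_value M \<mu> \<kappa> D r A f) -
      (\<Sum>i\<in>A. \<Sum>f\<in>A \<rightarrow>\<^sub>E insert r D. placement_value M (?\<mu> i) \<kappa> D r A f)"
    by (simp add: sum_subtractf sum_distrib_left) (rule sum.swap)
  also have "(\<Sum>f\<in>A \<rightarrow>\<^sub>E insert r D. placement_value M \<mu> \<kappa> D r A f) = M (image_mset \<mu> (mset_set A)) * ?L"
    using insert.prems by (intro insert.IH) auto
  also have "(\<Sum>i\<in>A. \<Sum>f\<in>A \<rightarrow>\<^sub>E insert r D. placement_value M (?\<mu> i) \<kappa> D r A f) =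
      (\<Sum>i\<in>A. M (image_mset (?\<mu> i) (mset_set A)) * ?L)"
    using insert.prems by (intro sum.cong refl insert.IH) auto
  also have "p (\<mu> n) * (M (image_mset \<mu> (mset_set A)) * ?L) - (\<Sum>i\<in>A. M (image_mset (?\<mu> i) (mset_set A)) * ?L) =
      (p (\<mu> n) * M (image_mset \<mu> (mset_set A)) - (\<Sum>i\<in>A. M (image_mset (?\<mu> i) (mset_set A)))) * ?L"
    by (simp add: left_diff_distrib sum_distrib_right)
  also have "p (\<mu> n) * M (image_mset \<mu> (mset_set A)) - (\<Sum>i\<in>A. M (image_mset (?\<mu> i) (mset_set A))) =
      M (add_mset (\<mu> n) (image_mset \<mu> (mset_set A)))"
    using monomial_values_index[OF M insert.hyps(1), of "\<mu> n" \<mu>] insert.prems by simp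
  finally show ?case using insert.hyps by simp
qed

section \<open>Graftings that keep a tree a path forest\<close>

lemma nverts_pos: "0 < nverts t"
  by (cases t) simp

lemma nverts_graft:
  "nverts (graft g T) = nverts (shape T) + (\<Sum>v\<in>#labels T. \<Sum>b\<in>#g v. nverts b)"
proof (induction T)
  case (LNode r N)
  then have "(\<Sum>B\<in>#N. nverts (graft g B)) = (\<Sum>B\<in>#N. nverts (shape B) + (\<Sum>v\<in>#labels B. \<Sum>b\<in>#g v. nverts b))"
    by (intro sum_mset_cong)
  moreover have "(\<Sum>v\<in>#\<Sum>\<^sub># (image_mset labels N). \<Sum>b\<in>#g v. nverts b) = (\<Sum>B\<in>#N. \<Sum>v\<in>#labels B. \<Sum>b\<in>#g v. nverts b)"
    by (induction N) simp_all
  ultimately show ?case by (simp add: multiset.map_comp o_def sum_mset.distrib)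
qed

text \<open>The witness is the last vertex of the chain; it does not depend on \<open>g\<close>, so
  one end serves for all graftings.\<close>

lemma path_graft_end:
  assumes "is_path (shape B)" "distinct_labels B"
  shows "\<exists>e\<in>#labels B. \<forall>g. is_path (graft g B) \<longleftrightarrow>
    (\<forall>v\<in>#labels B. v \<noteq> e \<longrightarrow> g v = {#}) \<and> size (g e) \<le> 1 \<and> (\<forall>b\<in>#g e. is_path b)"
  using assms
proof (induction B)
  case (LNode v N)
  show ?case
  proof (cases N)
    case empty
    then show ?thesis by auto
  next
    case (add C N')
    then have N: "N = {#C#}" using LNode.prems(1) by auto
    note d = distinct_labels_branch(1,2)[OF LNode.prems(2)[unfolded N]]
    obtain e where e: "e \<in># labels C" and g: "\<And>g. is_path (graft g C) \<longleftrightarrow>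
        (\<forall>v\<in>#labels C. v \<noteq> e \<longrightarrow> g v = {#}) \<and> size (g e) \<le> 1 \<and> (\<forall>b\<in>#g e. is_path b)"
      using LNode.IH[of C] LNode.prems(1) d(1) N by auto
    have "is_path (graft g (LNode v N)) \<longleftrightarrow> g v = {#} \<and> is_path (graft g C)" for g
      by (auto simp: N)
    then show ?thesis using e g d(2) by (intro bexI[of _ e]) (auto simp: N)
  qed
qed

text \<open>Disjoint nonempty label sets keep the branches apart; in particular no branch is
  repeated, and the multiset of branches can be treated as a set.\<close>

lemma distinct_labels_branches:
  assumes "distinct_labels (LNode r N)"
  shows "B \<in># N \<Longrightarrow> distinct_labels B" "B \<in># N \<Longrightarrow> r \<notin># labels B"
    "B \<in># N \<Longrightarrow> C \<in># N \<Longrightarrow> v \<in># labels B \<Longrightarrow> v \<in># labels C \<Longrightarrow> B = C"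
    "N = mset_set (set_mset N)"
proof -
  have split: "distinct_labels (LNode r (add_mset B (N - {#B#})))" if "B \<in># N" for B
    using assms that by simp
  show "distinct_labels B" "r \<notin># labels B" if "B \<in># N"
    using distinct_labels_branch(1,2)[OF split[OF that]] .
  have disj: "v \<notin># labels C" if "B \<in># N" "C \<in># N - {#B#}" "v \<in># labels B" for B C v
    using distinct_labels_branch(3)[OF split[OF that(1)] that(3,2)] .
  show "B = C" if "B \<in># N" "C \<in># N" "v \<in># labels B" "v \<in># labels C"
  proof (rule ccontr)
    assume "B \<noteq> C"
    then have "C \<in># N - {#B#}" using that(2) by (simp add: in_diff_count)
    then show False using disj[OF that(1) _ that(3)] that(4) by blast
  qed
  have "B \<notin># N - {#B#}" for B
  proof
    assume B: "B \<in># N - {#B#}"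
    moreover obtain v where "v \<in># labels B" by (cases B) auto
    ultimately show False using disj[OF in_diffD[OF B] B] by blast
  qed
  then have le: "count N B \<le> 1" for B
    using not_in_iff[of B "N - {#B#}"] by simp
  show "N = mset_set (set_mset N)"
  proof (rule multiset_eqI)
    fix B
    show "count N B = count (mset_set (set_mset N)) B"
    proof (cases "B \<in># N")
      case True
      then have "1 \<le> count N B" by (simp only: count_greater_eq_one_iff)
      then have "count N B = 1" using le[of B] by linarith
      then show ?thesis using True by simp
    qed (simp add: not_in_iff)
  qed
qed

text \<open>Extracts from the labelled tree what products need: \<open>r\<close> is the root,
  \<open>D\<close> the set of last vertices of the branches, and \<open>\<kappa> d\<close> the
  number of vertices of the branch that ends at \<open>d\<close>.\<close>

lemma path_forest_graft:
  fixes T :: "'a ltree"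
  assumes "distinct_labels T" "path_forest (shape T)"
  obtains r D \<kappa> where "finite D" "r \<notin> D" "insert r D \<subseteq> vertices T" "\<And>d. d \<in> D \<Longrightarrow> 0 < \<kappa> d"
    "image_mset \<kappa> (mset_set D) = image_mset nverts (branches (shape T))"
    "\<And>g. path_forest (graft g T) \<longleftrightarrow> (\<forall>v\<in>vertices T - insert r D. g v = {#}) \<and>
       (\<forall>d\<in>D. size (g d) \<le> 1) \<and> (\<forall>v\<in>insert r D. \<forall>b\<in>#g v. is_path b)"
    "\<And>g. path_forest (graft g T) \<Longrightarrow> image_mset nverts (branches (graft g T)) =
       image_mset nverts (g r) + image_mset (\<lambda>d. \<kappa> d + (\<Sum>b\<in>#g d. nverts b)) (mset_set D)"
proof -
  obtain r N where T: "T = LNode r N" by (cases T)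
  note d = distinct_labels_branches[OF assms(1)[unfolded T]]
  define is_end :: "'a ltree \<Rightarrow> 'a \<Rightarrow> bool" where "is_end B e \<longleftrightarrow> e \<in># labels B \<and> (\<forall>g. is_path (graft g B) \<longleftrightarrow>
    (\<forall>v\<in>#labels B. v \<noteq> e \<longrightarrow> g v = {#}) \<and> size (g e) \<le> 1 \<and> (\<forall>b\<in>#g e. is_path b))" for B e
  have "\<exists>e. is_end B e" if B: "B \<in># N" for B
  proof -
    have "is_path (shape B)" using assms(2) B by (auto simp: T path_forest_def)
    from path_graft_end[OF this d(1)[OF B]] show ?thesis unfolding is_end_def by blast
  qed
  then obtain e where is_end: "\<And>B. B \<in># N \<Longrightarrow> is_end B (e B)" by metis
  have e: "e B \<in># labels B" if "B \<in># N" for B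
    using is_end[OF that] by (simp add: is_end_def)
  have g: "is_path (graft g B) \<longleftrightarrow>
    (\<forall>v\<in>#labels B. v \<noteq> e B \<longrightarrow> g v = {#}) \<and> size (g (e B)) \<le> 1 \<and> (\<forall>b\<in>#g (e B). is_path b)"
    if "B \<in># N" for B g
    using is_end[OF that] by (simp add: is_end_def)
  define D where "D = e ` set_mset N"
  define \<kappa> where "\<kappa> d = nverts (shape (inv_into (set_mset N) e d))" for d
  have inj: "inj_on e (set_mset N)" using d(3) e by (metis inj_onI)
  have \<kappa>: "\<kappa> (e B) = nverts (shape B)" if "B \<in># N" for B
    using inj that by (simp add: \<kappa>_def)
  have D_image: "image_mset h (mset_set D) = image_mset (\<lambda>B. h (e B)) N" for h :: "_ \<Rightarrow> nat"
  proof -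
    have "mset_set D = image_mset e N"
      unfolding D_def image_mset_mset_set[OF inj, symmetric] using d(4) by simp
    then show ?thesis by (simp add: multiset.map_comp o_def)
  qed
  have vert: "vertices T = insert r (\<Union>B\<in>set_mset N. set_mset (labels B))"
    by (auto simp: vertices_def T)
  have rD: "r \<notin> D" using d(2) e by (auto simp: D_def)
  show ?thesis
  proof (rule that)
    show "finite D" by (simp add: D_def)
    show "r \<notin> D" by (rule rD)
    show "insert r D \<subseteq> vertices T" using e by (auto simp: vert D_def)
    show "0 < \<kappa> d" for d by (simp add: \<kappa>_def nverts_pos)
    show "image_mset \<kappa> (mset_set D) = image_mset nverts (branches (shape T))"
    proof -
      have "image_mset (\<lambda>B. \<kappa> (e B)) N = image_mset (\<lambda>B. nverts (shape B)) N"
        using \<kappa> by (rule image_mset_cong)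
      then show ?thesis unfolding D_image by (simp add: T multiset.map_comp o_def)
    qed
    fix g
    have *: "path_forest (graft g T) \<longleftrightarrow> (\<forall>b\<in>#g r. is_path b) \<and> (\<forall>B\<in>#N. is_path (graft g B))"
      by (auto simp: path_forest_def T)
    have mem: "v \<in> insert r D \<longleftrightarrow> v = e B" if "B \<in># N" "v \<in># labels B" for v B
    proof
      assume "v \<in> insert r D"
      moreover have "v \<noteq> r" using d(2)[OF that(1)] that(2) by blast
      ultimately obtain C where "C \<in># N" "v = e C" by (auto simp: D_def)
      then show "v = e B" using d(3)[OF that(1), of C v] that(2) e by simp
    qed (use that(1) in \<open>simp add: D_def\<close>)
    have "(\<forall>v\<in>vertices T - insert r D. g v = {#}) \<longleftrightarrow> (\<forall>B\<in>#N. \<forall>v\<in>#labels B. v \<noteq> e B \<longrightarrow> g v = {#})"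
      unfolding vert using mem by blast
    moreover have "(\<forall>v\<in>insert r D. \<forall>b\<in>#g v. is_path b) \<longleftrightarrow>
        (\<forall>b\<in>#g r. is_path b) \<and> (\<forall>B\<in>#N. \<forall>b\<in>#g (e B). is_path b)"
      by (simp add: D_def)
    moreover have "(\<forall>d\<in>D. size (g d) \<le> 1) \<longleftrightarrow> (\<forall>B\<in>#N. size (g (e B)) \<le> 1)"
      by (simp add: D_def)
    moreover have "(\<forall>B\<in>#N. is_path (graft g B)) \<longleftrightarrow> (\<forall>B\<in>#N. \<forall>v\<in>#labels B. v \<noteq> e B \<longrightarrow> g v = {#}) \<and>
        (\<forall>B\<in>#N. size (g (e B)) \<le> 1) \<and> (\<forall>B\<in>#N. \<forall>b\<in>#g (e B). is_path b)"
      using g by blast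
    ultimately show "path_forest (graft g T) \<longleftrightarrow> (\<forall>v\<in>vertices T - insert r D. g v = {#}) \<and>
       (\<forall>d\<in>D. size (g d) \<le> 1) \<and> (\<forall>v\<in>insert r D. \<forall>b\<in>#g v. is_path b)"
      unfolding * by argo
    assume pf: "path_forest (graft g T)"
    have "nverts (graft g B) = \<kappa> (e B) + (\<Sum>b\<in>#g (e B). nverts b)" if B: "B \<in># N" for B
    proof -
      have "is_path (graft g B)" using pf B * by blast
      then have z: "(\<Sum>b\<in>#g v. nverts b) = 0" if "v \<in># labels B - {#e B#}" for v
      proof -
        have "count (labels B) (e B) \<le> 1" using d(1)[OF B] by (simp add: distinct_labels_def)
        then have "v \<noteq> e B" using that by (auto simp: in_diff_count)
        then show ?thesis using \<open>is_path (graft g B)\<close> g[OF B] in_diffD[OF that] by simp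
      qed
      have "labels B = add_mset (e B) (labels B - {#e B#})" using e[OF B] by simp
      then have "(\<Sum>v\<in>#labels B. \<Sum>b\<in>#g v. nverts b) = (\<Sum>b\<in>#g (e B). nverts b) + (\<Sum>v\<in>#labels B - {#e B#}. \<Sum>b\<in>#g v. nverts b)"
        using sum_mset.add_mset image_mset_add_mset by metis
      also have "(\<Sum>v\<in>#labels B - {#e B#}. \<Sum>b\<in>#g v. nverts b) = (\<Sum>v\<in>#labels B - {#e B#}. 0)"
        by (rule sum_mset_cong) (rule z)
      finally show ?thesis by (simp add: nverts_graft \<kappa>[OF B])
    qed
    then have "image_mset (\<lambda>B. nverts (graft g B)) N = image_mset (\<lambda>B. \<kappa> (e B) + (\<Sum>b\<in>#g (e B). nverts b)) N"
      by (rule image_mset_cong)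
    then show "image_mset nverts (branches (graft g T)) =
       image_mset nverts (g r) + image_mset (\<lambda>d. \<kappa> d + (\<Sum>b\<in>#g d. nverts b)) (mset_set D)"
      unfolding D_image by (simp add: T multiset.map_comp o_def)
  qed
qed

section \<open>Characters supported on path forests\<close>

text \<open>The values on trees of a functional that factors through \<open>Q\<close> and takes the
  value \<open>M l\<close> at \<open>aug_monomial_sf l\<close>.\<close>

definition tree_values :: "(nat multiset \<Rightarrow> real) \<Rightarrow> rtree \<Rightarrow> real" where
  "tree_values M t = (if path_forest t then M (image_mset nverts (branches t)) else 0)"

lemma zero_notin_nverts: "0 \<notin># image_mset nverts X"
proof
  assume "0 \<in># image_mset nverts X"
  then obtain t where "nverts t = 0" by auto
  then show False using nverts_pos[of t] by simp
qed

lemma nverts_branches_path_tree: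
  assumes "0 \<notin># l"
  shows "image_mset nverts (branches (path_tree l)) = l"
proof -
  have "image_mset (\<lambda>n. nverts (chain n)) l = image_mset (\<lambda>n. n) l"
  proof (rule image_mset_cong)
    fix n assume "n \<in># l"
    then have "1 \<le> n" using assms by (cases n) auto
    then show "nverts (chain n) = n" by (rule nverts_chain)
  qed
  then show ?thesis by (simp add: path_tree_def multiset.map_comp o_def)
qed

lemma tree_values_path_tree:
  assumes "0 \<notin># l"
  shows "tree_values M (path_tree l) = M l"
proof -
  have "path_forest (path_tree l)" using assms path_forest_iff by blast
  then show ?thesis by (simp add: tree_values_def nverts_branches_path_tree[OF assms])
qed

lemma bullet_path_tree: "bullet = path_tree {#}"
  by (simp add: bullet_def path_tree_def)

lemma is_path_shape: "is_path (graft g B) \<Longrightarrow> is_path (shape B)"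
proof (induction B)
  case (LNode v N)
  then have "size N \<le> 1" by simp
  moreover have "is_path (shape B)" if "B \<in># N" for B
    using that LNode.prems by (intro LNode.IH) auto
  ultimately show ?case by simp
qed

lemma path_forest_shape: "path_forest (graft g T) \<Longrightarrow> path_forest (shape T)"
  by (cases T) (auto simp: path_forest_def dest: is_path_shape)

lemma path_forest_grafted:
  assumes "distinct_labels T" "path_forest (graft g T)" "v \<in> vertices T" "b \<in># g v"
  shows "is_path b"
proof -
  obtain r D \<kappa> where D: "finite D" "r \<notin> D" "insert r D \<subseteq> vertices T" and \<kappa>: "\<And>d. d \<in> D \<Longrightarrow> 0 < \<kappa> d"
      "image_mset \<kappa> (mset_set D) = image_mset nverts (branches (shape T))"
    and pf: "\<And>g. path_forest (graft g T) \<longleftrightarrow> (\<forall>v\<in>vertices T - insert r D. g v = {#}) \<and>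
       (\<forall>d\<in>D. size (g d) \<le> 1) \<and> (\<forall>v\<in>insert r D. \<forall>b\<in>#g v. is_path b)"
    and parts: "\<And>g. path_forest (graft g T) \<Longrightarrow> image_mset nverts (branches (graft g T)) =
       image_mset nverts (g r) + image_mset (\<lambda>d. \<kappa> d + (\<Sum>b\<in>#g d. nverts b)) (mset_set D)"
    by (rule path_forest_graft[OF assms(1) path_forest_shape[OF assms(2)]]) (rule that)
  show ?thesis using pf[of g] assms(2-4) by (cases "v \<in> insert r D") auto
qed

lemma mset_nth: "mset xs = image_mset (\<lambda>i. xs ! i) (mset_set {..<length xs})"
proof -
  have "mset xs = mset (map (\<lambda>i. xs ! i) [0..<length xs])" by (simp add: map_nth)
  then show ?thesis by (simp only: mset_map mset_set_upto_eq_mset_upto)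
qed

lemma parts_branch_list:
  "image_mset nverts (branches t) = image_mset (\<lambda>i. nverts (branch_list t ! i)) (mset_set {..<length (branch_list t)})"
  by (simp add: mset_branch_list[symmetric] mset_nth[of "branch_list t"] multiset.map_comp o_def)

lemma path_forest_branch_list:
  "path_forest t \<longleftrightarrow> (\<forall>i<length (branch_list t). is_path (branch_list t ! i))"
  by (simp add: path_forest_def mset_branch_list[symmetric] all_set_conv_all_nth)

text \<open>Grafting never repairs a defect, so a factor that is not a path forest makes every term
  vanish. Otherwise only attachments at the root and at branch ends survive, and they form a
  placement sum. This is the multiplicativity of \<open>Q\<close>, tested against
  \<open>M\<close>.\<close>

lemma tree_values_product:
  assumes M: "monomial_values p M" and T: "distinct_labels T"
  shows "(\<Sum>f\<in>{..<length (branch_list s)} \<rightarrow>\<^sub>E vertices T. tree_values M (graft (\<lambda>v. image_mset (\<lambda>i. branch_list s ! i)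
      (mset_set {i. i < length (branch_list s) \<and> f i = v})) T)) = tree_values M s * tree_values M (shape T)"
proof -
  define ss where "ss = branch_list s"
  define A where "A = {..<length ss}"
  define \<mu> where "\<mu> = (\<lambda>i. nverts (ss ! i))"
  define g where "g f v = image_mset (\<lambda>i. ss ! i) (mset_set {i \<in> A. f i = v})" for f :: "nat \<Rightarrow> 'a" and v
  have finA: "finite A" by (simp add: A_def)
  have "(\<Sum>f\<in>A \<rightarrow>\<^sub>E vertices T. tree_values M (graft (g f) T)) = tree_values M s * tree_values M (shape T)"
  proof (cases "path_forest (shape T) \<and> path_forest s")
    case False
    have "\<not> path_forest (graft (g f) T)" if f: "f \<in> A \<rightarrow>\<^sub>E vertices T" for f
    proof
      assume pf: "path_forest (graft (g f) T)"
      have "is_path (ss ! i)" if i: "i \<in> A" for i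
      proof (rule path_forest_grafted[OF T pf])
        show "f i \<in> vertices T" using f i by auto
        show "ss ! i \<in># g f (f i)" using i finA by (simp add: g_def)
      qed
      then have "path_forest s" by (simp add: path_forest_branch_list A_def ss_def)
      then show False using False path_forest_shape[OF pf] by blast
    qed
    then show ?thesis using False by (auto simp: tree_values_def)
  next
    case True
    obtain r D \<kappa> where D: "finite D" "r \<notin> D" "insert r D \<subseteq> vertices T" and \<kappa>: "\<And>d. d \<in> D \<Longrightarrow> 0 < \<kappa> d"
        "image_mset \<kappa> (mset_set D) = image_mset nverts (branches (shape T))"
      and pf: "\<And>g. path_forest (graft g T) \<longleftrightarrow> (\<forall>v\<in>vertices T - insert r D. g v = {#}) \<and>
       (\<forall>d\<in>D. size (g d) \<le> 1) \<and> (\<forall>v\<in>insert r D. \<forall>b\<in>#g v. is_path b)"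
      and parts: "\<And>g. path_forest (graft g T) \<Longrightarrow> image_mset nverts (branches (graft g T)) =
       image_mset nverts (g r) + image_mset (\<lambda>d. \<kappa> d + (\<Sum>b\<in>#g d. nverts b)) (mset_set D)"
      by (rule path_forest_graft[OF T conjunct1[OF True]]) (rule that)
    have path: "is_path b" if "b \<in># g f v" for b f v
      using that True finA by (auto simp: g_def A_def ss_def path_forest_branch_list)
    have inside: "tree_values M (graft (g f) T) = placement_value M \<mu> \<kappa> D r A f" if f: "f \<in> A \<rightarrow>\<^sub>E insert r D" for f
    proof -
      have "g f v = {#}" if "v \<in> vertices T - insert r D" for v
      proof -
        have empty: "{i \<in> A. f i = v} = {}" using f that by auto
        show ?thesis unfolding g_def empty by simp
      qed
      then have outside: "\<forall>v\<in>vertices T - insert r D. g f v = {#}" by blast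
      have size: "size (g f d) = card {i \<in> A. f i = d}" for d by (simp add: g_def)
      have pf': "path_forest (graft (g f) T) \<longleftrightarrow> (\<forall>d\<in>D. card {i \<in> A. f i = d} \<le> 1)"
        unfolding pf size using outside path by blast
      have "placement \<mu> \<kappa> D r A f = image_mset nverts (g f r) + image_mset (\<lambda>d. \<kappa> d + (\<Sum>b\<in>#g f d. nverts b)) (mset_set D)"
        by (simp add: placement_def g_def \<mu>_def multiset.map_comp o_def sum_unfold_sum_mset)
      then show ?thesis unfolding tree_values_def placement_value_def pf'[symmetric] using parts by simp
    qed
    have outside: "tree_values M (graft (g f) T) = 0" if f: "f \<in> (A \<rightarrow>\<^sub>E vertices T) - (A \<rightarrow>\<^sub>E insert r D)" for f
    proof -
      obtain i where i: "i \<in> A" "f i \<notin> insert r D" "f i \<in> vertices T" using f by (auto simp: PiE_iff)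
      then have "g f (f i) \<noteq> {#}" using finA by (auto simp: g_def mset_set_empty_iff)
      then have "\<not> path_forest (graft (g f) T)" unfolding pf using i by blast
      then show ?thesis by (simp add: tree_values_def)
    qed
    have "(\<Sum>f\<in>A \<rightarrow>\<^sub>E vertices T. tree_values M (graft (g f) T)) = (\<Sum>f\<in>A \<rightarrow>\<^sub>E insert r D. placement_value M \<mu> \<kappa> D r A f)"
    proof (rule sum.mono_neutral_cong_right)
      show "finite (A \<rightarrow>\<^sub>E vertices T)" using finA by (intro finite_PiE finite_vertices)
      show "(A \<rightarrow>\<^sub>E insert r D) \<subseteq> (A \<rightarrow>\<^sub>E vertices T)" using D(3) by (intro PiE_mono)
    qed (simp_all add: inside outside)
    also have "\<dots> = M (image_mset \<mu> (mset_set A)) * M (image_mset \<kappa> (mset_set D))"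
      using D \<kappa>(1) by (intro sum_placement_value[OF M finA]) (simp_all add: \<mu>_def nverts_pos)
    also have "image_mset \<mu> (mset_set A) = image_mset nverts (branches s)"
      by (simp add: parts_branch_list A_def ss_def \<mu>_def)
    finally show ?thesis using True \<kappa>(2) by (simp add: tree_values_def)
  qed
  then show ?thesis by (simp add: g_def[abs_def] A_def ss_def)
qed

lemma gl_character_tree_values:
  assumes "linear \<phi>" "monomial_values p M" "\<And>t. \<phi> (bF t) = tree_values M t"
  shows "gl_character \<phi>"
proof (rule gl_characterI[OF assms(1)])
  fix s t
  show "\<phi> (gl_basis_mult s t) = \<phi> (bF s) * \<phi> (bF t)"
    unfolding gl_basis_mult_functional[OF assms(1)] assms(3)
    using tree_values_product[OF assms(2) distinct_labels_representative[of t], of s]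
    by (simp add: shape_representative)
qed

text \<open>Multiply by a one-branch path tree: at the root the chain becomes a new part, at a
  branch end it merges with a part, and at any other vertex the result is no path forest and has
  value 0. Read under \<open>\<phi>\<close>, this is the recursion.\<close>

lemma character_values:
  assumes \<phi>: "gl_character \<phi>" "basis_positive \<phi>" "unital \<phi>"
  defines "M \<equiv> \<lambda>l. \<phi> (bF (path_tree l))"
  shows "\<phi> (bF t) = tree_values M t" "monomial_values (\<lambda>k. M {#k#}) M"
proof -
  have lin: "linear \<phi>" using \<phi>(1) by (simp add: gl_character_def)
  show tv: "\<phi> (bF t) = tree_values M t" for t
  proof (cases "path_forest t")
    case True
    then obtain l where "0 \<notin># l" "t = path_tree l" using path_forest_iff by blast
    then show ?thesis by (simp add: tree_values_path_tree M_def)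
  next
    case False
    then show ?thesis using character_not_path_forest[OF \<phi>(1,2)] by (simp add: tree_values_def)
  qed
  show "monomial_values (\<lambda>k. M {#k#}) M"
    unfolding monomial_values_def
  proof (intro conjI allI impI)
    show "M {#} = 1" using \<phi>(3) by (simp add: M_def unital_def bullet_path_tree)
  next
    fix k :: nat and l :: "nat multiset" assume k: "0 < k" "0 \<notin># l"
    define t where "t = path_tree l"
    define T where "T = representative t"
    define g where "g v = (\<lambda>u. if u = v then {#chain k#} else {#})" for v :: nat
    have T: "distinct_labels T" "shape T = t"
      by (simp_all add: T_def distinct_labels_representative shape_representative)
    have l: "image_mset nverts (branches (shape T)) = l"
      unfolding T t_def by (rule nverts_branches_path_tree[OF k(2)])
    have pft: "path_forest (shape T)" unfolding T t_def using k(2) path_forest_iff by blast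
  obtain r D \<kappa> where D: "finite D" "r \<notin> D" "insert r D \<subseteq> vertices T" and \<kappa>: "\<And>d. d \<in> D \<Longrightarrow> 0 < \<kappa> d"
      "image_mset \<kappa> (mset_set D) = image_mset nverts (branches (shape T))"
    and pf: "\<And>g. path_forest (graft g T) \<longleftrightarrow> (\<forall>v\<in>vertices T - insert r D. g v = {#}) \<and>
       (\<forall>d\<in>D. size (g d) \<le> 1) \<and> (\<forall>v\<in>insert r D. \<forall>b\<in>#g v. is_path b)"
    and parts: "\<And>g. path_forest (graft g T) \<Longrightarrow> image_mset nverts (branches (graft g T)) =
       image_mset nverts (g r) + image_mset (\<lambda>d. \<kappa> d + (\<Sum>b\<in>#g d. nverts b)) (mset_set D)"
    by (rule path_forest_graft[OF T(1) pft]) (rule that)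
    have nk: "nverts (chain k) = k" using k by (intro nverts_chain) simp
    have pf_in: "path_forest (graft (g v) T)" if "v \<in> insert r D" for v
      unfolding pf using that is_path_chain by (auto simp: g_def)
    have "\<not> path_forest (graft (g v) T)" if "v \<in> vertices T - insert r D" for v
      unfolding pf using that by (auto simp: g_def)
    then have out: "tree_values M (graft (g v) T) = 0" if "v \<in> vertices T - insert r D" for v
      using that by (simp add: tree_values_def)
    have "image_mset (\<lambda>d. \<kappa> d + (\<Sum>b\<in>#g r d. nverts b)) (mset_set D) = image_mset \<kappa> (mset_set D)"
      using D by (intro image_mset_cong) (auto simp: g_def)
    then have at_r: "tree_values M (graft (g r) T) = M (add_mset k l)"
      using parts[OF pf_in[of r]] pf_in[of r] \<kappa>(2) l nk by (simp add: tree_values_def g_def)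
    have at_d: "tree_values M (graft (g d) T) = M (add_mset (k + \<kappa> d) (l - {#\<kappa> d#}))" if d: "d \<in> D" for d
    proof -
      have "image_mset (\<lambda>e. \<kappa> e + (\<Sum>b\<in>#g d e. nverts b)) (mset_set D) = image_mset (\<kappa>(d := k + \<kappa> d)) (mset_set D)"
        by (intro image_mset_cong) (auto simp: g_def nk)
      also have "\<dots> = add_mset (k + \<kappa> d) (l - {#\<kappa> d#})"
        unfolding image_mset_fun_upd[OF D(1) d] \<kappa>(2) l ..
      finally show ?thesis
        using parts[OF pf_in[of d]] pf_in[of d] d D(2) by (auto simp: tree_values_def g_def)
    qed
    have "\<phi> (bF (path_tree {#k#})) * \<phi> (bF t) = (\<Sum>v\<in>vertices T. tree_values M (graft (g v) T))"
      unfolding gl_character_basis[OF \<phi>(1), symmetric] g_def T_def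
      by (simp add: path_tree_def gl_basis_mult_single[OF lin] tv)
    also have "\<dots> = (\<Sum>v\<in>insert r D. tree_values M (graft (g v) T))"
      using D(3) out by (intro sum.mono_neutral_right finite_vertices) auto
    also have "\<dots> = M (add_mset k l) + (\<Sum>d\<in>D. M (add_mset (k + \<kappa> d) (l - {#\<kappa> d#})))"
      using D at_r at_d by simp
    also have "(\<Sum>d\<in>D. M (add_mset (k + \<kappa> d) (l - {#\<kappa> d#}))) = (\<Sum>a\<in>#image_mset \<kappa> (mset_set D). M (add_mset (k + a) (l - {#a#})))"
      by (simp add: sum_unfold_sum_mset multiset.map_comp o_def)
    finally show "M {#k#} * M l = M (add_mset k l) + (\<Sum>a\<in>#l. M (add_mset (k + a) (l - {#a#})))"
      unfolding \<kappa>(2) l by (simp only: M_def t_def)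
  qed
qed

text \<open>\<open>bF bullet\<close> is a left unit, so its value is idempotent, and the value 0
  annihilates all others.\<close>

lemma nonunital_character_zero:
  assumes "gl_character \<phi>" "\<not> unital \<phi>"
  shows "\<phi> = (\<lambda>_. 0)"
proof -
  have lin: "linear \<phi>" using assms(1) by (simp add: gl_character_def)
  have unit: "\<phi> (bF bullet) * \<phi> (bF t) = \<phi> (bF t)" for t
  proof -
    have bl: "branch_list bullet = []" using mset_branch_list[of bullet] by (simp add: bullet_def)
    have "\<phi> (bF bullet) * \<phi> (bF t) = \<phi> (gl_basis_mult bullet t)" by (rule gl_character_basis[OF assms(1), symmetric])
    also have "\<dots> = \<phi> (bF t)"
      by (simp add: gl_basis_mult_functional[OF lin] bl graft_empty shape_representative)
    finally show ?thesis .
  qed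
  have "\<phi> (bF bullet) = 0" using unit[of bullet] assms(2) by (simp add: unital_def)
  then have "\<phi> (bF t) = 0" for t using unit[of t] by simp
  then show ?thesis using linear_gl_eqI[OF lin linear_zero] by blast
qed

section \<open>Convolution\<close>

lemma lin_ext_single: "lin_ext b (Poly_Mapping.single x 1) = b x"
  by (simp add: lin_ext_def)

lemma hconv_bF:
  "(\<phi> \<star> \<psi>) (bF t) = (\<Sum>I\<in>Pow {..<length (branch_list t)}.
     \<phi> (bF (subtree_on t I)) * \<psi> (bF (subtree_on t ({..<length (branch_list t)} - I))))"
proof -
  have "linear (tensor_fun \<phi> \<psi>)" unfolding tensor_fun_def by (rule linear_lin_ext)
  note sum = linear_sum[OF this]
  have comult: "gl_comult (bF t) = (\<Sum>I\<in>Pow {..<length (branch_list t)}.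
      Poly_Mapping.single (subtree_on t I, subtree_on t ({..<length (branch_list t)} - I)) 1)"
    by (simp add: gl_comult_def lin_ext_bF Let_def)
  have single: "tensor_fun \<phi> \<psi> (Poly_Mapping.single (a, b) 1) = \<phi> (bF a) * \<psi> (bF b)" for a b
    by (simp add: tensor_fun_def lin_ext_single)
  show ?thesis unfolding hconv_def comult sum single ..
qed

lemma linear_hconv: "linear (\<phi> \<star> \<psi>)"
proof -
  have "(\<phi> \<star> \<psi>) = tensor_fun \<phi> \<psi> \<circ> gl_comult" by (simp add: fun_eq_iff hconv_def)
  then show ?thesis unfolding tensor_fun_def gl_comult_def
    using linear_compose[OF linear_lin_ext linear_lin_ext] by simp
qed

text \<open>A further part goes to either side of the splitting, and a merger with a part
  \<open>i\<close> concerns only the side containing \<open>i\<close>; so the two recursions combine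
  by a product rule into the one for the added power sums.\<close>

lemma monomial_values_convolution:
  assumes M: "monomial_values p M" "monomial_values p' M'" "monomial_values p'' M''"
    and p: "\<And>k. 0 < k \<Longrightarrow> p'' k = p k + p' k" and A: "finite A" "\<And>i. i \<in> A \<Longrightarrow> 0 < \<mu> i"
  shows "(\<Sum>I\<in>Pow A. M (image_mset \<mu> (mset_set I)) * M' (image_mset \<mu> (mset_set (A - I)))) =
    M'' (image_mset \<mu> (mset_set A))"
  using A
proof (induction A arbitrary: \<mu> rule: finite_induct)
  case empty
  then show ?case using M[THEN monomial_values_empty] by simp
next
  case (insert n A)
  define k where "k = \<mu> n"
  let ?M = "\<lambda>\<mu> I. M (image_mset \<mu> (mset_set I))" and ?M' = "\<lambda>\<mu> I. M' (image_mset \<mu> (mset_set I))"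
  let ?u = "\<lambda>i. \<mu>(i := k + \<mu> i)"
  have k: "0 < k" using insert.prems by (simp add: k_def)
  have step: "?M \<mu> (insert n I) * ?M' \<mu> (A - I) + ?M \<mu> I * ?M' \<mu> (insert n (A - I)) =
      p'' k * (?M \<mu> I * ?M' \<mu> (A - I)) - (\<Sum>i\<in>A. ?M (?u i) I * ?M' (?u i) (A - I))" if I: "I \<subseteq> A" for I
  proof -
    have fin: "finite I" "finite (A - I)" using I insert.hyps(1) by (auto intro: finite_subset)
    have n: "n \<notin> I" "n \<notin> A - I" using I insert.hyps(2) by auto
    have 1: "p k * ?M \<mu> I = ?M \<mu> (insert n I) + (\<Sum>i\<in>I. ?M (?u i) I)"
      using monomial_values_index[OF M(1) fin(1) k, of \<mu>] insert.prems I fin n by (auto simp: k_def)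
    have 2: "p' k * ?M' \<mu> (A - I) = ?M' \<mu> (insert n (A - I)) + (\<Sum>i\<in>A - I. ?M' (?u i) (A - I))"
      using monomial_values_index[OF M(2) fin(2) k, of \<mu>] insert.prems fin n by (auto simp: k_def)
    \<comment> \<open>Changing the size of \<open>i\<close> is invisible on the side without
      \<open>i\<close>.\<close>
    have off: "image_mset (?u i) (mset_set J) = image_mset \<mu> (mset_set J)" if "i \<notin> J" "finite J" for i J
      using that by (intro image_mset_cong) auto
    have "(\<Sum>i\<in>A. ?M (?u i) I * ?M' (?u i) (A - I)) =
        (\<Sum>i\<in>A - I. ?M (?u i) I * ?M' (?u i) (A - I)) + (\<Sum>i\<in>I. ?M (?u i) I * ?M' (?u i) (A - I))"
      by (rule sum.subset_diff[OF I insert.hyps(1)])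
    also have "(\<Sum>i\<in>A - I. ?M (?u i) I * ?M' (?u i) (A - I)) = ?M \<mu> I * (\<Sum>i\<in>A - I. ?M' (?u i) (A - I))"
      unfolding sum_distrib_left using fin by (intro sum.cong refl) (simp add: off)
    also have "(\<Sum>i\<in>I. ?M (?u i) I * ?M' (?u i) (A - I)) = (\<Sum>i\<in>I. ?M (?u i) I) * ?M' \<mu> (A - I)"
      unfolding sum_distrib_right using fin by (intro sum.cong refl) (simp add: off)
    finally have 3: "(\<Sum>i\<in>A. ?M (?u i) I * ?M' (?u i) (A - I)) = ?M \<mu> I * (\<Sum>i\<in>A - I. ?M' (?u i) (A - I)) +
        (\<Sum>i\<in>I. ?M (?u i) I) * ?M' \<mu> (A - I)" .
    have "p'' k * (?M \<mu> I * ?M' \<mu> (A - I)) = (p k * ?M \<mu> I) * ?M' \<mu> (A - I) + ?M \<mu> I * (p' k * ?M' \<mu> (A - I))"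
      by (simp add: p[OF k] algebra_simps)
    then show ?thesis unfolding 1 2 3 by (simp add: algebra_simps)
  qed
  have "(\<Sum>I\<in>Pow (insert n A). ?M \<mu> I * ?M' \<mu> (insert n A - I)) =
      (\<Sum>I\<in>Pow A. ?M \<mu> I * ?M' \<mu> (insert n A - I)) + (\<Sum>I\<in>insert n ` Pow A. ?M \<mu> I * ?M' \<mu> (insert n A - I))"
    unfolding Pow_insert using insert.hyps by (intro sum.union_disjoint) auto
  also have "(\<Sum>I\<in>insert n ` Pow A. ?M \<mu> I * ?M' \<mu> (insert n A - I)) = (\<Sum>I\<in>Pow A. ?M \<mu> (insert n I) * ?M' \<mu> (A - I))"
  proof (subst sum.reindex)
    show "inj_on (insert n) (Pow A)" using insert.hyps(2) by (auto intro!: inj_onI)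
    have "insert n A - insert n I = A - I" if "I \<subseteq> A" for I using insert.hyps(2) by auto
    then show "sum ((\<lambda>I. ?M \<mu> I * ?M' \<mu> (insert n A - I)) \<circ> insert n) (Pow A) = (\<Sum>I\<in>Pow A. ?M \<mu> (insert n I) * ?M' \<mu> (A - I))"
      by (intro sum.cong) auto
  qed
  also have "(\<Sum>I\<in>Pow A. ?M \<mu> I * ?M' \<mu> (insert n A - I)) = (\<Sum>I\<in>Pow A. ?M \<mu> I * ?M' \<mu> (insert n (A - I)))"
  proof (rule sum.cong[OF refl])
    fix I assume "I \<in> Pow A"
    then have "insert n A - I = insert n (A - I)" using insert.hyps(2) by auto
    then show "?M \<mu> I * ?M' \<mu> (insert n A - I) = ?M \<mu> I * ?M' \<mu> (insert n (A - I))" by simp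
  qed
  also have "\<dots> + (\<Sum>I\<in>Pow A. ?M \<mu> (insert n I) * ?M' \<mu> (A - I)) =
      (\<Sum>I\<in>Pow A. p'' k * (?M \<mu> I * ?M' \<mu> (A - I)) - (\<Sum>i\<in>A. ?M (?u i) I * ?M' (?u i) (A - I)))"
    unfolding sum.distrib[symmetric] by (intro sum.cong refl) (simp only: step[symmetric] Pow_iff add.commute)
  also have "\<dots> = p'' k * (\<Sum>I\<in>Pow A. ?M \<mu> I * ?M' \<mu> (A - I)) - (\<Sum>i\<in>A. \<Sum>I\<in>Pow A. ?M (?u i) I * ?M' (?u i) (A - I))"
    unfolding sum_subtractf sum_distrib_left by (simp only: sum.swap[of _ A])
  also have "(\<Sum>I\<in>Pow A. ?M \<mu> I * ?M' \<mu> (A - I)) = M'' (image_mset \<mu> (mset_set A))"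
    using insert.prems by (intro insert.IH) auto
  also have "(\<Sum>i\<in>A. \<Sum>I\<in>Pow A. ?M (?u i) I * ?M' (?u i) (A - I)) = (\<Sum>i\<in>A. M'' (image_mset (?u i) (mset_set A)))"
    using insert.prems by (intro sum.cong refl insert.IH) auto
  also have "p'' k * M'' (image_mset \<mu> (mset_set A)) - (\<Sum>i\<in>A. M'' (image_mset (?u i) (mset_set A))) =
      M'' (image_mset \<mu> (mset_set (insert n A)))"
    using monomial_values_index[OF M(3) insert.hyps(1) k, of \<mu>] insert.prems insert.hyps by (simp add: k_def)
  finally show ?case .
qed

text \<open>The coproduct distributes the branches over two sides. A branch that is not a path lands
  on one of them and makes that factor vanish.\<close>

lemma hconv_tree_values:
  assumes M: "monomial_values p M" "monomial_values p' M'" "monomial_values p'' M''"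
    and p: "\<And>k. 0 < k \<Longrightarrow> p'' k = p k + p' k"
    and \<phi>: "\<And>t. \<phi> (bF t) = tree_values M t" "\<And>t. \<psi> (bF t) = tree_values M' t"
  shows "(\<phi> \<star> \<psi>) (bF t) = tree_values M'' t"
proof -
  define A where "A = {..<length (branch_list t)}"
  define \<mu> where "\<mu> = (\<lambda>i. nverts (branch_list t ! i))"
  have finA: "finite A" by (simp add: A_def)
  have pf: "path_forest (subtree_on t I) \<longleftrightarrow> (\<forall>i\<in>I. is_path (branch_list t ! i))" if "finite I" for I
    using that by (simp add: path_forest_def subtree_on_def)
  have parts: "image_mset nverts (branches (subtree_on t I)) = image_mset \<mu> (mset_set I)" for I
    by (simp add: subtree_on_def multiset.map_comp o_def \<mu>_def)
  have "(\<phi> \<star> \<psi>) (bF t) = (\<Sum>I\<in>Pow A. tree_values M (subtree_on t I) * tree_values M' (subtree_on t (A - I)))"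
    by (simp add: hconv_bF A_def \<phi>)
  also have "\<dots> = tree_values M'' t"
  proof (cases "path_forest t")
    case True
    then have path: "is_path (branch_list t ! i)" if "i \<in> A" for i
      using that by (simp add: path_forest_branch_list A_def)
    have "tree_values N (subtree_on t I) = N (image_mset \<mu> (mset_set I))" if "I \<subseteq> A" for N I
      using that path pf[OF finite_subset[OF that finA]] by (auto simp: tree_values_def parts)
    then have "(\<Sum>I\<in>Pow A. tree_values M (subtree_on t I) * tree_values M' (subtree_on t (A - I))) =
       (\<Sum>I\<in>Pow A. M (image_mset \<mu> (mset_set I)) * M' (image_mset \<mu> (mset_set (A - I))))"
      by (intro sum.cong) auto
    also have "\<dots> = M'' (image_mset \<mu> (mset_set A))"
      by (rule monomial_values_convolution[OF M p finA]) (simp_all add: \<mu>_def nverts_pos)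
    finally show ?thesis using True by (simp add: tree_values_def parts_branch_list A_def \<mu>_def)
  next
    case False
    then obtain j where j: "j \<in> A" "\<not> is_path (branch_list t ! j)"
      by (auto simp: path_forest_branch_list A_def)
    have "tree_values M (subtree_on t I) * tree_values M' (subtree_on t (A - I)) = 0" if I: "I \<subseteq> A" for I
    proof (cases "j \<in> I")
      case True
      then have "\<not> path_forest (subtree_on t I)" using j pf[OF finite_subset[OF I finA]] by blast
      then show ?thesis by (simp add: tree_values_def)
    next
      case False
      then have "\<not> path_forest (subtree_on t (A - I))" using j pf[of "A - I"] finA by blast
      then show ?thesis by (simp add: tree_values_def)
    qed
    moreover have "tree_values M'' t = 0" using False by (simp add: tree_values_def)
    ultimately show ?thesis by (simp only:) (intro sum.neutral ballI, simp)
  qed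
  finally show ?thesis .
qed

section \<open>The parametrised characters on the tree basis\<close>

lemma linear_Psi:
  assumes "(c, q) \<in> KK"
  shows "linear (\<Psi> c q)"
  using linear_compose[OF linear_Q] sf_hom_ev[OF assms] unfolding \<Psi>_def sf_hom_def by blast

lemma Psi_bF:
  assumes "(c, q) \<in> KK"
  shows "\<Psi> c q (bF t) = tree_values (KK_values c q) t"
proof -
  have "linear (ev c q)" using sf_hom_ev[OF assms] by (simp add: sf_hom_def)
  from linear_0[OF this] show ?thesis
    using ev_aug[OF assms zero_notin_nverts] by (simp add: \<Psi>_def Q_def lin_ext_bF tree_values_def)
qed

lemma Psi_path_tree:
  assumes "(c, q) \<in> KK" "0 < k"
  shows "\<Psi> c q (bF (path_tree {#k#})) = psum c q k"
  using assms monomial_values_single[OF KK_values(1)[OF assms(1)] assms(2)]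
  by (simp add: Psi_bF tree_values_path_tree)

lemma Psi_UPC:
  assumes "(c, q) \<in> KK"
  shows "\<Psi> c q \<in> UPC"
proof -
  note M = KK_values[OF assms]
  have "unital (\<Psi> c q)"
    using monomial_values_empty[OF M(1)] tree_values_path_tree[of "{#}"]
    by (simp add: unital_def Psi_bF[OF assms] bullet_path_tree)
  moreover have "basis_positive (\<Psi> c q)"
    using M(2)[OF zero_notin_nverts] by (simp add: basis_positive_def Psi_bF[OF assms] tree_values_def)
  moreover have "gl_character (\<Psi> c q)"
    using gl_character_tree_values[OF linear_Psi[OF assms] M(1) Psi_bF[OF assms]] .
  ultimately show ?thesis by (simp add: UPC_def)
qed

lemma UPC_D:
  assumes "\<phi> \<in> UPC"
  shows "gl_character \<phi>" "basis_positive \<phi>" "unital \<phi>" "linear \<phi>"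
  using assms by (auto simp: UPC_def gl_character_def)

text \<open>Agreement at the one-branch path trees suffices, since the values there play the role of
  the power sums in the recursion.\<close>

lemma UPC_eqI:
  assumes "\<phi> \<in> UPC" "linear \<psi>" "monomial_values p M" "\<And>t. \<psi> (bF t) = tree_values M t"
    and "\<And>k. 0 < k \<Longrightarrow> \<phi> (bF (path_tree {#k#})) = p k"
  shows "\<phi> = \<psi>"
proof
  note \<phi> = UPC_D[OF assms(1)]
  note v = character_values[OF \<phi>(1-3)]
  have "\<phi> (bF (path_tree l)) = M l" if "0 \<notin># l" for l
    using monomial_values_unique[OF v(2) assms(3) assms(5) that] .
  then have "\<phi> (bF t) = \<psi> (bF t)" for t
    unfolding v(1)[of t] assms(4) tree_values_def using zero_notin_nverts by simp
  then show "\<phi> x = \<psi> x" for x by (rule linear_gl_eqI[OF \<phi>(4) assms(2)])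
qed

section \<open>Sampling from a nonnegative character\<close>

text \<open>A colouring \<open>f\<close> of \<open>A\<close> with \<open>N \<ge> |A|\<close> colours receives the value \<open>M\<close> of its fibre sizes divided
  by the number of injective recolourings. For \<open>p 1 = 1\<close> this is a consistent family of probability
  weights whose kernel partition is Kingman's exchangeable partition.\<close>

definition colour_weight :: "(nat multiset \<Rightarrow> real) \<Rightarrow> nat \<Rightarrow> nat set \<Rightarrow> (nat \<Rightarrow> nat) \<Rightarrow> real" where
  "colour_weight M N A f = M (image_mset (\<lambda>c. card {i \<in> A. f i = c}) (mset_set (f ` A))) /
     (\<Prod>j<card (f ` A). real N - real j)"

lemma colour_weight_nonneg:
  assumes "\<And>l. 0 \<notin># l \<Longrightarrow> 0 \<le> M l" "finite A" "card A \<le> N"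
  shows "0 \<le> colour_weight M N A f"
proof -
  have "0 < card {i \<in> A. f i = c}" if "c \<in> f ` A" for c
    using that assms(2) by (auto simp: card_gt_0_iff)
  then have "0 \<notin># image_mset (\<lambda>c. card {i \<in> A. f i = c}) (mset_set (f ` A))"
    using assms(2) by fastforce
  moreover have "card (f ` A) \<le> N" using card_image_le[OF assms(2), of f] assms(3) by linarith
  then have "0 \<le> (\<Prod>j<card (f ` A). real N - real j)" by (intro prod_nonneg) auto
  ultimately show ?thesis using assms(1) by (simp add: colour_weight_def)
qed

lemma colour_weight_insert:
  assumes M: "monomial_values p M" and p1: "p 1 = 1" and A: "finite A" "n \<notin> A" "card A < N"
    and f: "f \<in> A \<rightarrow>\<^sub>E {..<N}"
  shows "(\<Sum>c<N. colour_weight M N (insert n A) (f(n := c))) = colour_weight M N A f"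
proof -
  define X where "X = f ` A"
  define \<tau> where "\<tau> c = card {i \<in> A. f i = c}" for c
  define F where "F = (\<Prod>j<card X. real N - real j)"
  have X: "finite X" "X \<subseteq> {..<N}" using A f by (auto simp: X_def)
  have rX: "card X < N" using card_image_le[OF A(1), of f] A(3) by (simp add: X_def)
  have F: "F \<noteq> 0" using rX by (auto simp: F_def)
  have W: "colour_weight M N A f = M (image_mset \<tau> (mset_set X)) / F"
    by (simp add: colour_weight_def X_def \<tau>_def[abs_def] F_def)
  have img: "(f(n := c)) ` insert n A = insert c X" for c
    using A(2) by (auto simp: X_def)
  have cnt: "card {i \<in> insert n A. (f(n := c)) i = d} = (\<tau>(c := 1 + \<tau> c)) d" for c d
  proof -
    have "{i \<in> insert n A. (f(n := c)) i = d} = (if d = c then insert n {i \<in> A. f i = d} else {i \<in> A. f i = d})"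
      using A(2) by auto
    then show ?thesis using A by (simp add: \<tau>_def)
  qed
  have old: "colour_weight M N (insert n A) (f(n := c)) = M (image_mset (\<tau>(c := 1 + \<tau> c)) (mset_set X)) / F"
    if "c \<in> X" for c
    unfolding colour_weight_def img cnt F_def insert_absorb[OF that] ..
  have new: "colour_weight M N (insert n A) (f(n := c)) = M (add_mset 1 (image_mset \<tau> (mset_set X))) / (F * (real N - real (card X)))"
    if c: "c \<in> {..<N} - X" for c
  proof -
    have E: "{i \<in> A. f i = c} = {}" using c by (auto simp: X_def)
    have "\<tau> c = 0" unfolding \<tau>_def E by simp
    moreover have "image_mset (\<tau>(c := 1 + \<tau> c)) (mset_set X) = image_mset \<tau> (mset_set X)"
      using X c by (intro image_mset_cong) auto
    ultimately have G: "image_mset (\<tau>(c := 1 + \<tau> c)) (mset_set (insert c X)) = add_mset 1 (image_mset \<tau> (mset_set X))"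
      using X c by (simp del: fun_upd_apply add: mset_set.insert) simp
    show ?thesis
      unfolding colour_weight_def img cnt G F_def using X c by simp
  qed
  have pos: "0 < \<tau> c" if "c \<in> X" for c using that A(1) by (auto simp: X_def \<tau>_def card_gt_0_iff)
  have "(\<Sum>c<N. colour_weight M N (insert n A) (f(n := c))) =
      (\<Sum>c\<in>{..<N} - X. colour_weight M N (insert n A) (f(n := c))) + (\<Sum>c\<in>X. colour_weight M N (insert n A) (f(n := c)))"
    using X by (intro sum.subset_diff) auto
  also have "(\<Sum>c\<in>{..<N} - X. colour_weight M N (insert n A) (f(n := c))) = M (add_mset 1 (image_mset \<tau> (mset_set X))) / F"
  proof -
    have "card ({..<N} - X) = N - card X" using X by (simp add: card_Diff_subset)
    moreover have "real N - real (card X) \<noteq> 0" using rX by simp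
    ultimately show ?thesis using rX by (simp add: new of_nat_diff)
  qed
  also have "(\<Sum>c\<in>X. colour_weight M N (insert n A) (f(n := c))) = (\<Sum>c\<in>X. M (image_mset (\<tau>(c := 1 + \<tau> c)) (mset_set X))) / F"
    by (simp add: old sum_divide_distrib)
  also have "M (add_mset 1 (image_mset \<tau> (mset_set X))) / F + \<dots> = M (image_mset \<tau> (mset_set X)) / F"
    using monomial_values_index[OF M X(1), of 1 \<tau>] pos p1 by (simp add: add_divide_distrib[symmetric])
  finally show ?thesis unfolding W .
qed

definition const_on :: "(nat \<Rightarrow> nat) \<Rightarrow> nat set \<Rightarrow> bool" where
  "const_on f S \<longleftrightarrow> (\<forall>i\<in>S. \<forall>j\<in>S. f i = f j)"

lemma const_on_upd: "n \<notin> S \<Longrightarrow> const_on (f(n := c)) S \<longleftrightarrow> const_on f S"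
  by (auto simp: const_on_def)

text \<open>For sets of \<open>s\<close> and \<open>t\<close> points: either they share a colour,
  with \<open>N\<close> choices of weight \<open>M {#s + t#} / N\<close>, or they have different
  colours, with \<open>N (N - 1)\<close> choices. The total is the recursion for
  \<open>p s * p t\<close>.\<close>

lemma sum_colour_weight_base:
  assumes M: "monomial_values p M" and ST: "finite S" "finite T" "S \<noteq> {}" "T \<noteq> {}" "S \<inter> T = {}" and N: "2 \<le> N"
  shows "(\<Sum>f | f \<in> (S \<union> T) \<rightarrow>\<^sub>E {..<N} \<and> const_on f S \<and> const_on f T. colour_weight M N (S \<union> T) f) =
    p (card S) * p (card T)"
proof -
  let ?A = "S \<union> T"
  define h where "h a b = (\<lambda>i\<in>?A. if i \<in> S then a else b)" for a b :: nat
  obtain s t where s: "s \<in> S" and t: "t \<in> T" using ST by auto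
  have ts: "t \<notin> S" using t ST by auto
  have fibre: "{i \<in> ?A. h a b i = c} = (if c = a then S else {}) \<union> (if c = b then T else {})" for a b c
    using ST by (auto simp: h_def)
  have img: "h a b ` ?A = {a, b}" for a b
    using s t ts by (auto simp: h_def image_iff)
  have eq: "colour_weight M N ?A (h a a) = M {#card S + card T#} / N" for a
    unfolding colour_weight_def img fibre using ST by (simp add: card_Un_disjoint)
  have neq: "colour_weight M N ?A (h a b) = M {#card S, card T#} / (N * (real N - 1))" if "a \<noteq> b" for a b
  proof -
    have "mset_set {a, b} = {#a, b#}" using that by simp
    moreover have "(\<Prod>j<card {a, b}. real N - real j) = N * (real N - 1)"
      using that by (simp add: lessThan_Suc)
    moreover have "b \<noteq> a" using that by simp
    ultimately show ?thesis unfolding colour_weight_def img fibre using that by simp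
  qed
  have "(\<Sum>f | f \<in> ?A \<rightarrow>\<^sub>E {..<N} \<and> const_on f S \<and> const_on f T. colour_weight M N ?A f) =
      (\<Sum>(a, b)\<in>{..<N} \<times> {..<N}. colour_weight M N ?A (h a b))"
  proof (rule sum.reindex_bij_witness[of _ "\<lambda>(a, b). h a b" "\<lambda>f. (f s, f t)"])
    fix f assume f: "f \<in> {f. f \<in> ?A \<rightarrow>\<^sub>E {..<N} \<and> const_on f S \<and> const_on f T}"
    have "f = h (f s) (f t)"
    proof
      fix i
      show "f i = h (f s) (f t) i"
      proof (cases "i \<in> ?A")
        case True
        have "f i = f s" if "i \<in> S" using f s that unfolding const_on_def by blast
        moreover have "f i = f t" if "i \<in> T" using f t that unfolding const_on_def by blast
        ultimately show ?thesis using True by (auto simp: h_def)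
      next
        case False
        moreover have "f \<in> ?A \<rightarrow>\<^sub>E {..<N}" using f by blast
        ultimately have "f i = undefined" by (rule PiE_arb[rotated])
        then show ?thesis using False by (simp add: h_def)
      qed
    qed
    then show "(case (f s, f t) of (a, b) \<Rightarrow> h a b) = f"
      "(case (f s, f t) of (a, b) \<Rightarrow> colour_weight M N ?A (h a b)) = colour_weight M N ?A f" by simp_all
    show "(f s, f t) \<in> {..<N} \<times> {..<N}" using f s t by auto
  next
    fix x assume x: "x \<in> {..<N} \<times> {..<N}"
    show "(case x of (a, b) \<Rightarrow> h a b) \<in> {f. f \<in> ?A \<rightarrow>\<^sub>E {..<N} \<and> const_on f S \<and> const_on f T}"
      using x ST by (auto simp: h_def const_on_def)
    show "((case x of (a, b) \<Rightarrow> h a b) s, (case x of (a, b) \<Rightarrow> h a b) t) = x"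
      using s t ts by (auto simp: h_def split: prod.split)
  qed
  also have "\<dots> = (\<Sum>a<N. \<Sum>b<N. colour_weight M N ?A (h a b))"
    by (simp only: sum.cartesian_product)
  also have "\<dots> = (\<Sum>a<N. M {#card S + card T#} / N + (\<Sum>b\<in>{..<N} - {a}. M {#card S, card T#} / (N * (real N - 1))))"
  proof (rule sum.cong[OF refl])
    fix a assume "a \<in> {..<N}"
    then have "(\<Sum>b<N. colour_weight M N ?A (h a b)) = colour_weight M N ?A (h a a) + (\<Sum>b\<in>{..<N} - {a}. colour_weight M N ?A (h a b))"
      by (intro sum.remove) auto
    also have "(\<Sum>b\<in>{..<N} - {a}. colour_weight M N ?A (h a b)) = (\<Sum>b\<in>{..<N} - {a}. M {#card S, card T#} / (N * (real N - 1)))"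
      by (intro sum.cong refl neq) auto
    finally show "(\<Sum>b<N. colour_weight M N ?A (h a b)) = M {#card S + card T#} / N + (\<Sum>b\<in>{..<N} - {a}. M {#card S, card T#} / (N * (real N - 1)))"
      by (simp only: eq)
  qed
  also have "\<dots> = (\<Sum>a<N. M {#card S + card T#} / N + real (N - 1) * (M {#card S, card T#} / (N * (real N - 1))))"
    by (intro sum.cong refl) (simp add: card_Diff_singleton)
  also have "\<dots> = M {#card S + card T#} + M {#card S, card T#}"
  proof -
    have "real (N - 1) = real N - 1" "real N \<noteq> 0" "real N - 1 \<noteq> 0" using N by auto
    then show ?thesis by (simp add: field_simps)
  qed
  also have "\<dots> = p (card S) * p (card T)"
  proof -
    have c: "0 < card S" "0 < card T" using ST by (simp_all add: card_gt_0_iff)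
    then show ?thesis using monomial_values_rec[OF M, of "card S" "{#card T#}"] monomial_values_single[OF M c(2)] by simp
  qed
  finally show ?thesis .
qed

text \<open>Points outside \<open>S\<close> and \<open>T\<close> are added one at a time;
  consistency of the weights keeps the sum unchanged.\<close>

lemma sum_colour_weight:
  assumes M: "monomial_values p M" and p1: "p 1 = 1" and ST: "S \<noteq> {}" "T \<noteq> {}" "S \<inter> T = {}"
    and A: "finite A" "S \<union> T \<subseteq> A" "card A \<le> N"
  shows "(\<Sum>f | f \<in> A \<rightarrow>\<^sub>E {..<N} \<and> const_on f S \<and> const_on f T. colour_weight M N A f) = p (card S) * p (card T)"
proof -
  have finST: "finite S" "finite T" using A by (auto intro: finite_subset)
  let ?P = "\<lambda>f. const_on f S \<and> const_on f T"
  have "(\<Sum>f\<in>(S \<union> T \<union> B) \<rightarrow>\<^sub>E {..<N}. if ?P f then colour_weight M N (S \<union> T \<union> B) f else 0) = p (card S) * p (card T)"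
    if "finite B" "B \<inter> (S \<union> T) = {}" "card (S \<union> T \<union> B) \<le> N" for B
    using that
  proof (induction B rule: finite_induct)
    case empty
    have fin: "finite ((S \<union> T) \<rightarrow>\<^sub>E {..<N})" using finST by (intro finite_PiE) auto
    have "card S + card T \<le> N" using empty finST ST by (simp add: card_Un_disjoint)
    moreover have "0 < card S" "0 < card T" using finST ST by (simp_all add: card_gt_0_iff)
    ultimately have "2 \<le> N" by linarith
    have "(\<Sum>f\<in>(S \<union> T) \<rightarrow>\<^sub>E {..<N}. if ?P f then colour_weight M N (S \<union> T) f else 0) =
        (\<Sum>f | f \<in> (S \<union> T) \<rightarrow>\<^sub>E {..<N} \<and> ?P f. colour_weight M N (S \<union> T) f)"
      using sum.inter_filter[OF fin, symmetric] .
    also have "\<dots> = p (card S) * p (card T)" by (rule sum_colour_weight_base[OF M finST ST \<open>2 \<le> N\<close>])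
    finally show ?case unfolding Un_empty_right .
  next
    case (insert n B)
    have ins: "S \<union> T \<union> insert n B = insert n (S \<union> T \<union> B)" by auto
    have n: "n \<notin> S \<union> T \<union> B" "n \<notin> S" "n \<notin> T" using insert by auto
    have fin: "finite (S \<union> T \<union> B)" using finST insert.hyps by auto
    have card: "card (S \<union> T \<union> B) < N" using insert.prems(2) n fin unfolding ins by simp
    have "(\<Sum>f\<in>insert n (S \<union> T \<union> B) \<rightarrow>\<^sub>E {..<N}. if ?P f then colour_weight M N (insert n (S \<union> T \<union> B)) f else 0) =
      (\<Sum>f\<in>(S \<union> T \<union> B) \<rightarrow>\<^sub>E {..<N}. \<Sum>c<N. if ?P (f(n := c)) then colour_weight M N (insert n (S \<union> T \<union> B)) (f(n := c)) else 0)"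
      by (rule sum_PiE_insert[OF n(1)])
    also have "\<dots> = (\<Sum>f\<in>(S \<union> T \<union> B) \<rightarrow>\<^sub>E {..<N}. if ?P f then colour_weight M N (S \<union> T \<union> B) f else 0)"
    proof (rule sum.cong[OF refl])
      fix f assume f: "f \<in> (S \<union> T \<union> B) \<rightarrow>\<^sub>E {..<N}"
      show "(\<Sum>c<N. if ?P (f(n := c)) then colour_weight M N (insert n (S \<union> T \<union> B)) (f(n := c)) else 0) =
          (if ?P f then colour_weight M N (S \<union> T \<union> B) f else 0)"
        unfolding const_on_upd[OF n(2)] const_on_upd[OF n(3)]
      proof (cases "?P f")
        case True
        show "(\<Sum>c<N. if ?P f then colour_weight M N (insert n (S \<union> T \<union> B)) (f(n := c)) else 0) =
            (if ?P f then colour_weight M N (S \<union> T \<union> B) f else 0)"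
          unfolding if_P[OF True] by (rule colour_weight_insert[OF M p1 fin n(1) card f])
      next
        case False
        show "(\<Sum>c<N. if ?P f then colour_weight M N (insert n (S \<union> T \<union> B)) (f(n := c)) else 0) =
            (if ?P f then colour_weight M N (S \<union> T \<union> B) f else 0)"
          unfolding if_not_P[OF False] by simp
      qed
    qed
    also have "\<dots> = p (card S) * p (card T)"
      using insert.prems card by (intro insert.IH) auto
    finally show ?case unfolding ins .
  qed
  note gen = this
  have A': "S \<union> T \<union> (A - (S \<union> T)) = A" using A by auto
  have "(\<Sum>f\<in>A \<rightarrow>\<^sub>E {..<N}. if ?P f then colour_weight M N A f else 0) = p (card S) * p (card T)"
  proof (rule gen[of "A - (S \<union> T)", unfolded A'])
    show "(A - (S \<union> T)) \<inter> (S \<union> T) = {}" by blast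
  qed (use A in auto)
  moreover have "finite (A \<rightarrow>\<^sub>E {..<N})" using A by (intro finite_PiE) auto
  ultimately show ?thesis by (subst sum.inter_filter)
qed

section \<open>Second moments of the colour frequencies\<close>

text \<open>The \<open>k\<close>-th power sum of the colour frequencies. Points and colours are
  equally many, which leaves enough colours for the weights to be nonnegative.\<close>

definition fibre_moment :: "nat \<Rightarrow> (nat \<Rightarrow> nat) \<Rightarrow> nat \<Rightarrow> real" where
  "fibre_moment n f k = (\<Sum>c<n. (real (card {i \<in> {..<n}. f i = c}) / real n) ^ k)"

text \<open>Expanding the powers counts the samples \<open>h\<close> of \<open>k + l\<close> points,
  drawn with replacement, whose first \<open>k\<close> points share a colour and whose last
  \<open>l\<close> points share a colour.\<close>

lemma fibre_moment_product:
  assumes k: "0 < k" "0 < l" and f: "f \<in> {..<n} \<rightarrow>\<^sub>E {..<n}"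
  shows "real n ^ (k + l) * (fibre_moment n f k * fibre_moment n f l) =
    (\<Sum>h\<in>{..<k + l} \<rightarrow>\<^sub>E {..<n}. if const_on f (h ` {..<k}) \<and> const_on f (h ` {k..<k + l}) then 1 else 0)"
proof (cases "n = 0")
  case True
  then have "{..<k + l} \<rightarrow>\<^sub>E {..<n} = {}" using k by (auto simp: PiE_eq_empty_iff)
  then show ?thesis using True k by simp
next
  case False
  define y where "y c = (\<Sum>j<n. if f j = c then 1 else 0 :: real)" for c
  have y: "y c = real (card {i \<in> {..<n}. f i = c})" for c
    unfolding y_def by (subst sum.inter_filter[symmetric]) auto
  have mom: "real n ^ k * fibre_moment n f k = (\<Sum>c<n. y c ^ k)" for k
    using False by (simp add: fibre_moment_def y sum_distrib_left power_divide)
  have split: "{..<k + l} = {..<k} \<union> {k..<k + l}" by auto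
  have expand: "y c ^ k * y d ^ l = (\<Sum>h\<in>{..<k + l} \<rightarrow>\<^sub>E {..<n}. \<Prod>t<k + l. if f (h t) = (if t < k then c else d) then 1 else 0)" for c d
  proof -
    have "y c ^ k * y d ^ l = (\<Prod>t<k. y c) * (\<Prod>t\<in>{k..<k + l}. y d)" by simp
    also have "\<dots> = (\<Prod>t<k. y (if t < k then c else d)) * (\<Prod>t\<in>{k..<k + l}. y (if t < k then c else d))"
      by (intro arg_cong2[where f = "(*)"] prod.cong) auto
    also have "\<dots> = (\<Prod>t<k + l. y (if t < k then c else d))"
      unfolding split by (intro prod.union_disjoint[symmetric]) auto
    also have "\<dots> = (\<Sum>h\<in>{..<k + l} \<rightarrow>\<^sub>E {..<n}. \<Prod>t<k + l. if f (h t) = (if t < k then c else d) then 1 else 0)"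
      unfolding y_def by (rule prod_sum_PiE) auto
    finally show ?thesis .
  qed
  have "real n ^ (k + l) * (fibre_moment n f k * fibre_moment n f l) = (\<Sum>c<n. y c ^ k) * (\<Sum>d<n. y d ^ l)"
    unfolding mom[symmetric] by (simp add: power_add)
  also have "\<dots> = (\<Sum>c<n. \<Sum>d<n. y c ^ k * y d ^ l)" by (rule sum_product)
  also have "\<dots> = (\<Sum>(c, d)\<in>{..<n} \<times> {..<n}. y c ^ k * y d ^ l)" by (simp only: sum.cartesian_product)
  also have "\<dots> = (\<Sum>(c, d)\<in>{..<n} \<times> {..<n}. \<Sum>h\<in>{..<k + l} \<rightarrow>\<^sub>E {..<n}. \<Prod>t<k + l. if f (h t) = (if t < k then c else d) then 1 else 0)"
    by (simp only: expand)
  also have "\<dots> = (\<Sum>h\<in>{..<k + l} \<rightarrow>\<^sub>E {..<n}. \<Sum>(c, d)\<in>{..<n} \<times> {..<n}. \<Prod>t<k + l. if f (h t) = (if t < k then c else d) then 1 else 0)"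
    unfolding case_prod_beta by (rule sum.swap)
  also have "\<dots> = (\<Sum>h\<in>{..<k + l} \<rightarrow>\<^sub>E {..<n}. if const_on f (h ` {..<k}) \<and> const_on f (h ` {k..<k + l}) then 1 else 0)"
  proof (rule sum.cong[OF refl])
    fix h assume h: "h \<in> {..<k + l} \<rightarrow>\<^sub>E {..<n}"
    let ?Q = "\<lambda>c d. \<forall>t<k + l. f (h t) = (if t < k then c else d)"
    have prod: "(\<Prod>t<k + l. if f (h t) = (if t < k then c else d) then 1 else 0 :: real) = (if ?Q c d then 1 else 0)" for c d
    proof (cases "?Q c d")
      case False
      then obtain t where "t < k + l" "f (h t) \<noteq> (if t < k then c else d)" by blast
      then show ?thesis unfolding if_not_P[OF False] by (intro prod_zero bexI[of _ t]) simp_all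
    qed (auto intro!: prod.neutral)
    have Q: "?Q c d \<longleftrightarrow> (c, d) = (f (h 0), f (h k)) \<and> const_on f (h ` {..<k}) \<and> const_on f (h ` {k..<k + l})" for c d
    proof
      assume q: "?Q c d"
      have 1: "f (h t) = c" if "t < k" for t using q[rule_format, of t] that by simp
      have 2: "f (h t) = d" if "k \<le> t" "t < k + l" for t using q[rule_format, of t] that by simp
      have "const_on f (h ` {..<k})" "const_on f (h ` {k..<k + l})"
        unfolding const_on_def by (simp_all add: 1 2)
      then show "(c, d) = (f (h 0), f (h k)) \<and> const_on f (h ` {..<k}) \<and> const_on f (h ` {k..<k + l})"
        using 1[of 0] 2[of k] k by simp
    next
      assume r: "(c, d) = (f (h 0), f (h k)) \<and> const_on f (h ` {..<k}) \<and> const_on f (h ` {k..<k + l})"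
      show "?Q c d"
      proof (intro allI impI)
        fix t assume t: "t < k + l"
        show "f (h t) = (if t < k then c else d)"
        proof (cases "t < k")
          case True
          then have "h t \<in> h ` {..<k}" "h 0 \<in> h ` {..<k}" using k by auto
          then have "f (h t) = f (h 0)" using r unfolding const_on_def by blast
          then show ?thesis using r True by simp
        next
          case False
          then have "h t \<in> h ` {k..<k + l}" "h k \<in> h ` {k..<k + l}" using k t by auto
          then have "f (h t) = f (h k)" using r unfolding const_on_def by blast
          then show ?thesis using r False by simp
        qed
      qed
    qed
    have mem: "(f (h 0), f (h k)) \<in> {..<n} \<times> {..<n}"
    proof -
      have "h 0 \<in> {..<n}" "h k \<in> {..<n}" using h k by (auto simp: PiE_iff)
      then show ?thesis using f by (auto simp: PiE_iff)
    qed
    let ?B = "const_on f (h ` {..<k}) \<and> const_on f (h ` {k..<k + l})"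
    have "(\<Sum>(c, d)\<in>{..<n} \<times> {..<n}. \<Prod>t<k + l. if f (h t) = (if t < k then c else d) then 1 else (0::real)) =
        (\<Sum>x\<in>{..<n} \<times> {..<n}. if x = (f (h 0), f (h k)) then (if ?B then 1 else 0) else 0)"
    proof (rule sum.cong[OF refl])
      fix x assume "x \<in> {..<n} \<times> {..<n}"
      obtain c d where x: "x = (c, d)" by (cases x)
      show "(case x of (c, d) \<Rightarrow> \<Prod>t<k + l. if f (h t) = (if t < k then c else d) then 1 else (0::real)) =
          (if x = (f (h 0), f (h k)) then (if ?B then 1 else 0) else 0)"
        unfolding x prod.case prod Q by (cases "(c, d) = (f (h 0), f (h k))") (simp_all only: simp_thms if_True if_False)
    qed
    also have "\<dots> = (if ?B then 1 else 0)" using mem by (simp add: sum.delta)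
    finally show "(\<Sum>(c, d)\<in>{..<n} \<times> {..<n}. \<Prod>t<k + l. if f (h t) = (if t < k then c else d) then 1 else (0::real)) =
        (if ?B then 1 else 0)" .
  qed
  finally show ?thesis .
qed

definition colour_expectation :: "(nat multiset \<Rightarrow> real) \<Rightarrow> nat \<Rightarrow> ((nat \<Rightarrow> nat) \<Rightarrow> real) \<Rightarrow> real" where
  "colour_expectation M n X = (\<Sum>f\<in>{..<n} \<rightarrow>\<^sub>E {..<n}. colour_weight M n {..<n} f * X f)"

lemma card_injective_PiE:
  "real (card {h \<in> {..<m} \<rightarrow>\<^sub>E {..<n}. inj_on h {..<m}}) = (\<Prod>j<m. real (n - j))"
proof -
  have "card {h \<in> {..<m} \<rightarrow>\<^sub>E {..<n}. inj_on h {..<m}} = prod ((-) n) {0..<m}"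
    using card_inj_on_subset_funcset[of "{..<m}" "{..<n}" "{..<m}"] by simp
  then show ?thesis by (simp add: atLeast0LessThan)
qed

text \<open>For an injective sample the event has weight exactly \<open>p k * p l\<close>; for any
  other sample the deviation is at most 1. So the error is at most the proportion of samples with a
  repetition.\<close>

lemma colour_expectation_moments:
  assumes M: "monomial_values p M" and p1: "p 1 = 1" and pos: "\<And>l. 0 \<notin># l \<Longrightarrow> 0 \<le> M l"
    and k: "0 < k" "0 < l" and n: "k + l \<le> n"
  shows "\<bar>colour_expectation M n (\<lambda>f. fibre_moment n f k * fibre_moment n f l) - p k * p l\<bar> \<le>
    1 - (\<Prod>j<k + l. real (n - j)) / real n ^ (k + l)"
proof -
  let ?O = "{..<n} \<rightarrow>\<^sub>E {..<n}" and ?H = "{..<k + l} \<rightarrow>\<^sub>E {..<n}"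
  let ?B = "\<lambda>f h. const_on f (h ` {..<k}) \<and> const_on f (h ` {k..<k + l})"
  let ?w = "colour_weight M n {..<n}"
  define P where "P h = (\<Sum>f | f \<in> ?O \<and> ?B f h. ?w f)" for h
  define J where "J = {h \<in> ?H. inj_on h {..<k + l}}"
  have n0: "0 < n" using n k by simp
  have finO: "finite ?O" and finH: "finite ?H" by (intro finite_PiE; simp)+
  have w: "0 \<le> ?w f" for f using pos by (rule colour_weight_nonneg) auto
  have inj: "P h = p k * p l" if h: "h \<in> J" for h
  proof -
    have hi: "inj_on h {..<k + l}" and hH: "h \<in> ?H" using h by (auto simp: J_def)
    have c: "card (h ` {..<k}) = k" "card (h ` {k..<k + l}) = l"
      using hi by (auto simp: card_image inj_on_def)
    have "h ` ({..<k} \<inter> {k..<k + l}) = h ` {..<k} \<inter> h ` {k..<k + l}"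
      by (rule inj_on_image_Int[OF hi]) auto
    moreover have "{..<k} \<inter> {k..<k + l} = {}" by auto
    ultimately have "h ` {..<k} \<inter> h ` {k..<k + l} = {}" by simp
    moreover have "h ` {..<k} \<union> h ` {k..<k + l} \<subseteq> {..<n}" using hH by (auto simp: PiE_iff)
    moreover have "h ` {..<k} \<noteq> {}" "h ` {k..<k + l} \<noteq> {}" using k by auto
    ultimately show ?thesis unfolding P_def
      using sum_colour_weight[OF M p1, of "h ` {..<k}" "h ` {k..<k + l}" "{..<n}" n] c by simp
  qed
  \<comment> \<open>The condition is void for singletons, so the general formula gives the total
    weight \<open>p 1 * p 1\<close>; two points exist because \<open>k\<close> and \<open>l\<close>
    are positive.\<close>
  have total: "(\<Sum>f\<in>?O. ?w f) = 1"
  proof -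
    have "{0::nat} \<union> {1} \<subseteq> {..<n}" using n k by auto
    then have "(\<Sum>f | f \<in> ?O \<and> const_on f {0} \<and> const_on f {1}. ?w f) = p (card {0::nat}) * p (card {1::nat})"
      by (intro sum_colour_weight[OF M p1]) auto
    then show ?thesis using p1 by (simp add: const_on_def)
  qed
  have P: "0 \<le> P h" "P h \<le> 1" for h
  proof -
    show "0 \<le> P h" unfolding P_def using w by (intro sum_nonneg)
    have "P h \<le> (\<Sum>f\<in>?O. ?w f)" unfolding P_def using w finO by (intro sum_mono2) auto
    then show "P h \<le> 1" by (simp add: total)
  qed
  have J: "J \<subseteq> ?H" by (auto simp: J_def)
  have pp: "0 \<le> p k * p l" "p k * p l \<le> 1"
  proof -
    \<comment> \<open>The identity sample is injective and exhibits \<open>p k * p l\<close> as the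
      weight of an event.\<close>
    have "(\<lambda>i\<in>{..<k + l}. i) \<in> J" using n by (auto simp: J_def inj_on_def)
    then show "0 \<le> p k * p l" "p k * p l \<le> 1" using P inj by metis+
  qed
  have "real n ^ (k + l) * colour_expectation M n (\<lambda>f. fibre_moment n f k * fibre_moment n f l) =
      (\<Sum>f\<in>?O. ?w f * (real n ^ (k + l) * (fibre_moment n f k * fibre_moment n f l)))"
    by (simp add: colour_expectation_def sum_distrib_left mult.left_commute)
  also have "\<dots> = (\<Sum>f\<in>?O. ?w f * (\<Sum>h\<in>?H. if ?B f h then 1 else 0))"
    using k by (intro sum.cong refl) (simp add: fibre_moment_product)
  also have "\<dots> = (\<Sum>h\<in>?H. \<Sum>f\<in>?O. if ?B f h then ?w f else 0)"
    by (subst sum.swap) (simp add: sum_distrib_left if_distrib cong: if_cong)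
  also have "\<dots> = (\<Sum>h\<in>?H. P h)"
    unfolding P_def by (intro sum.cong refl sum.inter_filter[OF finO, symmetric])
  finally have E: "real n ^ (k + l) * colour_expectation M n (\<lambda>f. fibre_moment n f k * fibre_moment n f l) = (\<Sum>h\<in>?H. P h)" .
  have "real n ^ (k + l) * (p k * p l) = (\<Sum>h\<in>?H. p k * p l)"
    by (simp add: card_funcsetE)
  then have "real n ^ (k + l) * (colour_expectation M n (\<lambda>f. fibre_moment n f k * fibre_moment n f l) - p k * p l) =
      (\<Sum>h\<in>?H. P h - p k * p l)"
    by (simp add: right_diff_distrib E sum_subtractf)
  also have "\<dots> = (\<Sum>h\<in>?H - J. P h - p k * p l)"
  proof (rule sum.mono_neutral_right[OF finH])
    show "\<forall>h\<in>?H - (?H - J). P h - p k * p l = 0" using inj by auto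
  qed auto
  finally have eq: "real n ^ (k + l) * (colour_expectation M n (\<lambda>f. fibre_moment n f k * fibre_moment n f l) - p k * p l) =
      (\<Sum>h\<in>?H - J. P h - p k * p l)" .
  have "real n ^ (k + l) * \<bar>colour_expectation M n (\<lambda>f. fibre_moment n f k * fibre_moment n f l) - p k * p l\<bar> =
      \<bar>\<Sum>h\<in>?H - J. P h - p k * p l\<bar>"
    unfolding eq[symmetric] by (simp only: abs_mult abs_of_nat power_abs)
  also have "\<dots> \<le> (\<Sum>h\<in>?H - J. \<bar>P h - p k * p l\<bar>)" by (rule sum_abs)
  also have "\<dots> \<le> (\<Sum>h\<in>?H - J. 1)"
  proof (rule sum_mono)
    fix h
    show "\<bar>P h - p k * p l\<bar> \<le> 1" using P[of h] pp by (simp add: abs_le_iff)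
  qed
  also have "\<dots> = real (card (?H - J))" by simp
  also have "\<dots> = real (card ?H) - real (card J)"
  proof -
    have "finite J" using J finH by (rule finite_subset)
    then show ?thesis using J finH by (simp add: card_Diff_subset of_nat_diff card_mono)
  qed
  also have "\<dots> = real n ^ (k + l) - (\<Prod>j<k + l. real (n - j))"
    by (simp add: card_funcsetE J_def card_injective_PiE)
  finally have "\<bar>colour_expectation M n (\<lambda>f. fibre_moment n f k * fibre_moment n f l) - p k * p l\<bar> \<le>
      (real n ^ (k + l) - (\<Prod>j<k + l. real (n - j))) / real n ^ (k + l)"
    using n0 by (subst pos_le_divide_eq) (simp_all only: mult.commute zero_less_power of_nat_0_less_iff)
  then show ?thesis using n0 by (simp add: diff_divide_distrib)
qed

lemma colour_expectation_tendsto: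
  assumes M: "monomial_values p M" and p1: "p 1 = 1" and pos: "\<And>l. 0 \<notin># l \<Longrightarrow> 0 \<le> M l"
    and k: "0 < k" "0 < l"
  shows "(\<lambda>n. colour_expectation M n (\<lambda>f. fibre_moment n f k * fibre_moment n f l)) \<longlonglongrightarrow> p k * p l"
proof (rule LIM_zero_cancel, rule tendsto_rabs_zero_cancel, rule tendsto_sandwich[OF _ _ tendsto_const])
  have "(\<lambda>n. real (n - j) / real n) \<longlonglongrightarrow> 1" for j
  proof -
    have "(\<lambda>n. 1 - real j * inverse (real n)) \<longlonglongrightarrow> 1 - real j * 0"
      by (intro tendsto_intros lim_inverse_n)
    moreover have "\<forall>\<^sub>F n in sequentially. 1 - real j * inverse (real n) = real (n - j) / real n"
      using eventually_gt_at_top[of j]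
      by eventually_elim (simp add: field_simps of_nat_diff)
    ultimately show ?thesis using Lim_transform_eventually by fastforce
  qed
  then have "(\<lambda>n. 1 - (\<Prod>j<k + l. real (n - j) / real n)) \<longlonglongrightarrow> 1 - (\<Prod>j<k + l. 1)"
    by (intro tendsto_diff tendsto_prod tendsto_const)
  then show "(\<lambda>n. 1 - (\<Prod>j<k + l. real (n - j)) / real n ^ (k + l)) \<longlonglongrightarrow> 0"
    by (simp add: prod_dividef)
  show "\<forall>\<^sub>F n in sequentially. \<bar>colour_expectation M n (\<lambda>f. fibre_moment n f k * fibre_moment n f l) - p k * p l\<bar> \<le>
      1 - (\<Prod>j<k + l. real (n - j)) / real n ^ (k + l)"
    using eventually_ge_at_top[of "k + l"]
    by eventually_elim (rule colour_expectation_moments[OF M p1 pos k])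
qed simp

lemma colour_expectation_square:
  "colour_expectation M n (\<lambda>f. (X f - s * Y f)\<^sup>2) = colour_expectation M n (\<lambda>f. X f * X f) +
     ((- 2 * s) * colour_expectation M n (\<lambda>f. X f * Y f) + s\<^sup>2 * colour_expectation M n (\<lambda>f. Y f * Y f))"
  unfolding colour_expectation_def sum_distrib_left sum.distrib[symmetric]
  by (intro sum.cong refl) (simp add: power2_eq_square algebra_simps)

lemma colour_expectation_sum:
  "colour_expectation M n (\<lambda>f. \<Sum>i\<in>I. Z i f) = (\<Sum>i\<in>I. colour_expectation M n (Z i))"
  unfolding colour_expectation_def sum_distrib_left by (rule sum.swap)

lemma fibre_moment_1:
  assumes "f \<in> {..<n} \<rightarrow>\<^sub>E {..<n}" "0 < n"
  shows "fibre_moment n f 1 = 1"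
proof -
  have "(\<Sum>c<n. card {i \<in> {..<n}. f i = c}) = card (\<Union>c<n. {i \<in> {..<n}. f i = c})"
    by (intro card_UN_disjoint[symmetric]) auto
  also have "(\<Union>c<n. {i \<in> {..<n}. f i = c}) = {..<n}" using assms(1) by (auto simp: PiE_iff)
  finally have "(\<Sum>c<n. real (card {i \<in> {..<n}. f i = c})) = real n"
    by (simp flip: of_nat_sum)
  then show ?thesis using assms(2) by (simp add: fibre_moment_def sum_divide_distrib[symmetric])
qed

text \<open>Second moments: the fibre moments concentrate at \<open>p\<close>, so some colouring is close to \<open>p\<close>.\<close>

lemma ex_colouring_near:
  assumes M: "monomial_values p M" and p1: "p 1 = 1" and pos: "\<And>l. 0 \<notin># l \<Longrightarrow> 0 \<le> M l" and e: "0 < e"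
  shows "\<exists>n f. 0 < n \<and> f \<in> {..<n} \<rightarrow>\<^sub>E {..<n} \<and> (\<forall>k\<in>{1..K}. (fibre_moment n f k - p k)\<^sup>2 < e)"
proof -
  let ?E = "colour_expectation M"
  \<comment> \<open>The factor \<open>fibre_moment n f 1\<close> equals 1 for \<open>n > 0\<close>;
    it is kept so that every term of the expanded square is a product of two moments, whose limit is
    known.\<close>
  define V where "V n f = (\<Sum>k\<in>{1..K}. (fibre_moment n f k - p k * fibre_moment n f 1)\<^sup>2)" for n f
  have var: "(\<lambda>n. ?E n (\<lambda>f. (fibre_moment n f k - p k * fibre_moment n f 1)\<^sup>2)) \<longlonglongrightarrow> 0" if "0 < k" for k
  proof -
    have "(\<lambda>n. ?E n (\<lambda>f. fibre_moment n f k * fibre_moment n f k) + ((- 2 * p k) * ?E n (\<lambda>f. fibre_moment n f k * fibre_moment n f 1) +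
        (p k)\<^sup>2 * ?E n (\<lambda>f. fibre_moment n f 1 * fibre_moment n f 1))) \<longlonglongrightarrow> p k * p k + ((- 2 * p k) * (p k * p 1) + (p k)\<^sup>2 * (p 1 * p 1))"
      using that by (intro tendsto_add tendsto_mult tendsto_const colour_expectation_tendsto[OF M p1 pos]) auto
    moreover have "p k * p k + ((- 2 * p k) * (p k * p 1) + (p k)\<^sup>2 * (p 1 * p 1)) = 0"
      by (simp add: p1 power2_eq_square del: One_nat_def)
    ultimately show ?thesis unfolding colour_expectation_square by (simp only:)
  qed
  have "(\<lambda>n. \<Sum>k\<in>{1..K}. ?E n (\<lambda>f. (fibre_moment n f k - p k * fibre_moment n f 1)\<^sup>2)) \<longlonglongrightarrow> (\<Sum>k\<in>{1..K}. 0)"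
    by (intro tendsto_sum var) auto
  then have lim: "(\<lambda>n. ?E n (V n)) \<longlonglongrightarrow> 0"
    unfolding V_def colour_expectation_sum by simp
  \<comment> \<open>The total weight in the form of a product moment; the averaging argument needs
    it bounded away from 0.\<close>
  have one: "(\<lambda>n. ?E n (\<lambda>f. fibre_moment n f 1 * fibre_moment n f 1)) \<longlonglongrightarrow> 1"
    using colour_expectation_tendsto[OF M p1 pos, of 1 1] p1 by simp
  have "\<forall>\<^sub>F n in sequentially. ?E n (V n) < e / 2" using e by (intro order_tendstoD(2)[OF lim]) simp
  moreover have "\<forall>\<^sub>F n in sequentially. 1 / 2 < ?E n (\<lambda>f. fibre_moment n f 1 * fibre_moment n f 1)"
    by (intro order_tendstoD(1)[OF one]) simp
  ultimately have "\<forall>\<^sub>F n in sequentially. ?E n (V n) < e / 2 \<and> 1 / 2 < ?E n (\<lambda>f. fibre_moment n f 1 * fibre_moment n f 1) \<and> 0 < n"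
    using eventually_gt_at_top[of 0] by (intro eventually_conj)
  then obtain n where n: "?E n (V n) < e / 2" "1 / 2 < ?E n (\<lambda>f. fibre_moment n f 1 * fibre_moment n f 1)" "0 < n"
    by (auto simp: eventually_sequentially)
  have "\<exists>f \<in> {..<n} \<rightarrow>\<^sub>E {..<n}. V n f < e"
  proof (rule ccontr)
    assume "\<not> ?thesis"
    then have ge: "e \<le> V n f" if "f \<in> {..<n} \<rightarrow>\<^sub>E {..<n}" for f using that by force
    have w: "0 \<le> colour_weight M n {..<n} f" for f using pos by (rule colour_weight_nonneg) auto
    have "e * ?E n (\<lambda>f. fibre_moment n f 1 * fibre_moment n f 1) = (\<Sum>f\<in>{..<n} \<rightarrow>\<^sub>E {..<n}. colour_weight M n {..<n} f * e)"
      unfolding colour_expectation_def sum_distrib_left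
      by (intro sum.cong refl) (simp only: fibre_moment_1[OF _ n(3)] mult_1_right mult.commute)
    also have "\<dots> \<le> ?E n (V n)"
      unfolding colour_expectation_def using w ge by (intro sum_mono mult_left_mono)
    finally have "e * ?E n (\<lambda>f. fibre_moment n f 1 * fibre_moment n f 1) \<le> ?E n (V n)" .
    moreover have "e * (1 / 2) < e * ?E n (\<lambda>f. fibre_moment n f 1 * fibre_moment n f 1)"
      using n(2) e by (intro mult_strict_left_mono)
    ultimately show False using n(1) by simp
  qed
  then obtain f where f: "f \<in> {..<n} \<rightarrow>\<^sub>E {..<n}" "V n f < e" by blast
  have "(fibre_moment n f k - p k)\<^sup>2 < e" if "k \<in> {1..K}" for k
  proof -
    have "(fibre_moment n f k - p k * fibre_moment n f 1)\<^sup>2 \<le> V n f"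
      unfolding V_def using that by (intro member_le_sum) auto
    then show ?thesis using f(2) fibre_moment_1[OF f(1) n(3)] by simp
  qed
  then show ?thesis using n(3) f(1) by blast
qed

section \<open>Decreasing enumerations and unions of atoms\<close>

text \<open>An element is placed at the position given by the number of elements before it, ties being
  broken by an injection into the natural numbers.\<close>

lemma ex_decreasing_enumeration:
  fixes w :: "'a::countable \<Rightarrow> real"
  assumes pos: "\<And>i. i \<in> I \<Longrightarrow> 0 < w i" and fin: "\<And>e. 0 < e \<Longrightarrow> finite {i \<in> I. e \<le> w i}"
  shows "\<exists>s \<beta>. decseq s \<and> (\<forall>n. 0 \<le> s n) \<and> bij_betw \<beta> {n. 0 < s n} I \<and> (\<forall>n. 0 < s n \<longrightarrow> s n = w (\<beta> n))"
proof -
  define before where "before i j \<longleftrightarrow> w j < w i \<or> (w i = w j \<and> to_nat i < to_nat j)" for i j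
  define D where "D j = {i \<in> I. before i j}" for j
  define rank where "rank j = card (D j)" for j
  have finD: "finite (D j)" if "j \<in> I" for j
    by (rule finite_subset[OF _ fin[OF pos[OF that]]]) (auto simp: D_def before_def)
  have irrefl: "\<not> before i i" for i by (simp add: before_def)
  have trans: "before i k" if "before i j" "before j k" for i j k
    using that unfolding before_def by linarith
  have total: "before i j \<or> before j i" if "i \<noteq> j" for i j
  proof -
    have "to_nat i \<noteq> to_nat j" using that by simp
    then show ?thesis unfolding before_def by linarith
  qed
  have mono: "rank i < rank j" if "i \<in> I" "j \<in> I" "before i j" for i j
    unfolding rank_def
  proof (rule psubset_card_mono[OF finD[OF that(2)]])
    have "i \<in> D j" "i \<notin> D i" using that irrefl by (simp_all add: D_def)
    moreover have "D i \<subseteq> D j" using trans that(3) unfolding D_def by blast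
    ultimately show "D i \<subset> D j" by blast
  qed
  have inj: "inj_on rank I"
  proof (rule inj_onI)
    fix i j assume "i \<in> I" "j \<in> I" "rank i = rank j"
    then show "i = j" using total mono less_irrefl by metis
  qed
  have initial: "m \<in> rank ` I" if j: "j \<in> I" and m: "m < rank j" for j m
  proof -
    have sub: "D j \<subseteq> I" by (auto simp: D_def)
    have "rank ` D j \<subseteq> {..<rank j}" using mono j by (auto simp: D_def)
    moreover have "card (rank ` D j) = card {..<rank j}"
      using card_image[OF inj_on_subset[OF inj sub]] by (simp add: rank_def)
    ultimately have "rank ` D j = {..<rank j}" by (intro card_subset_eq) auto
    then show ?thesis using m sub by blast
  qed
  define \<beta> where "\<beta> = inv_into I rank"
  define s where "s n = (if n \<in> rank ` I then w (\<beta> n) else 0)" for n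
  have s_rank: "s (rank j) = w j" if "j \<in> I" for j
    using that inj by (simp add: s_def \<beta>_def)
  have pos_set: "{n. 0 < s n} = rank ` I"
  proof
    show "rank ` I \<subseteq> {n. 0 < s n}" using s_rank pos by auto
    show "{n. 0 < s n} \<subseteq> rank ` I" by (auto simp: s_def split: if_splits)
  qed
  have nonneg: "0 \<le> s n" for n
  proof (cases "n \<in> rank ` I")
    case True
    then have "0 < s n" using pos_set by blast
    then show ?thesis by simp
  qed (simp add: s_def)
  have "decseq s"
    unfolding decseq_def
  proof (intro allI impI)
    fix n m :: nat assume nm: "n \<le> m"
    show "s m \<le> s n"
    proof (cases "m \<in> rank ` I")
      case False
      then have "s m = 0" by (simp add: s_def)
      then show ?thesis using nonneg by simp
    next
      case True
      then obtain j where j: "j \<in> I" "m = rank j" by blast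
      obtain i where i: "i \<in> I" "n = rank i"
        using initial[OF j(1), of n] nm j True by (cases "n = m") auto
      have "\<not> before j i" using mono[OF j(1) i(1)] nm i j by auto
      then have "w j \<le> w i" by (auto simp: before_def)
      then show ?thesis using s_rank i j by simp
    qed
  qed
  moreover have "bij_betw \<beta> {n. 0 < s n} I"
    unfolding pos_set \<beta>_def by (rule bij_betw_inv_into) (rule inj_on_imp_bij_betw[OF inj])
  moreover have "s n = w (\<beta> n)" if "0 < s n" for n
    using that by (simp add: s_def split: if_splits)
  ultimately show ?thesis using nonneg by blast
qed

lemma has_sum_enumeration:
  fixes w :: "'a \<Rightarrow> real" and s :: "nat \<Rightarrow> real"
  assumes "\<And>n. 0 \<le> s n" "bij_betw \<beta> {n. 0 < s n} I" "\<And>n. 0 < s n \<Longrightarrow> s n = w (\<beta> n)" "0 < k"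
    and "((\<lambda>i. w i ^ k) has_sum S) I"
  shows "(\<lambda>n. s n ^ k) sums S"
proof -
  have "((\<lambda>n. w (\<beta> n) ^ k) has_sum S) {n. 0 < s n}"
    unfolding has_sum_reindex_bij_betw[OF assms(2), of "\<lambda>i. w i ^ k"] by (rule assms(5))
  moreover have "((\<lambda>n. s n ^ k) has_sum S) UNIV \<longleftrightarrow> ((\<lambda>n. w (\<beta> n) ^ k) has_sum S) {n. 0 < s n}"
  proof (rule has_sum_cong_neutral)
    fix n assume "n \<in> UNIV - {n. 0 < s n}"
    then have "s n = 0" using assms(1)[of n] by simp
    then show "s n ^ k = 0" using assms(4) by simp
  next
    fix n assume "n \<in> UNIV \<inter> {n. 0 < s n}"
    then have "0 < s n" by simp
    then show "s n ^ k = w (\<beta> n) ^ k" by (simp only: assms(3)[symmetric])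
  qed simp
  ultimately show ?thesis using has_sum_imp_sums by blast
qed

lemma has_sum_positive_part:
  assumes "(c, q) \<in> KK" "0 < k"
  shows "((\<lambda>i. q i ^ k) has_sum suminf (\<lambda>i. q i ^ k)) {i. 0 < q i}"
proof -
  have "((\<lambda>i. q i ^ k) has_sum suminf (\<lambda>i. q i ^ k)) UNIV"
    using KK_summable_power[OF assms] KK_D(3)[OF assms(1)] by (intro sums_nonneg_imp_has_sum summable_sums) auto
  moreover have "((\<lambda>i. q i ^ k) has_sum suminf (\<lambda>i. q i ^ k)) {i. 0 < q i} \<longleftrightarrow>
      ((\<lambda>i. q i ^ k) has_sum suminf (\<lambda>i. q i ^ k)) UNIV"
  proof (rule has_sum_cong_neutral)
    fix i assume "i \<in> UNIV - {i. 0 < q i}"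
    then have "q i = 0" using KK_D(3)[OF assms(1), of i] by simp
    then show "q i ^ k = 0" using assms(2) by simp
  qed simp_all
  ultimately show ?thesis by blast
qed

lemma atom_union_sums:
  assumes q: "(c, q) \<in> KK" and r: "(c', r) \<in> KK" and s: "\<And>n. 0 \<le> s n" "is_atom_union s q r" and k: "0 < k"
  shows "(\<lambda>n. s n ^ k) sums (suminf (\<lambda>i. q i ^ k) + suminf (\<lambda>i. r i ^ k))"
proof -
  obtain \<beta> where \<beta>: "bij_betw \<beta> {i. 0 < s i} ({i. 0 < q i} <+> {i. 0 < r i})"
      "\<And>i. 0 < s i \<Longrightarrow> s i = case_sum q r (\<beta> i)"
    using s(2) unfolding is_atom_union_def by blast
  have "((\<lambda>x. case_sum q r x ^ k) has_sum suminf (\<lambda>i. q i ^ k)) (Inl ` {i. 0 < q i})"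
    by (subst has_sum_reindex) (auto simp: o_def has_sum_positive_part[OF q k])
  moreover have "((\<lambda>x. case_sum q r x ^ k) has_sum suminf (\<lambda>i. r i ^ k)) (Inr ` {i. 0 < r i})"
    by (subst has_sum_reindex) (auto simp: o_def has_sum_positive_part[OF r k])
  ultimately have union: "((\<lambda>x. case_sum q r x ^ k) has_sum (suminf (\<lambda>i. q i ^ k) + suminf (\<lambda>i. r i ^ k))) ({i. 0 < q i} <+> {i. 0 < r i})"
    unfolding Plus_def by (rule has_sum_Un_disjoint) auto
  show ?thesis
    by (rule has_sum_enumeration[where w = "case_sum q r" and \<beta> = \<beta> and I = "{i. 0 < q i} <+> {i. 0 < r i}"])
      (fact s(1) \<beta> k union)+
qed

lemma finite_KK_large:
  assumes "(c, q) \<in> KK" "0 < e"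
  shows "finite {i. e \<le> q i}"
proof (rule finite_subset)
  show "{i. e \<le> q i} \<subseteq> {..nat \<lfloor>c / e\<rfloor>}"
  proof
    fix i assume "i \<in> {i. e \<le> q i}"
    then have "e \<le> c / real (Suc i)" using KK_decay[OF assms(1), of i] by simp
    then have "real (Suc i) \<le> c / e" using assms(2) by (simp add: field_simps)
    then have "real i \<le> c / e" by simp
    then show "i \<in> {..nat \<lfloor>c / e\<rfloor>}" by (simp add: le_nat_floor)
  qed
qed simp

lemma ex_atom_union:
  assumes q: "(c, q) \<in> KK" and r: "(c', r) \<in> KK"
  shows "\<exists>s. decseq s \<and> (\<forall>i. 0 \<le> s i) \<and> is_atom_union s q r"
proof -
  let ?I = "{i. 0 < q i} <+> {i. 0 < r i}"
  have "finite {i \<in> ?I. e \<le> case_sum q r i}" if "0 < e" for e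
  proof (rule finite_subset)
    show "{i \<in> ?I. e \<le> case_sum q r i} \<subseteq> Inl ` {i. e \<le> q i} \<union> Inr ` {i. e \<le> r i}" by auto
  qed (use finite_KK_large[OF q that] finite_KK_large[OF r that] in simp)
  moreover have "0 < case_sum q r i" if "i \<in> ?I" for i using that by auto
  ultimately obtain s \<beta> where "decseq s" "\<forall>n. 0 \<le> s n" "bij_betw \<beta> {n. 0 < s n} ?I"
      "\<forall>n. 0 < s n \<longrightarrow> s n = case_sum q r (\<beta> n)"
    using ex_decreasing_enumeration[of ?I "case_sum q r"] by blast
  then show ?thesis unfolding is_atom_union_def by blast
qed

lemma atom_union_KK:
  assumes q: "(c, q) \<in> KK" and r: "(c', r) \<in> KK"
    and s: "decseq s" "\<forall>i. 0 \<le> s i" "is_atom_union s q r"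
  shows "(c + c', s) \<in> KK" "suminf s = suminf q + suminf r"
    "\<And>k. 0 < k \<Longrightarrow> psum (c + c') s k = psum c q k + psum c' r k"
proof -
  note sums = atom_union_sums[OF q r s(2)[rule_format] s(3)]
  have sums1: "s sums (suminf q + suminf r)" using sums[of 1] by simp
  then show eq: "suminf s = suminf q + suminf r" by (rule sums_unique[symmetric])
  have "suminf s \<le> c + c'" using KK_D(5)[OF q] KK_D(5)[OF r] by (simp add: eq)
  then show "(c + c', s) \<in> KK" using s sums1 KK_D(1)[OF q] KK_D(1)[OF r] by (auto simp: KK_def sums_iff)
  show "psum (c + c') s k = psum c q k + psum c' r k" if "0 < k" for k
    using sums_unique[OF sums[OF that]] by (simp add: psum_def)
qed

section \<open>Power sums determine the parameters\<close>

text \<open>Remove the common initial entries. If \<open>r i < q i\<close>, the \<open>k\<close>-th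
  power sum of the tail is at least \<open>q i ^ k\<close> on one side and at most
  \<open>r i ^ (k - 1) * c\<close> on the other; dividing by \<open>q i ^ (k - 1)\<close> and
  letting \<open>k\<close> grow gives \<open>q i \<le> 0\<close>.\<close>

lemma psum_eq_imp_le:
  assumes q: "(c, q) \<in> KK" and r: "(c, r) \<in> KK" and eq: "\<And>k. 2 \<le> k \<Longrightarrow> psum c q k = psum c r k"
    and below: "\<And>j. j < i \<Longrightarrow> q j = r j"
  shows "q i \<le> r i"
proof (rule ccontr)
  assume "\<not> q i \<le> r i"
  then have less: "r i < q i" by simp
  have r0: "0 \<le> r i" by (rule KK_D(3)[OF r])
  then have qpos: "0 < q i" using less by linarith
  have bound: "q i \<le> (r i / q i) ^ (k - 1) * c" if k: "2 \<le> k" for k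
  proof -
    have k0: "0 < k" using k by simp
    have pw: "x ^ k = x ^ (k - 1) * x" for x :: real using k0 by (simp only: power_minus_mult)
    have sq: "summable (\<lambda>j. q j ^ k)" and sr: "summable (\<lambda>j. r j ^ k)"
      using KK_summable_power[OF q k0] KK_summable_power[OF r k0] by auto
    have sq': "summable (\<lambda>j. q (j + i) ^ k)" using sq by (subst summable_iff_shift)
    have sr': "summable (\<lambda>j. r (j + i) ^ k)" using sr by (subst summable_iff_shift)
    have "suminf (\<lambda>j. q j ^ k) = suminf (\<lambda>j. r j ^ k)" using eq[OF k] k by (simp add: psum_def)
    moreover have "(\<Sum>j<i. q j ^ k) = (\<Sum>j<i. r j ^ k)" using below by (intro sum.cong) auto
    ultimately have tail: "suminf (\<lambda>j. q (j + i) ^ k) = suminf (\<lambda>j. r (j + i) ^ k)"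
      using suminf_split_initial_segment[OF sq, of i] suminf_split_initial_segment[OF sr, of i] by simp
    have "q i ^ k = (\<Sum>j\<in>{0}. q (j + i) ^ k)" by simp
    also have "\<dots> \<le> suminf (\<lambda>j. q (j + i) ^ k)"
      using KK_D(3)[OF q] by (intro sum_le_suminf[OF sq']) auto
    also have "\<dots> = suminf (\<lambda>j. r (j + i) ^ k)" by (rule tail)
    also have "\<dots> \<le> suminf (\<lambda>j. r i ^ (k - 1) * r (j + i))"
    proof (rule suminf_le[OF _ sr'])
      show "summable (\<lambda>j. r i ^ (k - 1) * r (j + i))"
        using KK_D(4)[OF r] by (intro summable_mult summable_ignore_initial_segment)
      fix j
      have "r (j + i) \<le> r i" using KK_D(2)[OF r] by (simp add: decseq_def)
      then have "r (j + i) ^ (k - 1) * r (j + i) \<le> r i ^ (k - 1) * r (j + i)"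
        using KK_D(3)[OF r] by (intro mult_right_mono power_mono) auto
      then show "r (j + i) ^ k \<le> r i ^ (k - 1) * r (j + i)" unfolding pw .
    qed
    also have "\<dots> = r i ^ (k - 1) * suminf (\<lambda>j. r (j + i))"
      using KK_D(4)[OF r] by (intro suminf_mult summable_ignore_initial_segment)
    also have "\<dots> \<le> r i ^ (k - 1) * c"
    proof (rule mult_left_mono)
      have "0 \<le> (\<Sum>j<i. r j)" using KK_D(3)[OF r] by (intro sum_nonneg)
      then show "suminf (\<lambda>j. r (j + i)) \<le> c"
        using suminf_split_initial_segment[OF KK_D(4)[OF r], of i] KK_D(5)[OF r] by linarith
    qed (use r0 in simp)
    finally have "q i ^ (k - 1) * q i \<le> r i ^ (k - 1) * c" unfolding pw .
    then show ?thesis using qpos by (simp add: power_divide field_simps)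
  qed
  have "(\<lambda>n. (r i / q i) ^ n * c) \<longlonglongrightarrow> 0 * c"
    using less r0 qpos by (intro tendsto_mult tendsto_const LIMSEQ_power_zero) simp
  moreover have "\<exists>N. \<forall>n\<ge>N. q i \<le> (r i / q i) ^ n * c"
  proof (intro exI allI impI)
    fix n :: nat assume "1 \<le> n"
    then show "q i \<le> (r i / q i) ^ n * c" using bound[of "Suc n"] by simp
  qed
  ultimately have "q i \<le> 0 * c" by (rule LIMSEQ_le_const)
  then show False using qpos by simp
qed

lemma psum_inj:
  assumes q: "(c, q) \<in> KK" and r: "(c', r) \<in> KK" and eq: "\<And>k. 0 < k \<Longrightarrow> psum c q k = psum c' r k"
  shows "c = c'" "q = r"
proof -
  show c: "c = c'" using eq[of 1] by (simp add: psum_def)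
  note r' = r[folded c]
  have eq': "psum c q k = psum c r k" if "2 \<le> k" for k using eq[of k] that c by simp
  have "q i = r i" for i
  proof (induction i rule: less_induct)
    case (less i)
    show ?case
    proof (rule antisym)
      show "q i \<le> r i" by (rule psum_eq_imp_le[OF q r' eq' less])
      show "r i \<le> q i" by (rule psum_eq_imp_le[OF r' q eq'[symmetric] less[symmetric]])
    qed
  qed
  then show "q = r" ..
qed

text \<open>Two decreasing enumerations of the same atoms have equal power sums, and these determine
  the sequence.\<close>

lemma atom_union_eqI:
  assumes q: "(c, q) \<in> KK" and r: "(c', r) \<in> KK"
    and s: "decseq s" "\<forall>i. 0 \<le> s i" "is_atom_union s q r"
  shows "q \<squnion>\<^sub>a r = s"
  unfolding atom_union_def
proof (rule the_equality)
  fix s' assume s': "decseq s' \<and> (\<forall>i. 0 \<le> s' i) \<and> is_atom_union s' q r"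
  note s'' = conjunct1[OF s'] conjunct1[OF conjunct2[OF s']] conjunct2[OF conjunct2[OF s']]
  show "s' = s"
  proof (rule psum_inj(2)[OF atom_union_KK(1)[OF q r s''] atom_union_KK(1)[OF q r s]])
    show "psum (c + c') s' k = psum (c + c') s k" if "0 < k" for k
      by (simp only: atom_union_KK(3)[OF q r s that] atom_union_KK(3)[OF q r s'' that])
  qed
qed (use s in simp)

lemma atom_union:
  assumes q: "(c, q) \<in> KK" and r: "(c', r) \<in> KK"
  shows "decseq (q \<squnion>\<^sub>a r)" "\<forall>i. 0 \<le> (q \<squnion>\<^sub>a r) i" "is_atom_union (q \<squnion>\<^sub>a r) q r"
proof -
  obtain s where s: "decseq s" "\<forall>i. 0 \<le> s i" "is_atom_union s q r" using ex_atom_union[OF q r] by blast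
  show "decseq (q \<squnion>\<^sub>a r)" "\<forall>i. 0 \<le> (q \<squnion>\<^sub>a r) i" "is_atom_union (q \<squnion>\<^sub>a r) q r"
    unfolding atom_union_eqI[OF q r s] by (fact s)+
qed

section \<open>The topology of the parameter space\<close>

lemma continuous_on_parameter: "continuous_on UNIV (\<lambda>x :: real \<times> (nat \<Rightarrow> real). snd x i)"
  by (rule continuous_on_product_then_coordinatewise[OF continuous_on_snd[OF continuous_on_id]])

lemma closed_KK_bounded: "closed {x \<in> KK. fst x \<le> C}"
proof -
  have "{x \<in> KK. fst x \<le> C} = {x. 0 \<le> fst x} \<inter> {x. fst x \<le> C} \<inter> (\<Inter>i. {x. 0 \<le> snd x i}) \<inter>
      (\<Inter>i. {x. snd x (Suc i) \<le> snd x i}) \<inter> (\<Inter>n. {x. sum (snd x) {..<n} \<le> fst x})"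
  proof (rule Set.set_eqI)
    fix x :: "real \<times> (nat \<Rightarrow> real)"
    obtain c q where x: "x = (c, q)" by (cases x)
    show "x \<in> {x \<in> KK. fst x \<le> C} \<longleftrightarrow> x \<in> {x. 0 \<le> fst x} \<inter> {x. fst x \<le> C} \<inter> (\<Inter>i. {x. 0 \<le> snd x i}) \<inter>
      (\<Inter>i. {x. snd x (Suc i) \<le> snd x i}) \<inter> (\<Inter>n. {x. sum (snd x) {..<n} \<le> fst x})"
      unfolding x by (simp add: KK_iff_partial_sums decseq_Suc_iff) blast
  qed
  moreover have "continuous_on UNIV (\<lambda>x :: real \<times> (nat \<Rightarrow> real). sum (snd x) {..<n})" for n
    by (intro continuous_on_sum continuous_on_parameter)
  ultimately show ?thesis
    by (simp only:) (intro closed_Int closed_INT ballI closed_Collect_le continuous_on_parameter continuous_on_const continuous_on_fst continuous_on_id)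
qed

text \<open>The bound on \<open>c\<close> confines every coordinate to \<open>{0..C}\<close>;
  compactness then follows from Tychonoff's theorem and closedness.\<close>

lemma compact_KK_bounded: "compact {x \<in> KK. fst x \<le> C}"
proof -
  have "compact (PiE UNIV (\<lambda>_ :: nat. {0..C}))"
  proof -
    have "compactin (product_topology (\<lambda>_ :: nat. euclidean) UNIV) (PiE UNIV (\<lambda>_. {0..C}))"
      unfolding compactin_PiE by simp
    then show ?thesis unfolding euclidean_product_topology by simp
  qed
  then have "compact ({0..C} \<times> PiE UNIV (\<lambda>_ :: nat. {0..C}))" by (intro compact_Times) auto
  moreover have "{x \<in> KK. fst x \<le> C} \<subseteq> {0..C} \<times> PiE UNIV (\<lambda>_ :: nat. {0..C})"
  proof
    fix x assume x: "x \<in> {x \<in> KK. fst x \<le> C}"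
    obtain c q where cq: "x = (c, q)" by (cases x)
    have KK: "(c, q) \<in> KK" "c \<le> C" using x by (auto simp: cq)
    have "q i \<le> C" for i using KK_le[OF KK(1), of i] KK(2) by linarith
    then show "x \<in> {0..C} \<times> PiE UNIV (\<lambda>_ :: nat. {0..C})"
      using KK_D(1,3)[OF KK(1)] KK(2) by (auto simp: cq)
  qed
  ultimately show ?thesis
    using compact_Int_closed[of "{0..C} \<times> PiE UNIV (\<lambda>_ :: nat. {0..C})", OF _ closed_KK_bounded[of C]]
    by (simp add: Int_absorb1)
qed

text \<open>For \<open>k = 1\<close> atoms may dissolve into dust, but the value is the coordinate
  \<open>c\<close>. For \<open>k \<ge> 2\<close> the decay of the entries dominates the series by a
  multiple of the sum of \<open>(i + 1)^(-k)\<close>, uniformly along the sequence because the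
  values of \<open>c\<close> are bounded; Tannery's theorem applies.\<close>

lemma psum_tendsto:
  assumes x: "\<And>n. x n \<in> KK" and l: "l \<in> KK" "x \<longlonglongrightarrow> l" and k: "0 < k"
  shows "(\<lambda>n. psum (fst (x n)) (snd (x n)) k) \<longlonglongrightarrow> psum (fst l) (snd l) k"
proof (cases "k = 1")
  case True
  then show ?thesis using tendsto_fst[OF l(2)] by (simp add: psum_def)
next
  case False
  then have k2: "2 \<le> k" using k by simp
  have fst_lim: "(\<lambda>n. fst (x n)) \<longlonglongrightarrow> fst l" by (rule tendsto_fst[OF l(2)])
  from convergent_imp_Bseq[OF convergentI[OF this]] obtain C where C: "\<bar>fst (x n)\<bar> \<le> C" for n
    unfolding Bseq_def real_norm_def by blast
  have coord: "(\<lambda>n. snd (x n) i ^ k) \<longlonglongrightarrow> snd l i ^ k" for i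
    by (intro tendsto_power continuous_on_tendsto_compose[OF continuous_on_parameter l(2)]) auto
  have KK: "(fst (x n), snd (x n)) \<in> KK" for n using x by simp
  have bound: "norm (snd (x n) i ^ k) \<le> C ^ k * inverse (real (Suc i) ^ k)" for n i
  proof -
    have "snd (x n) i \<le> fst (x n) / real (Suc i)" by (rule KK_decay[OF KK])
    also have "\<dots> \<le> C / real (Suc i)" using C[of n] by (intro divide_right_mono) auto
    finally have "snd (x n) i ^ k \<le> (C / real (Suc i)) ^ k" using KK_D(3)[OF KK] by (intro power_mono)
    moreover have "(C / real (Suc i)) ^ k = C ^ k * inverse (real (Suc i) ^ k)"
      by (simp only: power_divide) (simp only: divide_inverse)
    ultimately show ?thesis using KK_D(3)[OF KK[of n], of i] by (simp del: of_nat_Suc)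
  qed
  have summ: "summable (\<lambda>i. C ^ k * inverse (real (Suc i) ^ k))"
    using inverse_power_summable[OF k2, where 'a = real] by (intro summable_mult) (subst summable_Suc_iff)
  have "\<forall>\<^sub>F (i, n) in at_top \<times>\<^sub>F sequentially. norm (snd (x n) i ^ k) \<le> C ^ k * inverse (real (Suc i) ^ k)"
    by (rule always_eventually) (simp only: case_prod_beta bound, simp)
  from tannerys_theorem[OF coord this summ]
  have "(\<lambda>n. suminf (\<lambda>i. snd (x n) i ^ k)) \<longlonglongrightarrow> suminf (\<lambda>i. snd l i ^ k)"
    by simp
  then show ?thesis using False by (simp add: psum_def)
qed

section \<open>Nonnegative values are power sums\<close>

lemma normalised_values_KK:
  assumes M: "monomial_values p M" and p1: "p 1 = 1" and pos: "\<And>l. 0 \<notin># l \<Longrightarrow> 0 \<le> M l"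
  shows "\<exists>q. (1, q) \<in> KK \<and> (\<forall>k>0. p k = psum 1 q k)"
proof -
  \<comment> \<open>One index \<open>K\<close> governs both the number of power sums and the
    tolerance, so that a single sequence of parameters approximates all of \<open>p\<close>.\<close>
  have "\<exists>s. (1, s) \<in> KK \<and> (\<forall>k\<in>{1..K}. (psum 1 s k - p k)\<^sup>2 < inverse (real (Suc K)))" for K
  proof -
    have "0 < inverse (real (Suc K))" by simp
    from ex_colouring_near[OF M p1 pos this, of K] obtain n f where n: "0 < n" "f \<in> {..<n} \<rightarrow>\<^sub>E {..<n}"
        and near: "\<forall>k\<in>{1..K}. (fibre_moment n f k - p k)\<^sup>2 < inverse (real (Suc K))"
      by blast
    define w where "w c = real (card {i \<in> {..<n}. f i = c}) / real n" for c
    define I where "I = {c \<in> {..<n}. 0 < w c}"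
    have I: "finite I" "I \<subseteq> {..<n}" "\<And>c. c \<in> I \<Longrightarrow> 0 < w c" by (auto simp: I_def)
    have "finite {c \<in> I. e \<le> w c}" for e using I(1) by simp
    from ex_decreasing_enumeration[of I w, OF I(3) this] obtain s \<beta> where
      s': "decseq s \<and> (\<forall>m. 0 \<le> s m) \<and> bij_betw \<beta> {m. 0 < s m} I \<and> (\<forall>m. 0 < s m \<longrightarrow> s m = w (\<beta> m))"
      by blast
    then have s: "decseq s" "0 \<le> s m" "bij_betw \<beta> {m. 0 < s m} I" "0 < s m \<Longrightarrow> s m = w (\<beta> m)" for m
      by (rule conjunct1, use s' in blast, use s' in blast, use s' in blast)
    have sums: "(\<lambda>m. s m ^ k) sums fibre_moment n f k" if k: "0 < k" for k
    proof (rule has_sum_enumeration[OF s(2-4) k])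
      have w0: "0 \<le> w c" for c by (simp add: w_def)
      have "w c ^ k = 0" if "c \<in> {..<n} - I" for c
      proof -
        have "\<not> 0 < w c" using that by (simp add: I_def)
        then have "w c = 0" using w0[of c] by simp
        then show ?thesis using k by simp
      qed
      then have "fibre_moment n f k = (\<Sum>c\<in>I. w c ^ k)"
        unfolding fibre_moment_def w_def[symmetric] using I(2) by (intro sum.mono_neutral_right) auto
      then show "((\<lambda>c. w c ^ k) has_sum fibre_moment n f k) I"
        using has_sum_finite[OF I(1)] by simp
    qed
    have sums1: "s sums 1" using sums[of 1] fibre_moment_1[OF n(2,1)] by simp
    have KK: "(1, s) \<in> KK" using s(1,2) sums1 by (simp add: KK_def sums_iff)
    have "psum 1 s k = fibre_moment n f k" if "k \<in> {1..K}" for k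
    proof (cases "k = 1")
      case True
      then show ?thesis using fibre_moment_1[OF n(2,1)] by (simp add: psum_def)
    next
      case False
      then show ?thesis using sums_unique[OF sums[of k]] that by (simp add: psum_def)
    qed
    then have "(psum 1 s k - p k)\<^sup>2 < inverse (real (Suc K))" if "k \<in> {1..K}" for k
      using bspec[OF near that] that by simp
    then show ?thesis using KK by blast
  qed
  then have "\<forall>K. \<exists>s. (1, s) \<in> KK \<and> (\<forall>k\<in>{1..K}. (psum 1 s k - p k)\<^sup>2 < inverse (real (Suc K)))" by blast
  from choice[OF this] obtain s where
    s': "\<forall>K. (1, s K) \<in> KK \<and> (\<forall>k\<in>{1..K}. (psum 1 (s K) k - p k)\<^sup>2 < inverse (real (Suc K)))"
    by blast
  have s: "(1, s K) \<in> KK" for K using s' by blast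
  have near: "(psum 1 (s K) k - p k)\<^sup>2 < inverse (real (Suc K))" if "k \<in> {1..K}" for K k
    using s' that by blast
  have lim: "(\<lambda>K. psum 1 (s K) k) \<longlonglongrightarrow> p k" if k: "0 < k" for k
  proof -
    have "(\<lambda>K. (psum 1 (s K) k - p k)\<^sup>2) \<longlonglongrightarrow> 0"
    proof (rule tendsto_sandwich[OF _ _ tendsto_const LIMSEQ_inverse_real_of_nat])
      show "\<forall>\<^sub>F K in sequentially. (psum 1 (s K) k - p k)\<^sup>2 \<le> inverse (real (Suc K))"
        using eventually_ge_at_top[of k]
      proof eventually_elim
        case (elim K)
        then have "k \<in> {1..K}" using k by simp
        then show ?case using near by (intro less_imp_le)
      qed
    qed simp
    then have "(\<lambda>K. psum 1 (s K) k - p k) \<longlonglongrightarrow> 0" by simp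
    then show ?thesis by (rule LIM_zero_cancel)
  qed
  have comp: "seq_compact {x \<in> KK. fst x \<le> 1}" by (rule compact_imp_seq_compact[OF compact_KK_bounded])
  have mem: "\<forall>K. (1, s K) \<in> {x \<in> KK. fst x \<le> 1}" using s by simp
  have "\<exists>l\<in>{x \<in> KK. fst x \<le> 1}. \<exists>\<rho>. strict_mono \<rho> \<and> ((\<lambda>K. (1, s K)) \<circ> \<rho>) \<longlonglongrightarrow> l"
    by (rule mp[OF spec[OF comp[unfolded seq_compact_def], of "\<lambda>K. (1, s K)"] mem])
  then obtain l \<rho> where
    l: "l \<in> {x \<in> KK. fst x \<le> 1}" "strict_mono \<rho>" "((\<lambda>K. (1, s K)) \<circ> \<rho>) \<longlonglongrightarrow> l"
    by (elim bexE exE conjE) (rule that)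
  have "p k = psum (fst l) (snd l) k" if k: "0 < k" for k
  proof (rule LIMSEQ_unique)
    show "(\<lambda>K. psum 1 (s (\<rho> K)) k) \<longlonglongrightarrow> p k"
      using LIMSEQ_subseq_LIMSEQ[OF lim[OF k] l(2)] by (simp add: o_def)
    define y where "y n = (1 :: real, s (\<rho> n))" for n
    have "y = (\<lambda>K. (1, s K)) \<circ> \<rho>" by (simp add: fun_eq_iff y_def)
    then have lim_y: "y \<longlonglongrightarrow> l" using l(3) by (simp only:)
    have "y n \<in> KK" for n using s by (simp add: y_def)
    moreover have "l \<in> KK" using l(1) by simp
    ultimately have "(\<lambda>n. psum (fst (y n)) (snd (y n)) k) \<longlonglongrightarrow> psum (fst l) (snd l) k"
      using psum_tendsto[of y l k] lim_y k by blast
    then show "(\<lambda>K. psum 1 (s (\<rho> K)) k) \<longlonglongrightarrow> psum (fst l) (snd l) k" by (simp add: y_def)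
  qed
  note eq = this
  have "fst l = 1" using eq[of 1] p1 by (simp add: psum_def)
  obtain a q where l': "l = (a, q)" by (cases l)
  have "(1, q) \<in> KK" using l(1) \<open>fst l = 1\<close> by (simp add: l')
  moreover have "\<forall>k>0. p k = psum 1 q k" using eq \<open>fst l = 1\<close> by (simp add: l')
  ultimately show ?thesis by blast
qed

lemma KK_scale:
  assumes "(c, q) \<in> KK" "0 \<le> a"
  shows "(a * c, \<lambda>i. a * q i) \<in> KK"
proof -
  note q = KK_D[OF assms(1)]
  have "suminf (\<lambda>i. a * q i) = a * suminf q" by (rule suminf_mult[OF q(4)])
  then have "suminf (\<lambda>i. a * q i) \<le> a * c" using mult_left_mono[OF q(5) assms(2)] by simp
  moreover have "decseq (\<lambda>i. a * q i)"
    unfolding decseq_def using q(2) assms(2) by (simp add: decseq_def mult_left_mono)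
  moreover have "0 \<le> a * c" "0 \<le> a * q i" for i using q(1,3) assms(2) by simp_all
  ultimately show ?thesis using summable_mult[OF q(4), of a] by (simp add: KK_def)
qed

lemma psum_scale:
  assumes "(c, q) \<in> KK" "0 < k"
  shows "psum (a * c) (\<lambda>i. a * q i) k = a ^ k * psum c q k"
  using suminf_mult[OF KK_summable_power[OF assms], of "a ^ k"] by (simp add: psum_def power_mult_distrib)

lemma KK_zero: "(0, \<lambda>_. 0) \<in> KK"
  by (simp add: KK_def decseq_def)

lemma nonneg_values_KK:
  assumes M: "monomial_values p M" and pos: "\<And>l. 0 \<notin># l \<Longrightarrow> 0 \<le> M l"
  shows "\<exists>c q. (c, q) \<in> KK \<and> (\<forall>k>0. p k = psum c q k)"
proof -
  have single: "M {#k#} = p k" if "0 < k" for k by (rule monomial_values_single[OF M that])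
  have "0 \<le> p 1" using pos[of "{#1#}"] single[of 1] by simp
  then consider "p 1 = 0" | "0 < p 1" by linarith
  then show ?thesis
  proof cases
    case 1
    have "p k = 0" if "0 < k" for k
    proof (cases "k = 1")
      case False
      then obtain j where j: "k = 1 + j" "0 < j" using \<open>0 < k\<close> by (cases k) auto
      \<comment> \<open>The product \<open>p 1 * p j\<close> vanishes and is a sum of two
        nonnegative values, so a zero first power sum forces all higher ones to be zero.\<close>
      have "M {#1, j#} + M {#1 + j#} = 0"
        using monomial_values_rec[OF M, of 1 "{#j#}"] j 1 by simp
      moreover have "0 \<le> M {#1, j#}" "0 \<le> M {#1 + j#}" using j by (auto intro!: pos)
      ultimately have "M {#1 + j#} = 0" by linarith
      then show ?thesis using single[of k] that j by simp
    qed (use 1 in simp)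
    then have "\<forall>k>0. p k = psum 0 (\<lambda>_. 0) k" by (simp add: psum_def power_0_left)
    then show ?thesis using KK_zero by blast
  next
    case 2
    define a where "a = inverse (p 1)"
    have a: "0 < a" "a * p 1 = 1" using 2 by (simp_all add: a_def)
    have "\<exists>q. (1, q) \<in> KK \<and> (\<forall>k>0. a ^ k * p k = psum 1 q k)"
    proof (rule normalised_values_KK[OF monomial_values_scale[OF M, of a]])
      show "a ^ 1 * p 1 = 1" using a by simp
      show "0 \<le> a ^ \<Sum>\<^sub># l * M l" if "0 \<notin># l" for l using pos[OF that] a by simp
    qed
    then obtain q where q: "(1, q) \<in> KK" "\<And>k. 0 < k \<Longrightarrow> a ^ k * p k = psum 1 q k" by blast
    have "p k = psum (p 1 * 1) (\<lambda>i. p 1 * q i) k" if "0 < k" for k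
    proof -
      have "psum (p 1 * 1) (\<lambda>i. p 1 * q i) k = (p 1) ^ k * (a ^ k * p k)"
        by (simp only: psum_scale[OF q(1) that] q(2)[OF that])
      also have "\<dots> = (a * p 1) ^ k * p k" by (simp add: power_mult_distrib)
      finally show ?thesis unfolding a(2) by simp
    qed
    then have "\<forall>k>0. p k = psum (p 1 * 1) (\<lambda>i. p 1 * q i) k" by (intro allI impI)
    moreover have "(p 1 * 1, \<lambda>i. p 1 * q i) \<in> KK" by (rule KK_scale[OF q(1) less_imp_le[OF 2]])
    ultimately show ?thesis by (intro exI conjI)
  qed
qed

section \<open>The parametrisation\<close>

lemma UPC_imp_Psi:
  assumes "\<phi> \<in> UPC"
  shows "\<exists>c q. (c, q) \<in> KK \<and> \<phi> = \<Psi> c q"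
proof -
  note \<phi> = UPC_D[OF assms]
  define M where "M = (\<lambda>l. \<phi> (bF (path_tree l)))"
  have M: "monomial_values (\<lambda>k. M {#k#}) M"
    unfolding M_def by (rule character_values(2)[OF \<phi>(1-3)])
  have "0 \<le> M l" for l using \<phi>(2) by (simp add: M_def basis_positive_def)
  then obtain c q where cq: "(c, q) \<in> KK" "\<forall>k>0. M {#k#} = psum c q k"
    using nonneg_values_KK[OF M] by blast
  have "\<phi> = \<Psi> c q"
    by (rule UPC_eqI[OF assms linear_Psi[OF cq(1)] KK_values(1)[OF cq(1)] Psi_bF[OF cq(1)]])
      (use cq(2) in \<open>simp add: M_def\<close>)
  then show ?thesis using cq(1) by blast
qed

lemma UPC_eq: "UPC = (\<lambda>(c, q). \<Psi> c q) ` KK"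
  using UPC_imp_Psi Psi_UPC by fastforce

lemma Psi_inj:
  assumes "(c, q) \<in> KK" "(c', r) \<in> KK"
    and "\<And>k. 0 < k \<Longrightarrow> \<Psi> c q (bF (path_tree {#k#})) = \<Psi> c' r (bF (path_tree {#k#}))"
  shows "c = c'" "q = r"
proof -
  have "psum c q k = psum c' r k" if "0 < k" for k
    using assms(3)[OF that] by (simp only: Psi_path_tree[OF assms(1) that] Psi_path_tree[OF assms(2) that])
  then show "c = c'" "q = r" using psum_inj[OF assms(1,2)] by blast+
qed

lemma UPC_ext:
  assumes "\<phi> \<in> UPC" "\<psi> \<in> UPC" "\<And>k. 0 < k \<Longrightarrow> \<phi> (bF (path_tree {#k#})) = \<psi> (bF (path_tree {#k#}))"
  shows "\<phi> = \<psi>"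
proof -
  obtain c q where 1: "(c, q) \<in> KK" "\<phi> = \<Psi> c q" using UPC_imp_Psi[OF assms(1)] by blast
  obtain c' r where 2: "(c', r) \<in> KK" "\<psi> = \<Psi> c' r" using UPC_imp_Psi[OF assms(2)] by blast
  show ?thesis using Psi_inj[OF 1(1) 2(1) assms(3)[unfolded 1(2) 2(2)]] by (simp add: 1(2) 2(2))
qed

section \<open>Continuity of the parametrisation and of its inverse\<close>

text \<open>The shift drops the meaningless power sum of index 0; coordinate 0 is then
  \<open>c\<close>.\<close>

definition power_sums :: "real \<times> (nat \<Rightarrow> real) \<Rightarrow> nat \<Rightarrow> real" where
  "power_sums x = (\<lambda>k. psum (fst x) (snd x) (Suc k))"

lemma inj_on_power_sums: "inj_on power_sums KK"
proof (rule inj_onI)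
  fix x y assume xy: "x \<in> KK" "y \<in> KK" "power_sums x = power_sums y"
  obtain c q c' r where x: "x = (c, q)" and y: "y = (c', r)" by (cases x, cases y)
  have "psum c q k = psum c' r k" if "0 < k" for k
    using fun_cong[OF xy(3), of "k - 1"] that by (simp add: power_sums_def x y)
  from psum_inj[OF xy(1)[unfolded x] xy(2)[unfolded y] this] show "x = y" by (simp add: x y)
qed

lemma continuous_on_power_sums: "continuous_on KK power_sums"
proof (rule continuous_on_coordinatewise_then_product)
  fix k
  show "continuous_on KK (\<lambda>x. power_sums x k)"
    unfolding continuous_on_sequentially power_sums_def o_def
    by (blast intro: psum_tendsto[OF _ _ _ zero_less_Suc])
qed

text \<open>A continuous injection of a noncompact space need not have a continuous inverse. Here
  coordinate 0 of the image is \<open>c\<close>, so near \<open>y\<close> the image agrees with that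
  of a compact slice of \<open>KK\<close>, where the inverse is continuous.\<close>

lemma continuous_on_inv_power_sums: "continuous_on (power_sums ` KK) (inv_into KK power_sums)"
  (is "continuous_on ?S ?g")
  unfolding continuous_on_def
proof
  fix y assume y: "y \<in> ?S"
  \<comment> \<open>The margin 1 makes the condition \<open>z 0 < C\<close> an open neighbourhood of
    \<open>y\<close>.\<close>
  define C where "C = y 0 + 1"
  define K where "K = {x \<in> KK. fst x \<le> C}"
  have "continuous_on (power_sums ` K) ?g"
  proof (rule continuous_on_inv)
    show "continuous_on K power_sums" unfolding K_def
      by (rule continuous_on_subset[OF continuous_on_power_sums]) blast
    show "compact K" unfolding K_def by (rule compact_KK_bounded)
    show "\<forall>x\<in>K. ?g (power_sums x) = x" using inj_on_power_sums by (simp add: K_def)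
  qed
  moreover have mem: "power_sums x \<in> power_sums ` K" if "x \<in> KK" "power_sums x 0 < C" for x
    using that by (simp add: K_def power_sums_def psum_def)
  then have "y \<in> power_sums ` K" using y by (auto simp: C_def)
  ultimately have "(?g \<longlongrightarrow> ?g y) (at y within power_sums ` K)" unfolding continuous_on_def by blast
  moreover have "at y within ?S = at y within power_sums ` K"
  proof (rule at_within_nhd)
    show "open {z :: nat \<Rightarrow> real. z 0 < C}"
      by (intro open_Collect_less continuous_on_const continuous_on_product_then_coordinatewise[OF continuous_on_id])
    show "y \<in> {z. z 0 < C}" by (simp add: C_def)
    show "?S \<inter> {z. z 0 < C} - {y} = power_sums ` K \<inter> {z. z 0 < C} - {y}"
      using mem by (auto simp: K_def)
  qed
  ultimately show "(?g \<longlongrightarrow> ?g y) (at y within ?S)" by simp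
qed

lemma topspace_UPC_top: "topspace UPC_top = UPC"
  by (simp add: UPC_top_def topspace_pullback_topology)

lemma continuous_map_UPC_eval: "continuous_map UPC_top euclideanreal (\<lambda>\<phi>. \<phi> (bF t))"
proof -
  have "continuous_map euclidean euclideanreal (\<lambda>v :: rtree \<Rightarrow> real. v t)"
    by (simp add: continuous_on_product_then_coordinatewise[OF continuous_on_id])
  from continuous_map_pullback[OF this, of UPC "\<lambda>\<phi> t. \<phi> (bF t)"] show ?thesis
    by (simp add: UPC_top_def o_def)
qed

lemma continuous_map_into_UPC:
  assumes "\<And>t. continuous_map X euclideanreal (\<lambda>x. f x (bF t))" "\<And>x. x \<in> topspace X \<Longrightarrow> f x \<in> UPC"
  shows "continuous_map X UPC_top f"
  unfolding UPC_top_def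
proof (rule continuous_map_pullback')
  show "continuous_map X (euclidean :: (rtree \<Rightarrow> real) topology) ((\<lambda>\<phi> t. \<phi> (bF t)) \<circ> f)"
    unfolding euclidean_product_topology[symmetric] continuous_map_componentwise_UNIV o_def
    using assms(1) by blast
  show "topspace X \<subseteq> f -` UPC" using assms(2) by blast
qed

lemma continuous_map_Psi: "continuous_map (top_of_set KK) UPC_top (\<lambda>(c, q). \<Psi> c q)"
proof (rule continuous_map_into_UPC)
  fix t
  show "continuous_map (top_of_set KK) euclideanreal (\<lambda>x. (case x of (c, q) \<Rightarrow> \<Psi> c q) (bF t))"
    unfolding continuous_map_iff_continuous continuous_on_sequentially
  proof (intro allI ballI impI, elim conjE)
    fix x :: "nat \<Rightarrow> real \<times> (nat \<Rightarrow> real)" and l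
    assume l: "l \<in> KK" and x: "\<forall>n. x n \<in> KK" and lim: "x \<longlonglongrightarrow> l"
    have KK: "(fst (x n), snd (x n)) \<in> KK" for n using x by simp
    have KKl: "(fst l, snd l) \<in> KK" using l by simp
    have "(\<lambda>n. KK_values (fst (x n)) (snd (x n)) m) \<longlonglongrightarrow> KK_values (fst l) (snd l) m" if "0 \<notin># m" for m
      by (rule monomial_values_tendsto[OF KK_values(1)[OF KK] KK_values(1)[OF KKl] _ that])
        (rule psum_tendsto[OF _ l lim], use x in auto)
    then have "(\<lambda>n. tree_values (KK_values (fst (x n)) (snd (x n))) t) \<longlonglongrightarrow> tree_values (KK_values (fst l) (snd l)) t"
      using zero_notin_nverts by (simp add: tree_values_def)
    then show "((\<lambda>x. (case x of (c, q) \<Rightarrow> \<Psi> c q) (bF t)) \<circ> x) \<longlonglongrightarrow> (case l of (c, q) \<Rightarrow> \<Psi> c q) (bF t)"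
      unfolding o_def case_prod_beta Psi_bF[OF KK] Psi_bF[OF KKl] .
  qed
next
  fix x assume "x \<in> topspace (top_of_set KK)"
  then show "(case x of (c, q) \<Rightarrow> \<Psi> c q) \<in> UPC" using Psi_UPC by (cases x) simp
qed

text \<open>A character in \<open>UPC\<close> is recovered from its values at the one-branch path
  trees, so the inverse is evaluation there followed by the inverse of
  \<open>power_sums\<close>.\<close>

lemma homeomorphic_map_Psi: "homeomorphic_map (top_of_set KK) UPC_top (\<lambda>(c, q). \<Psi> c q)"
proof -
  define v where "v \<phi> = (\<lambda>k. \<phi> (bF (path_tree {#Suc k#})))" for \<phi> :: "gl \<Rightarrow> real"
  let ?g = "inv_into KK power_sums"
  have v: "v (\<Psi> c q) = power_sums (c, q)" if "(c, q) \<in> KK" for c q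
    by (simp add: v_def power_sums_def Psi_path_tree[OF that])
  have g: "?g (v (\<Psi> c q)) = (c, q)" if "(c, q) \<in> KK" for c q
    using inj_on_power_sums that by (simp add: v[OF that])
  have "continuous_map UPC_top (top_of_set (power_sums ` KK)) v"
    unfolding continuous_map_in_subtopology
  proof
    show "continuous_map UPC_top euclidean v"
      unfolding euclidean_product_topology[symmetric] continuous_map_componentwise_UNIV v_def
      using continuous_map_UPC_eval by blast
    show "v \<in> topspace UPC_top \<rightarrow> power_sums ` KK"
    proof
      fix \<phi> assume "\<phi> \<in> topspace UPC_top"
      then have "\<phi> \<in> UPC" by (simp only: topspace_UPC_top)
      from UPC_imp_Psi[OF this] obtain c q where "(c, q) \<in> KK" "\<phi> = \<Psi> c q" by blast
      then show "v \<phi> \<in> power_sums ` KK" using v by blast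
    qed
  qed
  moreover have "continuous_map (top_of_set (power_sums ` KK)) (top_of_set KK) ?g"
    unfolding continuous_map_in_subtopology continuous_map_iff_continuous
  proof
    show "?g \<in> topspace (top_of_set (power_sums ` KK)) \<rightarrow> KK"
      using inv_into_into[of _ power_sums KK] by (intro funcsetI) simp
  qed (rule continuous_on_inv_power_sums)
  ultimately have "continuous_map UPC_top (top_of_set KK) (?g \<circ> v)" by (rule continuous_map_compose)
  then have "homeomorphic_maps (top_of_set KK) UPC_top (\<lambda>(c, q). \<Psi> c q) (?g \<circ> v)"
    unfolding homeomorphic_maps_def topspace_UPC_top using continuous_map_Psi g
    by (auto simp: UPC_eq)
  then show ?thesis by (rule homeomorphic_maps_imp_map)
qed

section \<open>The counit, scaling and the nonunital case\<close>

lemma linear_gl_counit: "linear gl_counit"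
  unfolding gl_counit_def by (rule linear_lin_ext)

lemma Psi_zero: "\<Psi> 0 (\<lambda>_. 0) = gl_counit"
proof (rule UPC_eqI[OF Psi_UPC[OF KK_zero] linear_gl_counit monomial_values_counit])
  fix t
  have "t = bullet \<longleftrightarrow> branches t = {#}" by (cases t) (simp add: bullet_def)
  then show "gl_counit (bF t) = tree_values (\<lambda>l. if l = {#} then 1 else 0) t"
    by (simp add: gl_counit_def lin_ext_bF tree_values_def path_forest_def)
next
  fix k :: nat assume "0 < k"
  then show "\<Psi> 0 (\<lambda>_. 0) (bF (path_tree {#k#})) = 0"
    using Psi_path_tree[OF KK_zero] by (simp add: psum_def power_0_left)
qed

lemma psi_char_eq_Psi: "psi_char p = \<Psi> 1 p"
  by (simp add: psi_char_def chi_hom_def \<Psi>_def ev_def)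

text \<open>Scaling the parameters by \<open>c\<close> multiplies the \<open>k\<close>-th power sum
  by \<open>c ^ k\<close>, and the weight of a path forest, the sum of its branch sizes, is
  \<open>nverts t - 1\<close>.\<close>

lemma Psi_homogeneous:
  assumes cq: "(c, q) \<in> KK" and c: "0 < c"
  shows "\<Psi> c q (bF t) = c ^ (nverts t - 1) * psi_char (\<lambda>i. q i / c) (bF t)"
proof -
  let ?q = "\<lambda>i. q i / c"
  have KK1: "(1, ?q) \<in> KK"
    using KK_scale[OF cq, of "1 / c"] c by simp
  have "psum c q k = c ^ k * psum 1 ?q k" if "0 < k" for k
    using psum_scale[OF KK1 that, of c] c by simp
  then have "KK_values c q l = c ^ \<Sum>\<^sub># l * KK_values 1 ?q l" if "0 \<notin># l" for l
    using monomial_values_unique[OF KK_values(1)[OF cq] monomial_values_scale[OF KK_values(1)[OF KK1], of c] _ that] by blast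
  moreover have "\<Sum>\<^sub># (image_mset nverts (branches t)) = nverts t - 1" by (cases t) simp
  ultimately show ?thesis
    using zero_notin_nverts by (simp add: psi_char_eq_Psi Psi_bF[OF cq] Psi_bF[OF KK1] tree_values_def)
qed

lemma nonunital_characters:
  "{\<phi>. gl_character \<phi> \<and> basis_positive \<phi> \<and> \<not> unital \<phi>} = {\<lambda>_. 0}"
proof
  show "{\<lambda>_. 0} \<subseteq> {\<phi>. gl_character \<phi> \<and> basis_positive \<phi> \<and> \<not> unital \<phi>}"
    using linear_zero by (simp add: gl_character_def basis_positive_def unital_def)
qed (use nonunital_character_zero in blast)

section \<open>The convolution monoid\<close>

lemma hconv_Psi:
  assumes q: "(c, q) \<in> KK" and r: "(c', r) \<in> KK"
  shows "(c + c', q \<squnion>\<^sub>a r) \<in> KK" "\<Psi> c q \<star> \<Psi> c' r = \<Psi> (c + c') (q \<squnion>\<^sub>a r)"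
proof -
  note u = atom_union[OF q r]
  show KK: "(c + c', q \<squnion>\<^sub>a r) \<in> KK" by (rule atom_union_KK(1)[OF q r u])
  have "\<Psi> (c + c') (q \<squnion>\<^sub>a r) = \<Psi> c q \<star> \<Psi> c' r"
  proof (rule UPC_eqI[OF Psi_UPC[OF KK] linear_hconv KK_values(1)[OF KK]])
    show "(\<Psi> c q \<star> \<Psi> c' r) (bF t) = tree_values (KK_values (c + c') (q \<squnion>\<^sub>a r)) t" for t
      by (rule hconv_tree_values[OF KK_values(1)[OF q] KK_values(1)[OF r] KK_values(1)[OF KK]
            atom_union_KK(3)[OF q r u] Psi_bF[OF q] Psi_bF[OF r]])
    show "\<Psi> (c + c') (q \<squnion>\<^sub>a r) (bF (path_tree {#k#})) = psum (c + c') (q \<squnion>\<^sub>a r) k" if "0 < k" for k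
      by (rule Psi_path_tree[OF KK that])
  qed
  then show "\<Psi> c q \<star> \<Psi> c' r = \<Psi> (c + c') (q \<squnion>\<^sub>a r)" ..
qed

lemma
  assumes "\<phi> \<in> UPC" "\<psi> \<in> UPC"
  shows hconv_UPC: "\<phi> \<star> \<psi> \<in> UPC"
    and hconv_path_tree: "0 < k \<Longrightarrow> (\<phi> \<star> \<psi>) (bF (path_tree {#k#})) = \<phi> (bF (path_tree {#k#})) + \<psi> (bF (path_tree {#k#}))"
proof -
  obtain c q where 1: "(c, q) \<in> KK" "\<phi> = \<Psi> c q" using UPC_imp_Psi[OF assms(1)] by blast
  obtain c' r where 2: "(c', r) \<in> KK" "\<psi> = \<Psi> c' r" using UPC_imp_Psi[OF assms(2)] by blast
  note h = hconv_Psi[OF 1(1) 2(1)]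
  show "\<phi> \<star> \<psi> \<in> UPC" unfolding 1(2) 2(2) h(2) by (rule Psi_UPC[OF h(1)])
  show "(\<phi> \<star> \<psi>) (bF (path_tree {#k#})) = \<phi> (bF (path_tree {#k#})) + \<psi> (bF (path_tree {#k#}))" if k: "0 < k"
    unfolding 1(2) 2(2) h(2) Psi_path_tree[OF h(1) k] Psi_path_tree[OF 1(1) k] Psi_path_tree[OF 2(1) k]
    by (rule atom_union_KK(3)[OF 1(1) 2(1) atom_union[OF 1(1) 2(1)] k])
qed

lemma gl_counit_UPC: "gl_counit \<in> UPC"
  using Psi_UPC[OF KK_zero] by (simp add: Psi_zero)

lemma gl_counit_path_tree: "0 < k \<Longrightarrow> gl_counit (bF (path_tree {#k#})) = 0"
  using Psi_path_tree[OF KK_zero, of k] by (simp add: Psi_zero psum_def power_0_left)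

text \<open>\<open>UPC_ext\<close> reduces each law to the one-branch path trees, where convolution
  is addition of real numbers and the counit is 0.\<close>

lemma comm_monoid_UPC: "Group.comm_monoid \<lparr>carrier = UPC, mult = (\<star>), one = gl_counit\<rparr>"
proof (rule comm_monoidI)
  let ?G = "\<lparr>carrier = UPC, mult = (\<star>), one = gl_counit\<rparr>"
  fix x y assume "x \<in> carrier ?G" "y \<in> carrier ?G"
  then have xy: "x \<in> UPC" "y \<in> UPC" by simp_all
  show "x \<otimes>\<^bsub>?G\<^esub> y \<in> carrier ?G" using hconv_UPC[OF xy] by simp
  have "x \<star> y = y \<star> x"
    by (rule UPC_ext[OF hconv_UPC[OF xy] hconv_UPC[OF xy(2,1)]]) (simp add: hconv_path_tree xy)
  then show "x \<otimes>\<^bsub>?G\<^esub> y = y \<otimes>\<^bsub>?G\<^esub> x" by simp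
next
  let ?G = "\<lparr>carrier = UPC, mult = (\<star>), one = gl_counit\<rparr>"
  show "\<one>\<^bsub>?G\<^esub> \<in> carrier ?G" using gl_counit_UPC by simp
  fix x y z assume "x \<in> carrier ?G" "y \<in> carrier ?G" "z \<in> carrier ?G"
  then have xyz: "x \<in> UPC" "y \<in> UPC" "z \<in> UPC" by simp_all
  have "x \<star> y \<star> z = x \<star> (y \<star> z)"
    by (rule UPC_ext) (simp_all add: hconv_UPC hconv_path_tree xyz)
  then show "x \<otimes>\<^bsub>?G\<^esub> y \<otimes>\<^bsub>?G\<^esub> z = x \<otimes>\<^bsub>?G\<^esub> (y \<otimes>\<^bsub>?G\<^esub> z)" by simp
next
  let ?G = "\<lparr>carrier = UPC, mult = (\<star>), one = gl_counit\<rparr>"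
  fix x assume "x \<in> carrier ?G"
  then have x: "x \<in> UPC" by simp
  have "gl_counit \<star> x = x"
    by (rule UPC_ext[OF hconv_UPC[OF gl_counit_UPC x] x])
      (simp add: hconv_path_tree gl_counit_UPC x gl_counit_path_tree)
  then show "\<one>\<^bsub>?G\<^esub> \<otimes>\<^bsub>?G\<^esub> x = x" by simp
qed

text \<open>On a fixed tree the convolution is a polynomial in finitely many values of the two
  factors.\<close>

lemma continuous_map_hconv:
  "continuous_map (prod_topology UPC_top UPC_top) UPC_top (\<lambda>(f, g). f \<star> g)"
proof (rule continuous_map_into_UPC)
  fix t
  have fst: "continuous_map (prod_topology UPC_top UPC_top) euclideanreal (\<lambda>x. fst x (bF s))" for s
    using continuous_map_compose[OF continuous_map_fst continuous_map_UPC_eval] by (simp add: o_def)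
  have snd: "continuous_map (prod_topology UPC_top UPC_top) euclideanreal (\<lambda>x. snd x (bF s))" for s
    using continuous_map_compose[OF continuous_map_snd continuous_map_UPC_eval] by (simp add: o_def)
  show "continuous_map (prod_topology UPC_top UPC_top) euclideanreal (\<lambda>x. (case x of (f, g) \<Rightarrow> f \<star> g) (bF t))"
    unfolding case_prod_beta hconv_bF
    by (intro continuous_map_sum continuous_map_real_mult fst snd) simp
next
  fix x assume "x \<in> topspace (prod_topology UPC_top UPC_top)"
  then show "(case x of (f, g) \<Rightarrow> f \<star> g) \<in> UPC"
    using hconv_UPC by (cases x) (simp add: topspace_UPC_top)
qed

text \<open>Once the atoms are united their masses add, so the dust masses add exactly when
  \<open>c'' = c + c'\<close>.\<close>

lemma hconv_Psi_iff:
  assumes q: "(c, q) \<in> KK" and r: "(c', r) \<in> KK" and s: "(c'', s) \<in> KK"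
  shows "\<Psi> c q \<star> \<Psi> c' r = \<Psi> c'' s \<longleftrightarrow> is_atom_union s q r \<and> dust c'' s = dust c q + dust c' r"
proof
  note h = hconv_Psi[OF q r] and u = atom_union[OF q r]
  assume "\<Psi> c q \<star> \<Psi> c' r = \<Psi> c'' s"
  then have "\<Psi> (c + c') (q \<squnion>\<^sub>a r) = \<Psi> c'' s" by (simp only: h(2))
  then have eq: "c + c' = c''" "q \<squnion>\<^sub>a r = s" using Psi_inj[OF h(1) s] by simp_all
  show "is_atom_union s q r \<and> dust c'' s = dust c q + dust c' r"
    using u(3) atom_union_KK(2)[OF q r u] by (simp add: dust_def eq flip: eq(1))
next
  assume a: "is_atom_union s q r \<and> dust c'' s = dust c q + dust c' r"
  have s': "decseq s" "\<forall>i. 0 \<le> s i" using KK_D[OF s] by simp_all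
  note sums = atom_union_KK(2)[OF q r s' conjunct1[OF a]]
  have "c + c' = c''" using conjunct2[OF a] by (simp add: dust_def sums)
  moreover have "q \<squnion>\<^sub>a r = s" by (rule atom_union_eqI[OF q r s' conjunct1[OF a]])
  ultimately show "\<Psi> c q \<star> \<Psi> c' r = \<Psi> c'' s" by (simp only: hconv_Psi(2)[OF q r])
qed

theorem theorem7p1:
  shows
    \<comment> \<open>parametrisation\<close>
    "homeomorphic_map (top_of_set KK) UPC_top (\<lambda>(c, q). \<Psi> c q)
     \<and> \<Psi> 0 (\<lambda>_. 0) = gl_counit
     \<and> (\<forall>c q t. (c, q) \<in> KK \<longrightarrow> 0 < c \<longrightarrow>
          \<Psi> c q (bF t) = c ^ (nverts t - 1) * psi_char (\<lambda>i. q i / c) (bF t))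
     \<and> {\<phi>. gl_character \<phi> \<and> basis_positive \<phi> \<and> \<not> unital \<phi>} = {\<lambda>_. 0}
     \<comment> \<open>commutative topological monoid\<close>
     \<and> Group.comm_monoid \<lparr>carrier = UPC, mult = (\<star>), one = gl_counit\<rparr>
     \<and> continuous_map (prod_topology UPC_top UPC_top) UPC_top (\<lambda>(f, g). f \<star> g)
     \<comment> \<open>the convolution formula\<close>
     \<and> (\<forall>c q c' r. (c, q) \<in> KK \<longrightarrow> (c', r) \<in> KK \<longrightarrow>
          (c + c', q \<squnion>\<^sub>a r) \<in> KK \<and> \<Psi> c q \<star> \<Psi> c' r = \<Psi> (c + c') (q \<squnion>\<^sub>a r))
     \<comment> \<open>equivalent form: atoms are united, dust masses add\<close>
     \<and> (\<forall>c q c' r c'' s. (c, q) \<in> KK \<longrightarrow> (c', r) \<in> KK \<longrightarrow> (c'', s) \<in> KK \<longrightarrow>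
          (\<Psi> c q \<star> \<Psi> c' r = \<Psi> c'' s \<longleftrightarrow>
            is_atom_union s q r \<and> dust c'' s = dust c q + dust c' r))"
proof (intro conjI allI impI)
  show "homeomorphic_map (top_of_set KK) UPC_top (\<lambda>(c, q). \<Psi> c q)" by (rule homeomorphic_map_Psi)
  show "\<Psi> 0 (\<lambda>_. 0) = gl_counit" by (rule Psi_zero)
  show "\<Psi> c q (bF t) = c ^ (nverts t - 1) * psi_char (\<lambda>i. q i / c) (bF t)"
    if "(c, q) \<in> KK" "0 < c" for c q t using that by (rule Psi_homogeneous)
  show "{\<phi>. gl_character \<phi> \<and> basis_positive \<phi> \<and> \<not> unital \<phi>} = {\<lambda>_. 0}" by (rule nonunital_characters)
  show "Group.comm_monoid \<lparr>carrier = UPC, mult = (\<star>), one = gl_counit\<rparr>" by (rule comm_monoid_UPC)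
  show "continuous_map (prod_topology UPC_top UPC_top) UPC_top (\<lambda>(f, g). f \<star> g)"
    by (rule continuous_map_hconv)
  show "(c + c', q \<squnion>\<^sub>a r) \<in> KK" "\<Psi> c q \<star> \<Psi> c' r = \<Psi> (c + c') (q \<squnion>\<^sub>a r)"
    if "(c, q) \<in> KK" "(c', r) \<in> KK" for c q c' r
    using that by (rule hconv_Psi)+
  show "\<Psi> c q \<star> \<Psi> c' r = \<Psi> c'' s \<longleftrightarrow> is_atom_union s q r \<and> dust c'' s = dust c q + dust c' r"
    if "(c, q) \<in> KK" "(c', r) \<in> KK" "(c'', s) \<in> KK" for c q c' r c'' s
    using that by (rule hconv_Psi_iff)
qed

end
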